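(* Let $\boldsymbol{\alpha},\boldsymbol{\beta},\boldsymbol{\gamma}\in\mathbb{Q}^n$ be weakly decreasing $n$-tuples of rational numbers. There exist $A,B,C\in\mathrm{GL}_n(\mathbb{C}\{t\})$ with $ABC=1$ and $l(\mathrm{Sing}(A))=\boldsymbol{\alpha}$, $l(\mathrm{Sing}(B))=\boldsymbol{\beta}$, $l(\mathrm{Sing}(C))=\boldsymbol{\gamma}$ if and only if $(\boldsymbol{\alpha},\boldsymbol{\beta},\boldsymbol{\gamma})$ is the boundary of a hive.
   Context: $\mathbb{C}\{t\}$ is the field of Puiseux series in $t^{-1}$, i.e. $\bigcup_{m\ge1}$ of the fields of Laurent series in $t^{-1/m}$ (finitely many positive powers of $t$) with complex coefficients that converge for all sufficiently large real $t$. $\mathbb{R}\{t\}\subset\mathbb{C}\{t\}$ is the subfield of series with real coefficients; it is a real closed ordered field in which the positive elements are the nonzero series whose leading term (the term with the largest exponent of $t$) has positive coefficient, and $\mathbb{C}\{t\}=\mathbb{R}\{t\}(\sqrt{-1})$ is its algebraic closure. The map $l:\mathbb{C}\{t\}^*\to\mathbb{Q}$ sends a series to the exponent of its leading term. For $A\in\mathrm{GL}_n(\mathbb{C}\{t\})$, $\mathrm{Sing}(A)$ is the weakly decreasing $n$-tuple of singular values of $A$, i.e. of positive square roots in $\mathbb{R}\{t\}$ of the eigenvalues (with multiplicity) of $A^*A$, where $A^*$ is the conjugate transpose; $l(\mathrm{Sing}(A))$ applies $l$ coordinatewise. $\Delta_n$ is the set of triples $(i,j,k)$ of nonnegative integers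 with $i+j+k=n$. A function $h:\Delta_n\to\mathbb{R}$ is a hive if $$h_{(i+1)j(k-1)}+h_{i(j+1)(k-1)}\ge h_{ijk}+h_{(i+1)(j+1)(k-2)},$$ $$h_{(i+1)(j-1)k}+h_{i(j-1)(k+1)}\ge h_{ijk}+h_{(i+1)(j-2)(k+1)},$$ $$h_{(i-1)(j+1)k}+h_{(i-1)j(k+1)}\ge h_{ijk}+h_{(i-2)(j+1)(k+1)}$$ whenever all the indices occurring lie in $\Delta_n$. The boundary of $h$ is the triple of weakly decreasing $n$-tuples $$\begin{aligned}\big(&(h_{(n-1)10}-h_{n00},\,h_{(n-2)20}-h_{(n-1)10},\ldots,h_{0n0}-h_{1(n-1)0}),\\&(h_{0(n-1)1}-h_{0n0},\,h_{0(n-2)2}-h_{0(n-1)1},\ldots,h_{00n}-h_{01(n-1)}),\\&(h_{10(n-1)}-h_{00n},\,h_{20(n-2)}-h_{10(n-1)},\ldots,h_{n00}-h_{(n-1)01})\big).\end{aligned}$$ *)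

theory Defs
  imports
    "HOL-Complex_Analysis.Laurent_Convergence"
    "Jordan_Normal_Form.Schur_Decomposition"
begin

section \<open>Convergent Puiseux series in the inverse of t\<close>

text \<open>A series is represented by its coefficient function: \<open>f q\<close> is the coefficient of the power
  of \<open>t\<close> with exponent \<open>q\<close>.  There are only finitely many terms with positive exponent and they
  do not affect convergence, so the last conjunct (convergence for all sufficiently large real
  \<open>t\<close>) only mentions the terms with exponents \<open>-k/m\<close> for natural \<open>k\<close>.\<close>

definition puiseux_in :: "nat \<Rightarrow> (rat \<Rightarrow> complex) \<Rightarrow> bool" where
  "puiseux_in m f \<longleftrightarrow>
     (\<forall>q. f q \<noteq> 0 \<longrightarrow> of_nat m * q \<in> \<int>) \<and>
     (\<exists>N. \<forall>q. f q \<noteq> 0 \<longrightarrow> q \<le> N) \<and>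
     (\<forall>\<^sub>F t :: real in at_top.
        summable (\<lambda>k. f (- of_nat k / of_nat m) * of_real (t powr (- real k / real m))))"

text \<open>Substitution of the \<open>m\<close>-th root of the inverse of \<open>t\<close> into a formal Laurent series; this
  only serves to derive the field axioms from those of \<open>fls\<close>.\<close>

definition ps_of_fls :: "nat \<Rightarrow> complex fls \<Rightarrow> rat \<Rightarrow> complex" where
  "ps_of_fls m F q = (if of_nat m * q \<in> \<int> then fls_nth F (- \<lfloor>of_nat m * q\<rfloor>) else 0)"

lemma ps_of_fls_nth:
  assumes "m > 0"
  shows "ps_of_fls m F (- of_int i / of_nat m) = fls_nth F i"
proof -
  have "of_nat m * (- of_int i / of_nat m :: rat) = of_int (- i)"
    using assms by simp
  then show ?thesis unfolding ps_of_fls_def by (metis Ints_of_int floor_of_int minus_minus)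
qed

lemma ps_of_fls_cases:
  fixes q :: rat
  assumes "m > 0"
  obtains i where "q = - of_int i / of_nat m" | "of_nat m * q \<notin> \<int>"
proof (cases "of_nat m * q \<in> \<int>")
  case True
  then obtain j where "of_nat m * q = of_int j" by (auto elim: Ints_cases)
  then have "q = - of_int (- j) / of_nat m" using assms by (simp add: field_simps)
  then show ?thesis using that by blast
qed (use that in blast)

lemma ps_of_fls_inj: "m > 0 \<Longrightarrow> ps_of_fls m F = ps_of_fls m G \<Longrightarrow> F = G"
  by (rule fls_eqI) (metis ps_of_fls_nth)

lemma summable_iff_conv_radius:
  fixes a :: "nat \<Rightarrow> complex"
  assumes m: "m > 0"
  shows "(\<forall>\<^sub>F t :: real in at_top. summable (\<lambda>k. a k * of_real (t powr (- real k / real m))))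
    \<longleftrightarrow> conv_radius a > 0"
proof -
  have eq: "a k * of_real (t powr (- real k / real m))
      = a k * (of_real (t powr (- 1 / real m))) ^ k" if "t > 0" for t :: real and k
  proof -
    have "t powr (- real k / real m) = (t powr (- 1 / real m)) ^ k"
      using that by (simp add: powr_powr powr_realpow [symmetric])
    then show ?thesis by simp
  qed
  show ?thesis
  proof
    assume "\<forall>\<^sub>F t :: real in at_top. summable (\<lambda>k. a k * of_real (t powr (- real k / real m)))"
    then have "\<forall>\<^sub>F t :: real in at_top. t > 0 \<and>
        summable (\<lambda>k. a k * of_real (t powr (- real k / real m)))"
      using eventually_gt_at_top[of "0::real"] by eventually_elim simp
    then obtain t :: real where t: "t > 0"
      and s: "summable (\<lambda>k. a k * of_real (t powr (- real k / real m)))"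
      using eventually_happens'[OF trivial_limit_at_top_linorder] by blast
    from s have "summable (\<lambda>k. a k * (complex_of_real (t powr (- 1 / real m))) ^ k)"
      unfolding eq[OF t] .
    from conv_radius_geI[OF this] have "ereal (t powr (- 1 / real m)) \<le> conv_radius a"
      by simp
    moreover have "0 < ereal (t powr (- 1 / real m))" using t by simp
    ultimately show "conv_radius a > 0" by (metis order_less_le_trans)
  next
    assume "conv_radius a > 0"
    then obtain r where r: "r > 0" "ereal r < conv_radius a"
      using ereal_dense2[of 0 "conv_radius a"] by auto
    have "((\<lambda>t. t powr (- 1 / real m)) \<longlongrightarrow> 0) at_top"
      using m by (intro tendsto_neg_powr filterlim_ident) auto
    then have "\<forall>\<^sub>F t in at_top. t powr (- 1 / real m) < r"
      using r by (simp add: order_tendstoD)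
    then show "\<forall>\<^sub>F t :: real in at_top. summable (\<lambda>k. a k * of_real (t powr (- real k / real m)))"
      using eventually_gt_at_top[of "0::real"]
    proof eventually_elim
      case (elim t)
      have "summable (\<lambda>k. a k * (complex_of_real (t powr (- 1 / real m))) ^ k)"
        using elim r by (intro summable_in_conv_radius)
          (auto intro: order_less_trans[where y = "ereal r"])
      then show ?case unfolding eq[OF elim(2)] .
    qed
  qed
qed

lemma puiseux_in_iff_fls:
  assumes m: "m > 0"
  shows "puiseux_in m f \<longleftrightarrow> (\<exists>F. f = ps_of_fls m F \<and> fls_conv_radius F > 0)"
proof
  assume f: "puiseux_in m f"
  then obtain N where N: "\<And>q. f q \<noteq> 0 \<Longrightarrow> q \<le> N" unfolding puiseux_in_def by blast
  define a where "a = (\<lambda>i::int. f (- of_int i / of_nat m))"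
  have "\<forall>i > \<lceil>of_nat m * N\<rceil>. a (- i) = 0"
  proof (intro allI impI, rule ccontr)
    fix i :: int assume i: "i > \<lceil>of_nat m * N\<rceil>" "a (- i) \<noteq> 0"
    then have "of_int i / of_nat m \<le> N" using N by (auto simp: a_def)
    then have "of_int i \<le> of_nat m * N" using m by (simp add: field_simps)
    then have "of_int i \<le> (of_int \<lceil>of_nat m * N\<rceil> :: rat)" using le_of_int_ceiling order_trans by blast
    then show False using i by simp
  qed
  then have nth: "fls_nth (Abs_fls a) = a"
    by (intro ext nth_Abs_fls_lower_bound[of "- \<lceil>of_nat m * N\<rceil>"])
      (metis minus_less_iff minus_minus)
  have "f = ps_of_fls m (Abs_fls a)"
  proof
    fix q show "f q = ps_of_fls m (Abs_fls a) q"
    proof (cases q rule: ps_of_fls_cases[OF m])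
      case (1 i) then show ?thesis by (simp only: ps_of_fls_nth[OF m] nth) (simp add: a_def)
    next
      case 2 then show ?thesis using f unfolding puiseux_in_def ps_of_fls_def by auto
    qed
  qed
  moreover have "fls_nth (Abs_fls a) (int k) = f (- of_nat k / of_nat m)" for k
    by (simp only: nth) (simp add: a_def)
  then have "fls_conv_radius (Abs_fls a) > 0"
    using f summable_iff_conv_radius[OF m, of "\<lambda>k. f (- of_nat k / of_nat m)"]
    by (simp add: puiseux_in_def fls_conv_radius_def fps_conv_radius_def)
  ultimately show "\<exists>F. f = ps_of_fls m F \<and> fls_conv_radius F > 0" by blast
next
  assume "\<exists>F. f = ps_of_fls m F \<and> fls_conv_radius F > 0"
  then obtain F where F: "f = ps_of_fls m F" "fls_conv_radius F > 0" by blast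
  have "q \<le> - of_int (fls_subdegree F) / of_nat m" if "f q \<noteq> 0" for q
  proof (cases q rule: ps_of_fls_cases[OF m])
    case (1 i)
    then have "fls_nth F i \<noteq> 0" using that F ps_of_fls_nth[OF m] by simp
    then have "fls_subdegree F \<le> i" by (rule fls_subdegree_leI)
    then show ?thesis using 1 m by (simp add: divide_right_mono)
  next
    case 2 then show ?thesis using that F by (simp add: ps_of_fls_def)
  qed
  moreover have "of_nat m * q \<in> \<int>" if "f q \<noteq> 0" for q
    using that F by (auto simp: ps_of_fls_def split: if_splits)
  moreover have "f (- of_nat k / of_nat m) = fls_nth F (int k)" for k
    using ps_of_fls_nth[OF m, of F "int k"] F by simp
  ultimately show "puiseux_in m f"
    using F summable_iff_conv_radius[OF m, of "\<lambda>k. f (- of_nat k / of_nat m)"]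
    unfolding puiseux_in_def by (auto simp: fls_conv_radius_def fps_conv_radius_def)
qed

lemma puiseux_in_mult:
  assumes f: "puiseux_in m f" and m: "m > 0" and d: "d > 0"
  shows "puiseux_in (m * d) f"
proof -
  have int: "of_nat m * q \<in> \<int>" if "f q \<noteq> 0" for q using f that by (auto simp: puiseux_in_def)
  have 1: "of_nat (m * d) * q \<in> \<int>" if "f q \<noteq> 0" for q
    using Ints_mult[OF Ints_of_nat[of d] int[OF that]] by (simp add: mult_ac)
  have "summable (\<lambda>k. f (- of_nat k / of_nat (m * d)) * of_real (t powr (- real k / real (m * d))))"
    (is "summable ?b")
    if "summable (\<lambda>k. f (- of_nat k / of_nat m) * of_real (t powr (- real k / real m)))"
    for t :: real
  proof -
    have "summable (\<lambda>k. ?b (d * k)) = summable ?b"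
    proof (rule summable_mono_reindex)
      show "strict_mono ((*) d)" using d by (simp add: strict_mono_def)
      fix k assume k: "k \<notin> range ((*) d)"
      show "?b k = 0"
      proof (rule ccontr)
        assume "?b k \<noteq> 0"
        then have "of_nat m * (- of_nat k / of_nat (m * d) :: rat) \<in> \<int>" using int by force
        also have "of_nat m * (- of_nat k / of_nat (m * d) :: rat) = - (of_nat k / of_nat d)"
          using m by simp
        finally have "(of_nat k / of_nat d :: rat) \<in> \<int>" by simp
        then obtain j where "(of_nat k / of_nat d :: rat) = of_int j" by (auto elim: Ints_cases)
        then have "(of_int (int k) :: rat) = of_int (int d * j)" using d by (simp add: field_simps)
        then have "int d dvd int k" unfolding of_int_eq_iff by simp
        then show False using k by (auto elim!: dvdE)
      qed
    qed
    moreover have "?b (d * k) = f (- of_nat k / of_nat m) * of_real (t powr (- real k / real m))" for k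
      using d by (simp add: divide_simps)
    ultimately show ?thesis using that by simp
  qed
  then show ?thesis using f 1 unfolding puiseux_in_def
    by (auto elim!: eventually_mono)
qed

typedef puiseux = "{f. \<exists>m>0. puiseux_in m f}"
  morphisms coeff_of Abs_puiseux
proof -
  have "(\<lambda>q. 0) = ps_of_fls 1 0" by (auto simp: ps_of_fls_def)
  then have "puiseux_in 1 (\<lambda>q. 0)" using puiseux_in_iff_fls[of 1] by force
  then show ?thesis by auto
qed


setup_lifting type_definition_puiseux

lemma puiseux_in_common:
  assumes "\<exists>m>0. puiseux_in m f" "\<exists>m>0. puiseux_in m g" "\<exists>m>0. puiseux_in m h"
  obtains m F G H where "m > 0"
    "f = ps_of_fls m F" "fls_conv_radius F > 0"
    "g = ps_of_fls m G" "fls_conv_radius G > 0"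
    "h = ps_of_fls m H" "fls_conv_radius H > 0"
proof -
  obtain a b c where abc: "a > 0" "b > 0" "c > 0"
    "puiseux_in a f" "puiseux_in b g" "puiseux_in c h"
    using assms by blast
  have "puiseux_in (a * (b * c)) f" "puiseux_in (b * (a * c)) g" "puiseux_in (c * (a * b)) h"
    using abc by (auto intro!: puiseux_in_mult)
  then have "puiseux_in (a * b * c) f" "puiseux_in (a * b * c) g" "puiseux_in (a * b * c) h"
    by (simp_all add: mult_ac)
  moreover have "a * b * c > 0" using abc by simp
  ultimately show ?thesis using that by (metis puiseux_in_iff_fls)
qed

lemma ps_of_fls_puiseux:
  "m > 0 \<Longrightarrow> fls_conv_radius F > 0 \<Longrightarrow> \<exists>k>0. puiseux_in k (ps_of_fls m F)"
  using puiseux_in_iff_fls by blast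

lemma ps_of_fls_0: "(\<lambda>q. 0) = ps_of_fls m 0"
  by (auto simp: ps_of_fls_def)

lemma ps_of_fls_1: "m > 0 \<Longrightarrow> (\<lambda>q. if q = 0 then 1 else 0) = ps_of_fls m 1"
  by (auto simp: ps_of_fls_def fun_eq_iff elim!: Ints_cases)

lemma ps_of_fls_add: "(\<lambda>q. ps_of_fls m F q + ps_of_fls m G q) = ps_of_fls m (F + G)"
  by (auto simp: ps_of_fls_def)

lemma ps_of_fls_diff: "(\<lambda>q. ps_of_fls m F q - ps_of_fls m G q) = ps_of_fls m (F - G)"
  by (auto simp: ps_of_fls_def)

lemma ps_of_fls_uminus: "(\<lambda>q. - ps_of_fls m F q) = ps_of_fls m (- F)"
  by (auto simp: ps_of_fls_def)

text \<open>In the product, restricting the convolution to the nonzero terms makes the index set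
  finite.\<close>

definition ps_conv :: "(rat \<Rightarrow> complex) \<Rightarrow> (rat \<Rightarrow> complex) \<Rightarrow> rat \<Rightarrow> complex" where
  "ps_conv f g q = (\<Sum>p | f p \<noteq> 0 \<and> g (q - p) \<noteq> 0. f p * g (q - p))"

lemma ps_of_fls_mult:
  assumes m: "m > 0"
  shows "ps_conv (ps_of_fls m F) (ps_of_fls m G) = ps_of_fls m (F * G)"
proof
  fix q
  show "ps_conv (ps_of_fls m F) (ps_of_fls m G) q = ps_of_fls m (F * G) q"
  proof (cases q rule: ps_of_fls_cases[OF m])
    case (1 n)
    let ?r = "\<lambda>i. - of_int i / of_nat m :: rat"
    let ?I = "{i. fls_nth F i \<noteq> 0 \<and> fls_nth G (n - i) \<noteq> 0}"
    let ?P = "{p. ps_of_fls m F p \<noteq> 0 \<and> ps_of_fls m G (q - p) \<noteq> 0}"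
    have qr: "q - ?r i = ?r (n - i)" for i using 1 by (simp add: diff_divide_distrib)
    have P: "?P = ?r ` ?I"
    proof (intro equalityI subsetI)
      fix p assume p: "p \<in> ?P"
      show "p \<in> ?r ` ?I"
      proof (cases p rule: ps_of_fls_cases[OF m])
        case (1 i)
        have "i \<in> ?I" using p unfolding 1 mem_Collect_eq qr ps_of_fls_nth[OF m] .
        then show ?thesis using 1 by blast
      next
        case 2 then show ?thesis using p by (simp add: ps_of_fls_def)
      qed
    next
      fix p assume "p \<in> ?r ` ?I"
      then obtain i where i: "p = ?r i" "i \<in> ?I" by blast
      show "p \<in> ?P" using i(2) unfolding i(1) mem_Collect_eq qr ps_of_fls_nth[OF m] .
    qed
    have inj: "inj_on ?r ?I" using m by (auto simp: inj_on_def)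
    have "ps_conv (ps_of_fls m F) (ps_of_fls m G) q
        = (\<Sum>p\<in>?r ` ?I. ps_of_fls m F p * ps_of_fls m G (q - p))"
      unfolding ps_conv_def P ..
    also have "\<dots> = (\<Sum>i\<in>?I. fls_nth F i * fls_nth G (n - i))"
      unfolding sum.reindex[OF inj] comp_def qr ps_of_fls_nth[OF m] ..
    also have "\<dots> = (\<Sum>i=fls_subdegree F..n - fls_subdegree G. fls_nth F i * fls_nth G (n - i))"
    proof (rule sum.mono_neutral_left)
      show "?I \<subseteq> {fls_subdegree F..n - fls_subdegree G}"
        using fls_subdegree_leI[of F] fls_subdegree_leI[of G] by (force simp: algebra_simps)
    qed auto
    also have "\<dots> = fls_nth (F * G) n" by (rule fls_times_nth(2)[symmetric])
    also have "\<dots> = ps_of_fls m (F * G) q" unfolding 1 ps_of_fls_nth[OF m] ..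
    finally show ?thesis .
  next
    case 2
    have "{p. ps_of_fls m F p \<noteq> 0 \<and> ps_of_fls m G (q - p) \<noteq> 0} = {}"
    proof -
      have "of_nat m * q \<in> \<int>" if "of_nat m * p \<in> \<int>" "of_nat m * (q - p) \<in> \<int>" for p
        using Ints_add[OF that] by (simp add: algebra_simps)
      then show ?thesis using 2 by (auto simp: ps_of_fls_def)
    qed
    then show ?thesis using 2 by (simp only: ps_conv_def) (simp add: ps_of_fls_def)
  qed
qed

instantiation puiseux :: comm_ring_1
begin

lift_definition zero_puiseux :: puiseux is "\<lambda>q. 0"
  using ps_of_fls_puiseux[of 1 0] ps_of_fls_0[of 1] by simp

lift_definition one_puiseux :: puiseux is "\<lambda>q. if q = 0 then 1 else 0"
  using ps_of_fls_puiseux[of 1 1] ps_of_fls_1[of 1] by simp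

lift_definition plus_puiseux :: "puiseux \<Rightarrow> puiseux \<Rightarrow> puiseux" is "\<lambda>f g q. f q + g q"
  subgoal premises prems for f g
    by (rule puiseux_in_common[OF prems(1) prems(2) prems(2)])
      (metis ps_of_fls_add ps_of_fls_puiseux fls_conv_radius_add min_less_iff_conj order_less_le_trans)
  done

lift_definition minus_puiseux :: "puiseux \<Rightarrow> puiseux \<Rightarrow> puiseux" is "\<lambda>f g q. f q - g q"
  subgoal premises prems for f g
    by (rule puiseux_in_common[OF prems(1) prems(2) prems(2)])
      (metis ps_of_fls_diff ps_of_fls_puiseux fls_conv_radius_diff min_less_iff_conj order_less_le_trans)
  done

lift_definition uminus_puiseux :: "puiseux \<Rightarrow> puiseux" is "\<lambda>f q. - f q"
  subgoal premises prems for f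
    by (rule puiseux_in_common[OF prems prems prems])
      (metis ps_of_fls_uminus ps_of_fls_puiseux fls_conv_radius_uminus)
  done

lift_definition times_puiseux :: "puiseux \<Rightarrow> puiseux \<Rightarrow> puiseux" is ps_conv
  subgoal premises prems for f g
    by (rule puiseux_in_common[OF prems(1) prems(2) prems(2)])
      (metis ps_of_fls_mult ps_of_fls_puiseux fls_conv_radius_mult min_less_iff_conj order_less_le_trans)
  done

instance
proof
  fix x y z :: puiseux
  show "x + y + z = x + (y + z)" by transfer (simp add: add_ac)
  show "x + y = y + x" by transfer (simp add: add_ac)
  show "0 + x = x" by transfer simp
  show "- x + x = 0" by transfer simp
  show "x - y = x + - y" by transfer simp
  show "(0::puiseux) \<noteq> 1" by transfer (metis zero_neq_one)
  show "x * y * z = x * (y * z)"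
    by (transfer, erule (2) puiseux_in_common) (simp add: ps_of_fls_mult mult_ac)
  show "x * y = y * x"
    by (transfer, erule (1) puiseux_in_common, assumption) (simp add: ps_of_fls_mult mult_ac)
  show "(x + y) * z = x * z + y * z"
    by (transfer, erule (2) puiseux_in_common)
      (simp add: ps_of_fls_mult ps_of_fls_add distrib_right)
  show "1 * x = x"
  proof transfer
    fix f assume f: "\<exists>m>0. puiseux_in m f"
    show "ps_conv (\<lambda>q. if q = 0 then 1 else 0) f = f"
      by (rule puiseux_in_common[OF f f f]) (simp add: ps_of_fls_mult ps_of_fls_1)
  qed
qed

end

lemma puiseux_inverse_ex:
  fixes x :: puiseux
  assumes "x \<noteq> 0"
  shows "\<exists>y. x * y = 1"
  using assms
proof transfer
  fix f assume f: "\<exists>m>0. puiseux_in m f" and f0: "f \<noteq> (\<lambda>q. 0)"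
  obtain m F where F: "m > 0" "f = ps_of_fls m F" "fls_conv_radius F > 0"
    by (rule puiseux_in_common[OF f f f])
  have "F \<noteq> 0" using f0 F(2) ps_of_fls_0 by metis
  then have "ps_conv f (ps_of_fls m (inverse F)) = (\<lambda>q. if q = 0 then 1 else 0)"
    using F by (simp add: ps_of_fls_mult ps_of_fls_1)
  moreover have "fls_conv_radius (inverse F) > 0"
    using has_laurent_expansion_inverse[OF eval_fls_has_laurent_expansion[OF F(3)]]
    by (simp add: has_laurent_expansion_def)
  ultimately show "\<exists>y\<in>{f. \<exists>m>0. puiseux_in m f}. ps_conv f y = (\<lambda>q. if q = 0 then 1 else 0)"
    using ps_of_fls_puiseux[OF F(1)] by blast
qed

instantiation puiseux :: field
begin

definition inverse_puiseux :: "puiseux \<Rightarrow> puiseux" where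
  "inverse_puiseux x = (if x = 0 then 0 else (THE y. x * y = 1))"

definition divide_puiseux :: "puiseux \<Rightarrow> puiseux \<Rightarrow> puiseux" where
  "divide_puiseux x y = x * inverse y"

instance
proof
  fix x y :: puiseux
  show "inverse x * x = 1" if x: "x \<noteq> 0"
  proof -
    obtain y where y: "x * y = 1" using puiseux_inverse_ex[OF x] by blast
    have "z = y" if "x * z = 1" for z
      using that y by (metis mult.commute mult.left_commute mult.right_neutral)
    then have "(THE y. x * y = 1) = y" using y by blast
    then show ?thesis using x y by (simp add: inverse_puiseux_def mult.commute)
  qed
qed (simp_all add: inverse_puiseux_def divide_puiseux_def)

end

instantiation puiseux :: conjugatable_field
begin

lift_definition conjugate_puiseux :: "puiseux \<Rightarrow> puiseux" is "\<lambda>f q. cnj (f q)"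
  subgoal premises prems for f
  proof -
    obtain m where m: "m > 0" "puiseux_in m f" using prems by blast
    have "summable (\<lambda>k. cnj (f (- of_nat k / of_nat m)) * of_real (t powr (- real k / real m)))"
      if "summable (\<lambda>k. f (- of_nat k / of_nat m) * of_real (t powr (- real k / real m)))"
      for t :: real
      using bounded_linear.summable[OF bounded_linear_cnj that] by simp
    then have "puiseux_in m (\<lambda>q. cnj (f q))"
      using m(2) unfolding puiseux_in_def by (auto elim!: eventually_mono)
    then show ?thesis using m(1) by blast
  qed
  done

instance
proof
  fix x y :: puiseux
  show *: "conjugate (conjugate x) = x" for x :: puiseux by transfer simp
  show "conjugate x = conjugate y \<longleftrightarrow> x = y" by (metis *)
  show "conjugate (x * y) = conjugate x * conjugate y"
    by transfer (simp add: ps_conv_def fun_eq_iff)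
  show "conjugate (x + y) = conjugate x + conjugate y" by transfer simp
  show "conjugate (- x) = - conjugate x" by transfer simp
  show "conjugate (0 :: puiseux) = 0" by transfer simp
qed

end

text \<open>The exponent of the leading term; meaningful for nonzero series only.\<close>

definition lead_exp :: "puiseux \<Rightarrow> rat" where
  "lead_exp x = (GREATEST q. coeff_of x q \<noteq> 0)"

lemma coeff_of_0: "coeff_of 0 q = 0"
  by transfer simp

lemma coeff_of_uminus: "coeff_of (- x) q = - coeff_of x q"
  by transfer simp

lemma lead_exp_properties:
  assumes "x \<noteq> 0"
  shows lead_coeff_nonzero: "coeff_of x (lead_exp x) \<noteq> 0"
    and lead_exp_max: "coeff_of x q \<noteq> 0 \<Longrightarrow> q \<le> lead_exp x"
proof -
  have c: "\<exists>m>0. puiseux_in m (coeff_of x)" using coeff_of[of x] by simp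
  obtain m F where F: "m > 0" "coeff_of x = ps_of_fls m F"
    by (rule puiseux_in_common[OF c c c])
  have "F \<noteq> 0"
  proof
    assume "F = 0"
    then have "coeff_of x = coeff_of 0" by (simp add: F(2) fun_eq_iff coeff_of_0 ps_of_fls_def)
    then show False using assms by (simp add: coeff_of_inject)
  qed
  let ?d = "- of_int (fls_subdegree F) / of_nat m :: rat"
  have nz: "coeff_of x ?d \<noteq> 0"
    unfolding F(2) ps_of_fls_nth[OF F(1)] using \<open>F \<noteq> 0\<close> by simp
  have max: "q \<le> ?d" if "coeff_of x q \<noteq> 0" for q
  proof (cases q rule: ps_of_fls_cases[OF F(1)])
    case (1 i)
    have "fls_nth F i \<noteq> 0" using that unfolding F(2) 1 ps_of_fls_nth[OF F(1)] .
    then have "fls_subdegree F \<le> i" by (rule fls_subdegree_leI)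
    then show ?thesis using 1 F(1) by (simp add: divide_right_mono)
  next
    case 2 then show ?thesis using that by (simp add: F(2) ps_of_fls_def)
  qed
  have d: "lead_exp x = ?d"
    unfolding lead_exp_def by (rule Greatest_equality) (fact nz, fact max)
  show "coeff_of x (lead_exp x) \<noteq> 0" unfolding d by (fact nz)
  show "coeff_of x q \<noteq> 0 \<Longrightarrow> q \<le> lead_exp x" unfolding d by (fact max)
qed

section \<open>Singular values\<close>

text \<open>The subfield of series with real coefficients is not a separate type; its ordering is given by
  the relations below.\<close>

definition ps_real :: "puiseux \<Rightarrow> bool" where
  "ps_real x \<longleftrightarrow> (\<forall>q. coeff_of x q \<in> \<real>)"

definition ps_pos :: "puiseux \<Rightarrow> bool" where
  "ps_pos x \<longleftrightarrow> ps_real x \<and> x \<noteq> 0 \<and> Re (coeff_of x (lead_exp x)) > 0"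

definition ps_ge :: "puiseux \<Rightarrow> puiseux \<Rightarrow> bool" where
  "ps_ge x y \<longleftrightarrow> x = y \<or> ps_pos (x - y)"

text \<open>\<open>is_Sing A ss\<close>: the list \<open>ss\<close> is the tuple of singular values of \<open>A\<close>.  The multiset
  \<open>proots\<close> of the characteristic polynomial consists of the eigenvalues with their algebraic
  multiplicities.  \<open>is_Sing_unique\<close> below shows that there is at most one such list.\<close>

definition is_Sing :: "puiseux mat \<Rightarrow> puiseux list \<Rightarrow> bool" where
  "is_Sing A ss \<longleftrightarrow>
     length ss = dim_col A \<and> sorted_wrt ps_ge ss \<and> (\<forall>s\<in>set ss. ps_pos s) \<and>
     image_mset (\<lambda>s. s\<^sup>2) (mset ss) = proots (char_poly (mat_adjoint A * A))"

lemma ps_pos_uminus: "ps_pos x \<Longrightarrow> \<not> ps_pos (- x)"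
  by (auto simp: ps_pos_def lead_exp_def coeff_of_uminus)

lemma ps_ge_antisym: "ps_ge x y \<Longrightarrow> ps_ge y x \<Longrightarrow> x = y"
  using ps_pos_uminus[of "x - y"] by (auto simp: ps_ge_def)

lemma sorted_wrt_ps_ge_unique:
  "sorted_wrt ps_ge xs \<Longrightarrow> sorted_wrt ps_ge ys \<Longrightarrow> mset xs = mset ys \<Longrightarrow> xs = ys"
proof (induction xs arbitrary: ys)
  case (Cons x xs)
  then obtain y zs where ys: "ys = y # zs" by (cases ys) auto
  have "set (x # xs) = set ys" using Cons.prems(3) mset_eq_setD by blast
  then have "x = y" using Cons.prems(1,2) ps_ge_antisym unfolding ys by fastforce
  then show ?case using Cons unfolding ys by simp
qed simp

lemma is_Sing_unique:
  assumes "is_Sing A ss" "is_Sing A ss'"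
  shows "ss = ss'"
proof -
  have inj: "inj_on (\<lambda>s. s\<^sup>2) {s. ps_pos s}"
    using ps_pos_uminus by (auto simp: inj_on_def power2_eq_iff)
  have "image_mset (\<lambda>s. s\<^sup>2) (mset ss) = image_mset (\<lambda>s. s\<^sup>2) (mset ss')"
    using assms by (simp add: is_Sing_def)
  then have "image_mset (inv_into {s. ps_pos s} (\<lambda>s. s\<^sup>2)) (image_mset (\<lambda>s. s\<^sup>2) (mset ss)) =
      image_mset (inv_into {s. ps_pos s} (\<lambda>s. s\<^sup>2)) (image_mset (\<lambda>s. s\<^sup>2) (mset ss'))"
    by simp
  moreover have "image_mset (inv_into {s. ps_pos s} (\<lambda>s. s\<^sup>2)) (image_mset (\<lambda>s. s\<^sup>2) (mset l)) = mset l"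
    if "is_Sing A l" for l
  proof -
    have "image_mset (\<lambda>s. inv_into {s. ps_pos s} (\<lambda>s. s\<^sup>2) (s\<^sup>2)) (mset l) = image_mset (\<lambda>s. s) (mset l)"
      using that by (intro image_mset_cong) (simp add: is_Sing_def inv_into_f_f[OF inj])
    then show ?thesis by (simp add: image_mset.compositionality comp_def)
  qed
  ultimately have "mset ss = mset ss'" using assms by simp
  then show ?thesis using assms sorted_wrt_ps_ge_unique by (auto simp: is_Sing_def)
qed

section \<open>Hives\<close>

text \<open>Only the values of \<open>h\<close> at triples of natural numbers with sum \<open>n\<close> matter.  The bounds
  \<open>2 \<le> k\<close>, \<open>2 \<le> j\<close>, \<open>2 \<le> i\<close> are exactly the condition that all the index triples
  in the respective inequality are nonnegative.\<close>

definition hive :: "nat \<Rightarrow> (nat \<Rightarrow> nat \<Rightarrow> nat \<Rightarrow> real) \<Rightarrow> bool" where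
  "hive n h \<longleftrightarrow>
     (\<forall>i j k. i + j + k = n \<and> 2 \<le> k \<longrightarrow>
        h (i + 1) j (k - 1) + h i (j + 1) (k - 1) \<ge> h i j k + h (i + 1) (j + 1) (k - 2)) \<and>
     (\<forall>i j k. i + j + k = n \<and> 2 \<le> j \<longrightarrow>
        h (i + 1) (j - 1) k + h i (j - 1) (k + 1) \<ge> h i j k + h (i + 1) (j - 2) (k + 1)) \<and>
     (\<forall>i j k. i + j + k = n \<and> 2 \<le> i \<longrightarrow>
        h (i - 1) (j + 1) k + h (i - 1) j (k + 1) \<ge> h i j k + h (i - 2) (j + 1) (k + 1))"

definition hive_boundary ::
    "nat \<Rightarrow> (nat \<Rightarrow> nat \<Rightarrow> nat \<Rightarrow> real) \<Rightarrow> real list \<times> real list \<times> real list" where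
  "hive_boundary n h =
     (map (\<lambda>m. h (n - (m + 1)) (m + 1) 0 - h (n - m) m 0) [0..<n],
      map (\<lambda>m. h 0 (n - (m + 1)) (m + 1) - h 0 (n - m) m) [0..<n],
      map (\<lambda>m. h (m + 1) 0 (n - (m + 1)) - h m 0 (n - m)) [0..<n])"

end

theory Submission
  imports Defs "HOL-Computational_Algebra.Field_as_Ring"
begin

text \<open>Write \<open>K\<close> for the field of convergent Puiseux series and \<open>O\<close> for its valuation ring, the series
  without positive exponents.  Singular values become invariant factors over \<open>O\<close>: by the
  Cauchy--Binet formula the coefficients of the characteristic polynomial of \<open>A A\<^sup>*\<close> are, up to sign,
  sums of terms \<open>\<bar>M\<bar>\<^sup>2\<close> over the minors \<open>M\<close> of one size, and such sums do not lose their leading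
  terms.  Hence the sum of the \<open>m\<close> largest leading exponents of singular values is the largest
  leading exponent of a minor of size \<open>m\<close> (\<open>is_Sing_minors\<close>).

  From matrices to hives: if \<open>A B C = 1\<close>, then \<open>1\<close>, \<open>A\<close> and \<open>A B\<close> are bases of three \<open>O\<close>-lattices, and
  consecutive ones are related by \<open>A\<close>, \<open>B\<close> and \<open>C\<close>.  Let \<open>h i j k\<close> be the largest leading exponent of
  a determinant of \<open>i\<close>, \<open>j\<close> and \<open>k\<close> columns of the three matrices.  When one of \<open>i\<close>, \<open>j\<close>, \<open>k\<close> is zero,
  these determinants are, up to a constant factor, minors of one of \<open>A\<close>, \<open>B\<close>, \<open>C\<close>, which gives the
  boundary of \<open>h\<close>.  The hive inequalities follow from the exchange property of valuated matroids,
  that is, from Cramer's rule (\<open>max_exp_rhombus\<close>).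

  From hives to matrices: rounding a large multiple of a hive to integers gives a rational hive \<open>g\<close>
  with the same boundary (\<open>rational_hive_exists\<close>).  Assign to the nodes of the triangular array the
  monomials \<open>t\<close> to the power \<open>g i j k\<close>.  These are the coefficients of linear relations between
  vectors at the small triangles of the array.  Scaled in a way that depends on a chosen corner, the
  vectors along either side at this corner span one lattice, because the hive inequalities say exactly
  that the elementary base changes between them have entries in \<open>O\<close> (\<open>snake_bases\<close>).  Along each
  side the scalings for its two corners differ by monomials whose exponents are the boundary
  differences.  Running around the triangle gives \<open>A\<close>, \<open>B\<close>, \<open>C\<close> with product \<open>1\<close>, each of which is an
  invertible matrix over \<open>O\<close> with columns scaled by such monomials.

  That these matrices have singular values in \<open>K\<close> at all rests on the algebraic closedness of \<open>K\<close>,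
  the theorem of Newton and Puiseux for convergent series.  It is proved with a version of Hensel's
  lemma that controls the growth of coefficients.\<close>

hide_const (open) Module.smult

section \<open>The leading exponent as a valuation\<close>

text \<open>A bound of this form makes sense for the zero series too, so sums need no case distinctions.\<close>

definition exp_le :: "puiseux \<Rightarrow> rat \<Rightarrow> bool" where
  "exp_le x q \<longleftrightarrow> (\<forall>p>q. coeff_of x p = 0)"

lemma coeff_of_add: "coeff_of (x + y) q = coeff_of x q + coeff_of y q"
  by transfer simp

lemma coeff_of_1: "coeff_of 1 q = (if q = 0 then 1 else 0)"
  by transfer simp

lemma coeff_of_conjugate: "coeff_of (conjugate x) q = cnj (coeff_of x q)"
  by transfer simp

lemma coeff_of_mult: "coeff_of (x * y) = ps_conv (coeff_of x) (coeff_of y)"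
  by transfer simp

lemma coeff_of_sum: "coeff_of (sum f A) q = (\<Sum>a\<in>A. coeff_of (f a) q)"
  by (induction A rule: infinite_finite_induct) (auto simp: coeff_of_0 coeff_of_add)

lemma coeff_of_of_nat: "coeff_of (of_nat k) q = (if q = 0 then of_nat k else 0)"
  by (induction k) (auto simp: coeff_of_0 coeff_of_1 coeff_of_add)

instance puiseux :: field_char_0
proof
  show "inj (of_nat :: nat \<Rightarrow> puiseux)"
    by (rule injI) (metis coeff_of_of_nat of_nat_eq_iff)
qed

lemma exp_le_mono: "exp_le x p \<Longrightarrow> p \<le> q \<Longrightarrow> exp_le x q"
  unfolding exp_le_def by auto

lemma exp_le_0 [simp]: "exp_le 0 q"
  by (simp add: exp_le_def coeff_of_0)

lemma exp_le_1 [simp]: "exp_le 1 0"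
  by (simp add: exp_le_def coeff_of_1)

lemma exp_le_uminus [simp]: "exp_le (- x) q \<longleftrightarrow> exp_le x q"
  by (simp add: exp_le_def coeff_of_uminus)

lemma exp_le_add: "exp_le x q \<Longrightarrow> exp_le y q \<Longrightarrow> exp_le (x + y) q"
  by (simp add: exp_le_def coeff_of_add)

lemma exp_le_sum: "(\<And>a. a \<in> A \<Longrightarrow> exp_le (f a) q) \<Longrightarrow> exp_le (sum f A) q"
  by (simp add: exp_le_def coeff_of_sum)

lemma exp_le_conjugate [simp]: "exp_le (conjugate x) q \<longleftrightarrow> exp_le x q"
  by (simp add: exp_le_def coeff_of_conjugate)

text \<open>At the top exponent only one pair of terms contributes to the convolution, so leading
  coefficients multiply.\<close>

lemma
  assumes "exp_le x p" "exp_le y q"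
  shows exp_le_mult: "exp_le (x * y) (p + q)"
    and coeff_of_mult_top: "coeff_of (x * y) (p + q) = coeff_of x p * coeff_of y q"
proof -
  have supp: "a \<le> p \<and> r - a \<le> q" if "coeff_of x a \<noteq> 0" "coeff_of y (r - a) \<noteq> 0" for a r
    using assms that unfolding exp_le_def by (meson not_le)
  show "exp_le (x * y) (p + q)"
    unfolding exp_le_def
  proof (intro allI impI)
    fix r assume r: "p + q < r"
    have "{a. coeff_of x a \<noteq> 0 \<and> coeff_of y (r - a) \<noteq> 0} = {}"
      using supp r by fastforce
    then show "coeff_of (x * y) r = 0" by (simp only: coeff_of_mult ps_conv_def) simp
  qed
  let ?S = "{a. coeff_of x a \<noteq> 0 \<and> coeff_of y (p + q - a) \<noteq> 0}"
  have "?S \<subseteq> {p}" using supp by force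
  then have "coeff_of (x * y) (p + q) = (\<Sum>a\<in>{p}. coeff_of x a * coeff_of y (p + q - a))"
    unfolding coeff_of_mult ps_conv_def by (intro sum.mono_neutral_left) auto
  then show "coeff_of (x * y) (p + q) = coeff_of x p * coeff_of y q" by simp
qed

lemma exp_le_prod: "(\<And>a. a \<in> A \<Longrightarrow> exp_le (f a) (q a)) \<Longrightarrow> exp_le (prod f A) (sum q A)"
  by (induction A rule: infinite_finite_induct) (auto intro: exp_le_mult)

lemma exp_le_of_nat: "exp_le (of_nat k) 0"
  by (simp add: exp_le_def coeff_of_of_nat)

lemma exp_le_lead_exp: "exp_le x (lead_exp x)"
proof (cases "x = 0")
  case False
  then show ?thesis unfolding exp_le_def by (meson lead_exp_max not_le)
qed simp

lemma exp_le_iff: "x \<noteq> 0 \<Longrightarrow> exp_le x q \<longleftrightarrow> lead_exp x \<le> q"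
  using exp_le_mono[OF exp_le_lead_exp] lead_coeff_nonzero unfolding exp_le_def
  by (meson not_le)

lemma lead_exp_eqI:
  assumes "exp_le x q" "coeff_of x q \<noteq> 0"
  shows "x \<noteq> 0" "lead_exp x = q"
proof -
  show "x \<noteq> 0" using assms by (auto simp: coeff_of_0)
  then show "lead_exp x = q"
    using assms exp_le_iff lead_exp_max by (metis order_antisym)
qed

lemma lead_exp_mult:
  assumes "x \<noteq> 0" "y \<noteq> 0"
  shows "lead_exp (x * y) = lead_exp x + lead_exp y"
    "coeff_of (x * y) (lead_exp x + lead_exp y) = coeff_of x (lead_exp x) * coeff_of y (lead_exp y)"
proof -
  show c: "coeff_of (x * y) (lead_exp x + lead_exp y) = coeff_of x (lead_exp x) * coeff_of y (lead_exp y)"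
    by (intro coeff_of_mult_top exp_le_lead_exp)
  then show "lead_exp (x * y) = lead_exp x + lead_exp y"
    using assms by (intro lead_exp_eqI exp_le_mult exp_le_lead_exp) (simp add: lead_coeff_nonzero)
qed

lemma lead_exp_1 [simp]: "lead_exp 1 = 0"
  by (rule lead_exp_eqI) (simp_all add: coeff_of_1)

lemma lead_exp_uminus [simp]: "lead_exp (- x) = lead_exp x"
  by (simp add: lead_exp_def coeff_of_uminus)

lemma lead_exp_inverse: "x \<noteq> 0 \<Longrightarrow> lead_exp (inverse x) = - lead_exp x"
  using lead_exp_mult(1)[of x "inverse x"] by simp

lemma lead_exp_power: "x \<noteq> 0 \<Longrightarrow> lead_exp (x ^ k) = of_nat k * lead_exp x"
  by (induction k) (simp_all add: lead_exp_mult algebra_simps)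

lemma lead_exp_divide: "x \<noteq> 0 \<Longrightarrow> y \<noteq> 0 \<Longrightarrow> lead_exp (x / y) = lead_exp x - lead_exp y"
  using lead_exp_mult(1)[of x "inverse y"] by (simp add: field_class.field_divide_inverse lead_exp_inverse)

lemma lead_exp_of_nat: "k > 0 \<Longrightarrow> lead_exp (of_nat k) = 0"
  by (rule lead_exp_eqI) (simp_all add: exp_le_of_nat coeff_of_of_nat)

subsection \<open>Monomials\<close>

lift_definition tpow :: "rat \<Rightarrow> puiseux" is "\<lambda>q p. if p = q then 1 else 0"
proof -
  fix q :: rat
  obtain a b where q: "quotient_of q = (a, b)" by (cases "quotient_of q")
  define m where "m = nat b"
  have m: "m > 0" "q = of_int a / of_nat m"
    using quotient_of_denom_pos[OF q] quotient_of_div[OF q] by (auto simp: m_def)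
  have "(\<lambda>p. if p = q then 1 else 0) = ps_of_fls m (fls_X_intpow (- a))"
  proof
    fix p
    show "(if p = q then 1 else 0) = ps_of_fls m (fls_X_intpow (- a)) p"
    proof (cases p rule: ps_of_fls_cases[OF m(1)])
      case (1 i)
      have "p = q \<longleftrightarrow> i = - a" using m(1) unfolding 1 m(2)
        by (simp add: field_simps) (metis minus_minus of_int_eq_iff of_int_minus)
      moreover have "ps_of_fls m (fls_X_intpow (- a)) p = fls_nth (fls_X_intpow (- a)) i"
        unfolding 1 by (rule ps_of_fls_nth[OF m(1)])
      ultimately show ?thesis by simp
    next
      case 2
      have "p \<noteq> q" using 2 m by auto
      then show ?thesis using 2 by (simp add: ps_of_fls_def)
    qed
  qed
  moreover have "fls_conv_radius (fls_X_intpow (- a) :: complex fls) > 0" by simp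
  ultimately show "\<exists>m>0. puiseux_in m (\<lambda>p. if p = q then 1 else 0)"
    using ps_of_fls_puiseux[OF m(1)] by simp
qed

lemma coeff_of_tpow: "coeff_of (tpow q) p = (if p = q then 1 else 0)"
  by transfer simp

lemma lead_exp_tpow [simp]: "tpow q \<noteq> 0" "lead_exp (tpow q) = q"
  using lead_exp_eqI[of "tpow q" q] by (auto simp: exp_le_def coeff_of_tpow)

subsection \<open>Positive elements\<close>

lemma ps_real_iff: "ps_real x \<longleftrightarrow> conjugate x = x"
  unfolding ps_real_def coeff_of_inject[symmetric] fun_eq_iff coeff_of_conjugate
  by (simp add: Reals_cnj_iff)

lemma conjugate_diff: "conjugate (x - y) = conjugate x - conjugate (y :: puiseux)"
  by (metis conjugate_dist_add conjugate_neg diff_conv_add_uminus)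

lemma conjugate_divide: "conjugate (x / y) = conjugate x / conjugate (y :: puiseux)"
proof (cases "y = 0")
  case False
  then have "conjugate (x / y) * conjugate y = conjugate x"
    by (simp flip: conjugate_dist_mul)
  then show ?thesis using False
    by (metis conjugate_cancel_iff conjugate_zero nonzero_mult_div_cancel_right)
qed simp

lemma Re_lead_coeff_mult:
  assumes "ps_real x" "ps_real y" "x \<noteq> 0" "y \<noteq> 0"
  shows "Re (coeff_of (x * y) (lead_exp (x * y)))
    = Re (coeff_of x (lead_exp x)) * Re (coeff_of y (lead_exp y))"
proof -
  obtain a b where "coeff_of x (lead_exp x) = of_real a" "coeff_of y (lead_exp y) = of_real b"
    using assms(1,2) unfolding ps_real_def by (metis Reals_cases)
  then show ?thesis using assms(3,4) by (simp add: lead_exp_mult)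
qed

lemma ps_pos_mult: "ps_pos x \<Longrightarrow> ps_pos y \<Longrightarrow> ps_pos (x * y)"
  using Re_lead_coeff_mult[of x y] by (simp add: ps_pos_def ps_real_iff conjugate_dist_mul)

lemma ps_pos_inverse:
  assumes x: "ps_pos x"
  shows "ps_pos (inverse x)"
proof -
  have x0: "x \<noteq> 0" and r: "ps_real x" using x by (auto simp: ps_pos_def)
  have "conjugate 1 = (1 :: puiseux)"
    using conjugate_divide[of x x] x0 r by (simp add: ps_real_iff)
  then have ri: "ps_real (inverse x)"
    using conjugate_divide[of 1 x] r by (simp add: ps_real_iff inverse_eq_divide)
  have "Re (coeff_of x (lead_exp x)) * Re (coeff_of (inverse x) (lead_exp (inverse x))) = 1"
    using Re_lead_coeff_mult[OF r ri] x0 by (simp add: coeff_of_1)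
  moreover have "Re (coeff_of x (lead_exp x)) > 0" using x by (simp add: ps_pos_def)
  ultimately have "Re (coeff_of (inverse x) (lead_exp (inverse x))) > 0"
    by (smt (verit, best) zero_less_mult_iff)
  then show ?thesis using x0 ri by (simp add: ps_pos_def)
qed

lemma ps_pos_divide: "ps_pos x \<Longrightarrow> ps_pos y \<Longrightarrow> ps_pos (x / y)"
  by (simp add: field_class.field_divide_inverse ps_pos_mult ps_pos_inverse)

lemma
  assumes x: "ps_pos x" and y: "ps_pos y"
  shows ps_pos_add: "ps_pos (x + y)"
    and lead_exp_add_pos: "lead_exp (x + y) = max (lead_exp x) (lead_exp y)"
proof -
  let ?m = "max (lead_exp x) (lead_exp y)"
  have nn: "Re (coeff_of z ?m) \<ge> 0" if "ps_pos z" "lead_exp z \<le> ?m" for z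
    using that lead_exp_max[of z ?m] unfolding ps_pos_def
    by (cases "lead_exp z = ?m") force+
  have pos: "Re (coeff_of (x + y) ?m) > 0"
    using x y nn[OF x] nn[OF y] by (auto simp: coeff_of_add ps_pos_def max_def)
  have le: "exp_le (x + y) ?m"
    by (intro exp_le_add exp_le_mono[OF exp_le_lead_exp]) auto
  have nz: "coeff_of (x + y) ?m \<noteq> 0" using pos by auto
  show l: "lead_exp (x + y) = ?m" by (rule lead_exp_eqI[OF le nz])
  show "ps_pos (x + y)"
    unfolding ps_pos_def l using pos lead_exp_eqI(1)[OF le nz] x y
    by (simp add: ps_pos_def ps_real_iff conjugate_dist_add)
qed

text \<open>A sum of elements \<open>x * conjugate x\<close> never suffers cancellation of leading terms.\<close>

lemma sum_norm_sq:
  fixes f :: "'a \<Rightarrow> puiseux"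
  assumes "finite A" "a \<in> A" "f a \<noteq> 0" "\<And>b. b \<in> A \<Longrightarrow> exp_le (f b) (lead_exp (f a))"
  shows "ps_pos (\<Sum>b\<in>A. f b * conjugate (f b))"
    and "lead_exp (\<Sum>b\<in>A. f b * conjugate (f b)) = 2 * lead_exp (f a)"
proof -
  let ?q = "lead_exp (f a)" and ?s = "\<Sum>b\<in>A. f b * conjugate (f b)"
  have top: "coeff_of (f b * conjugate (f b)) (2 * ?q) = of_real ((cmod (coeff_of (f b) ?q))\<^sup>2)"
    if "b \<in> A" for b
    using coeff_of_mult_top[of "f b" ?q "conjugate (f b)" ?q] assms(4)[OF that]
    by (simp add: coeff_of_conjugate flip: complex_norm_square)
  have c: "coeff_of ?s (2 * ?q) = of_real (\<Sum>b\<in>A. (cmod (coeff_of (f b) ?q))\<^sup>2)"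
    unfolding coeff_of_sum using top by simp
  have "(\<Sum>b\<in>A. (cmod (coeff_of (f b) ?q))\<^sup>2) \<ge> (cmod (coeff_of (f a) ?q))\<^sup>2"
    using assms(1,2) by (intro member_le_sum) auto
  then have pos: "(\<Sum>b\<in>A. (cmod (coeff_of (f b) ?q))\<^sup>2) > 0"
    using lead_coeff_nonzero[OF assms(3)] by (smt (verit) norm_eq_zero zero_less_power2)
  have le: "exp_le ?s (2 * ?q)"
    using assms(4) exp_le_mult[of _ ?q _ ?q] by (intro exp_le_sum) (simp flip: mult_2)
  have nz: "coeff_of ?s (2 * ?q) \<noteq> 0" unfolding c using pos by (metis less_irrefl of_real_eq_0_iff)
  show l: "lead_exp ?s = 2 * ?q" by (rule lead_exp_eqI[OF le nz])
  have "conjugate ?s = ?s"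
    using assms(1)
    by (induction A rule: finite_induct) (simp_all add: conjugate_dist_add conjugate_dist_mul mult.commute)
  then show "ps_pos ?s"
    unfolding ps_pos_def l ps_real_iff using lead_exp_eqI(1)[OF le nz] pos unfolding c by simp
qed

section \<open>Hensel factorization of convergent power series\<close>

text \<open>Cutting off at degree \<open>n\<close> loses nothing below that degree, and keeps the norm submultiplicative
  without conditions on degrees.\<close>

definition coeff_norm :: "nat \<Rightarrow> complex poly \<Rightarrow> real" where
  "coeff_norm n p = (\<Sum>i<n. cmod (coeff p i))"

lemma coeff_norm_nonneg: "coeff_norm n p \<ge> 0"
  by (simp add: coeff_norm_def sum_nonneg)

lemma coeff_norm_diff: "coeff_norm n (p - q) \<le> coeff_norm n p + coeff_norm n q"
  unfolding coeff_norm_def sum.distrib[symmetric] by (intro sum_mono) (simp add: norm_triangle_ineq4)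

lemma coeff_norm_sum: "coeff_norm n (sum f A) \<le> (\<Sum>a\<in>A. coeff_norm n (f a))"
proof -
  have "coeff_norm n (sum f A) \<le> (\<Sum>i<n. \<Sum>a\<in>A. cmod (coeff (f a) i))"
    unfolding coeff_norm_def coeff_sum by (intro sum_mono norm_sum)
  also have "\<dots> = (\<Sum>a\<in>A. coeff_norm n (f a))"
    unfolding coeff_norm_def by (rule sum.swap)
  finally show ?thesis .
qed

lemma coeff_norm_smult: "coeff_norm n (smult c p) = cmod c * coeff_norm n p"
  by (simp add: coeff_norm_def norm_mult sum_distrib_left)

lemma coeff_norm_mult: "coeff_norm n (p * q) \<le> coeff_norm n p * coeff_norm n q"
proof -
  let ?g = "\<lambda>i j. cmod (coeff p i) * cmod (coeff q j)"
  have "coeff_norm n (p * q) \<le> (\<Sum>k<n. \<Sum>i\<le>k. ?g i (k - i))"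
    unfolding coeff_norm_def coeff_mult by (intro sum_mono) (simp add: norm_sum flip: norm_mult)
  also have "\<dots> = (\<Sum>(i,j)\<in>{(i,j). i + j < n}. ?g i j)"
    by (rule sum.triangle_reindex [symmetric])
  also have "\<dots> \<le> (\<Sum>(i,j)\<in>{..<n} \<times> {..<n}. ?g i j)"
    by (intro sum_mono2) auto
  also have "\<dots> = coeff_norm n p * coeff_norm n q"
    unfolding coeff_norm_def by (simp add: sum_product sum.cartesian_product)
  finally show ?thesis .
qed

lemma cmod_coeff_le_coeff_norm: "i < n \<Longrightarrow> cmod (coeff p i) \<le> coeff_norm n p"
  unfolding coeff_norm_def by (rule member_le_sum) auto

text \<open>The factorization problem linearized at \<open>Q * R\<close>: a Bezout identity for \<open>Q\<close> and \<open>R\<close> gives a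
  solution, and reduction modulo \<open>Q\<close> makes it small enough in degree.\<close>

lemma linearized_factorization:
  fixes Q R w :: "complex poly"
  assumes "coprime Q R" "degree Q > 0" "degree R > 0"
    and w: "\<And>i. i \<ge> degree Q + degree R \<Longrightarrow> coeff w i = 0"
  obtains q r where "\<And>i. i \<ge> degree Q \<Longrightarrow> coeff q i = 0" "\<And>i. i \<ge> degree R \<Longrightarrow> coeff r i = 0"
    "Q * r + R * q = w"
proof -
  obtain U V where UV: "U * Q + V * R = 1"
    using bezout_coefficients_fst_snd[of Q R] coprime_imp_gcd_eq_1[OF assms(1)] by simp
  define q d r where "q = (V * w) mod Q" "d = (V * w) div Q" "r = U * w + R * d"
  have Vw: "V * w = d * Q + q" by (simp add: q_d_r_def)
  have Q0: "Q \<noteq> 0" and R0: "R \<noteq> 0" using assms by auto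
  have eq: "Q * r + R * q = w"
  proof -
    have "Q * r + R * q = U * Q * w + R * (d * Q + q)"
      by (simp add: q_d_r_def(3) algebra_simps)
    also have "\<dots> = (U * Q + V * R) * w" unfolding Vw[symmetric] by (simp add: algebra_simps)
    finally show ?thesis using UV by simp
  qed
  have q: "coeff q i = 0" if "i \<ge> degree Q" for i
    using degree_mod_less'[OF Q0, of "V * w"] that assms(2)
    by (cases "q = 0") (auto intro: coeff_eq_0 simp: q_d_r_def)
  have "coeff r i = 0" if i: "i \<ge> degree R" for i
  proof (rule ccontr)
    assume "coeff r i \<noteq> 0"
    then have r0: "r \<noteq> 0" and dr: "degree R \<le> degree r" using i le_degree[of r i] by auto
    have "degree (R * q) < degree Q + degree R \<or> q = 0"
    proof (cases "q = 0")
      case False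
      then have "degree q < degree Q" using q leading_coeff_0_iff by (meson not_le)
      then show ?thesis using False R0 by (simp add: degree_mult_eq)
    qed simp
    then have "coeff (R * q) (degree Q + degree r) = 0"
      using dr by (auto intro: coeff_eq_0)
    moreover have "coeff w (degree Q + degree r) = 0" using dr by (intro w) simp
    ultimately have "coeff (Q * r) (degree Q + degree r) = 0" unfolding eq[symmetric] by simp
    then show False using Q0 r0 by (simp add: coeff_mult_degree_sum)
  qed
  then show ?thesis using that q eq by blast
qed

text \<open>Solving for monomials only and extending linearly yields solution operators \<open>S\<close> and \<open>T\<close> with a
  norm bound \<open>C\<close> that does not depend on the right-hand side.\<close>

lemma bounded_linearized_factorization:
  fixes Q R :: "complex poly"
  assumes "coprime Q R" "degree Q > 0" "degree R > 0"
  defines "n \<equiv> degree Q + degree R"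
  obtains S T C where "C \<ge> 1"
    "\<And>w i. i \<ge> degree Q \<Longrightarrow> coeff (S w) i = 0" "\<And>w i. i \<ge> degree R \<Longrightarrow> coeff (T w) i = 0"
    "\<And>w. \<forall>i\<ge>n. coeff w i = 0 \<Longrightarrow> Q * T w + R * S w = w"
    "\<And>w. coeff_norm n (S w) \<le> C * coeff_norm n w" "\<And>w. coeff_norm n (T w) \<le> C * coeff_norm n w"
proof -
  have "\<exists>q r. (\<forall>j\<ge>degree Q. coeff q j = 0) \<and> (\<forall>j\<ge>degree R. coeff r j = 0) \<and>
      Q * r + R * q = monom 1 i" if "i < n" for i
    using linearized_factorization[OF assms(1-3), of "monom 1 i"] that unfolding n_def
    by (metis coeff_monom not_le)
  then obtain q r where qr: "\<And>i j. i < n \<Longrightarrow> j \<ge> degree Q \<Longrightarrow> coeff (q i) j = 0"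
      "\<And>i j. i < n \<Longrightarrow> j \<ge> degree R \<Longrightarrow> coeff (r i) j = 0"
      "\<And>i. i < n \<Longrightarrow> Q * r i + R * q i = monom 1 i"
    by metis
  define S where "S = (\<lambda>w. \<Sum>i<n. smult (coeff w i) (q i))"
  define T where "T = (\<lambda>w. \<Sum>i<n. smult (coeff w i) (r i))"
  define C where "C = 1 + (\<Sum>i<n. coeff_norm n (q i) + coeff_norm n (r i))"
  have C: "coeff_norm n (\<Sum>i<n. smult (coeff w i) (f i)) \<le> C * coeff_norm n w"
    if f: "\<And>i. i < n \<Longrightarrow> coeff_norm n (f i) \<le> coeff_norm n (q i) + coeff_norm n (r i)" for w f
  proof -
    have fC: "coeff_norm n (f i) \<le> C" if "i < n" for i
    proof -
      have "coeff_norm n (q i) + coeff_norm n (r i) \<le> (\<Sum>i<n. coeff_norm n (q i) + coeff_norm n (r i))"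
        using that by (intro member_le_sum) (auto simp: coeff_norm_nonneg)
      then show ?thesis using f[OF that] unfolding C_def by simp
    qed
    have "coeff_norm n (\<Sum>i<n. smult (coeff w i) (f i)) \<le> (\<Sum>i<n. cmod (coeff w i) * coeff_norm n (f i))"
      using coeff_norm_sum[of n "\<lambda>i. smult (coeff w i) (f i)" "{..<n}"] by (simp add: coeff_norm_smult)
    also have "\<dots> \<le> (\<Sum>i<n. cmod (coeff w i) * C)"
      by (intro sum_mono mult_left_mono fC) auto
    also have "\<dots> = C * coeff_norm n w"
      unfolding coeff_norm_def by (simp add: sum_distrib_left mult.commute)
    finally show ?thesis .
  qed
  show ?thesis
  proof (rule that[of C S T])
    show "C \<ge> 1" by (simp add: C_def sum_nonneg coeff_norm_nonneg)
    show "coeff (S w) i = 0" if "i \<ge> degree Q" for w i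
      using qr(1) that by (simp add: S_def coeff_sum)
    show "coeff (T w) i = 0" if "i \<ge> degree R" for w i
      using qr(2) that by (simp add: T_def coeff_sum)
    show "Q * T w + R * S w = w" if w: "\<forall>i\<ge>n. coeff w i = 0" for w
    proof -
      have "Q * T w + R * S w = (\<Sum>i<n. smult (coeff w i) (Q * r i + R * q i))"
        by (simp add: S_def T_def sum_distrib_left smult_add_right sum.distrib)
      also have "\<dots> = (\<Sum>i<n. monom (coeff w i) i)" using qr(3) by (simp add: smult_monom)
      also have "\<dots> = w"
        by (rule poly_eqI) (use w in \<open>auto simp: coeff_sum sum.delta\<close>)
      finally show ?thesis .
    qed
    show "coeff_norm n (S w) \<le> C * coeff_norm n w" for w
      unfolding S_def by (rule C) (simp add: coeff_norm_nonneg)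
    show "coeff_norm n (T w) \<le> C * coeff_norm n w" for w
      unfolding T_def by (rule C) (simp add: coeff_norm_nonneg)
  qed
qed

lemma sum_inverse_squares_le: "(\<Sum>j=1..<k. 1 / (real j)\<^sup>2) \<le> 2"
proof -
  have "(\<Sum>j=1..<Suc k. 1 / (real j)\<^sup>2) \<le> 2 - 1 / real k" if "k > 0" for k
    using that
  proof (induction k rule: nat_induct_non_zero)
    case (Suc k)
    have "1 / (real (Suc k))\<^sup>2 \<le> 1 / (real k * real (Suc k))"
      using Suc.hyps by (intro divide_left_mono) (auto simp: power2_eq_square)
    also have "\<dots> = 1 / real k - 1 / real (Suc k)" using Suc.hyps by (simp add: field_simps)
    finally show ?case using Suc.IH by simp
  qed simp
  from this[of "k - 1"] have "(\<Sum>j=1..<k. 1 / (real j)\<^sup>2) \<le> 2 - 1 / real (k - 1)" if "k > 1"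
    using that by simp
  moreover have "1 / real (k - 1) \<ge> 0" by simp
  ultimately show ?thesis by (cases "k > 1") (linarith, simp)
qed

text \<open>The weights \<open>1/k\<^sup>2\<close> are, up to a constant, stable under convolution; this makes a geometric
  bound reproduce itself in the quadratic recursion below.\<close>

lemma convolution_inverse_squares_le:
  "(\<Sum>j=1..<k. 1 / ((real j)\<^sup>2 * (real (k - j))\<^sup>2)) \<le> 8 / (real k)\<^sup>2"
proof -
  have "(\<Sum>j=1..<k. 1 / ((real j)\<^sup>2 * (real (k - j))\<^sup>2))
      \<le> (\<Sum>j=1..<k. 2 / (real k)\<^sup>2 * (1 / (real j)\<^sup>2 + 1 / (real (k - j))\<^sup>2))"
  proof (rule sum_mono)
    fix j assume j: "j \<in> {1..<k}"
    define a b where ab: "a = 1 / real j" "b = 1 / real (k - j)"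
    have "real k * (a * b) = a + b" using j by (simp add: ab field_simps of_nat_diff)
    then have "(real k)\<^sup>2 * (a * b)\<^sup>2 \<le> 2 * (a\<^sup>2 + b\<^sup>2)"
      using sum_squares_bound[of a b] by (simp add: power2_sum flip: power_mult_distrib)
    then have "(a * b)\<^sup>2 \<le> 2 / (real k)\<^sup>2 * (a\<^sup>2 + b\<^sup>2)" using j by (simp add: field_simps)
    then show "1 / ((real j)\<^sup>2 * (real (k - j))\<^sup>2)
        \<le> 2 / (real k)\<^sup>2 * (1 / (real j)\<^sup>2 + 1 / (real (k - j))\<^sup>2)"
      by (simp add: ab power_divide power_mult_distrib)
  qed
  also have "\<dots> = 2 / (real k)\<^sup>2 *
      ((\<Sum>j=1..<k. 1 / (real j)\<^sup>2) + (\<Sum>j=1..<k. 1 / (real (k - j))\<^sup>2))"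
    by (simp only: sum.distrib flip: sum_distrib_left)
  also have "(\<Sum>j=1..<k. 1 / (real (k - j))\<^sup>2) = (\<Sum>j=1..<k. 1 / (real j)\<^sup>2)"
    by (rule sum.reindex_bij_witness[of _ "\<lambda>j. k - j" "\<lambda>j. k - j"]) auto
  also have "2 / (real k)\<^sup>2 * ((\<Sum>j=1..<k. 1 / (real j)\<^sup>2) + (\<Sum>j=1..<k. 1 / (real j)\<^sup>2))
      \<le> 2 / (real k)\<^sup>2 * 4"
    using sum_inverse_squares_le[of k] by (intro mult_left_mono) auto
  finally show ?thesis by simp
qed

text \<open>The coefficient of the \<open>k\<close>-th power of the series variable in both factors, for \<open>k > 0\<close>: it solves
  the linearized problem whose right-hand side collects the contributions of smaller indices.\<close>

fun hensel_step :: "(complex poly \<Rightarrow> complex poly) \<Rightarrow> (complex poly \<Rightarrow> complex poly) \<Rightarrow>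
    (nat \<Rightarrow> complex poly) \<Rightarrow> nat \<Rightarrow> complex poly \<times> complex poly" where
  "hensel_step S T p k =
     (let w = p k - (\<Sum>j\<in>{1..<k}. fst (hensel_step S T p j) * snd (hensel_step S T p (k - j)))
      in (S w, T w))"

declare hensel_step.simps [simp del]

text \<open>Comparing coefficients in the equation \<open>p = q r\<close> between power series with polynomial coefficients
  determines \<open>q\<close> and \<open>r\<close> recursively.  Geometric growth of \<open>p\<close> is passed on to \<open>q\<close> and \<open>r\<close>: a bound
  \<open>e * K ^ k / k\<^sup>2\<close> reproduces itself when the constant \<open>e\<close> is small enough to absorb the quadratic
  terms and the rate \<open>K\<close> is large enough to absorb \<open>p\<close>.\<close>

lemma hensel_sequences:
  fixes p :: "nat \<Rightarrow> complex poly"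
  assumes p0: "p 0 = Q * R" and QR: "coprime Q R" "degree Q > 0" "degree R > 0"
    and n: "n = degree Q + degree R"
    and deg: "\<And>k i. k > 0 \<Longrightarrow> i \<ge> n \<Longrightarrow> coeff (p k) i = 0"
    and bound: "\<And>k. coeff_norm n (p k) \<le> M * L ^ k" and L: "L \<ge> 1" and M: "M \<ge> 0"
  obtains q r K where "q 0 = Q" "r 0 = R" "K \<ge> 1"
    "\<And>k i. k > 0 \<Longrightarrow> i \<ge> degree Q \<Longrightarrow> coeff (q k) i = 0"
    "\<And>k i. k > 0 \<Longrightarrow> i \<ge> degree R \<Longrightarrow> coeff (r k) i = 0"
    "\<And>k. p k = (\<Sum>j\<le>k. q j * r (k - j))"
    "\<And>k. k > 0 \<Longrightarrow> coeff_norm n (q k) \<le> K ^ k" "\<And>k. k > 0 \<Longrightarrow> coeff_norm n (r k) \<le> K ^ k"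
proof -
  obtain S T C where C: "C \<ge> 1"
    and S: "\<And>w i. i \<ge> degree Q \<Longrightarrow> coeff (S w) i = 0"
    and T: "\<And>w i. i \<ge> degree R \<Longrightarrow> coeff (T w) i = 0"
    and sol: "\<And>w. \<forall>i\<ge>n. coeff w i = 0 \<Longrightarrow> Q * T w + R * S w = w"
    and SC: "\<And>w. coeff_norm n (S w) \<le> C * coeff_norm n w"
    and TC: "\<And>w. coeff_norm n (T w) \<le> C * coeff_norm n w"
    by (rule bounded_linearized_factorization[OF QR, folded n]) (rule that)
  define q where "q = (\<lambda>k. if k = 0 then Q else fst (hensel_step S T p k))"
  define r where "r = (\<lambda>k. if k = 0 then R else snd (hensel_step S T p k))"
  define w where "w = (\<lambda>k. p k - (\<Sum>j=1..<k. q j * r (k - j)))"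
  have qw: "q k = S (w k)" and rw: "r k = T (w k)" if "k > 0" for k
  proof -
    have "(\<Sum>j\<in>{1..<k}. fst (hensel_step S T p j) * snd (hensel_step S T p (k - j)))
        = (\<Sum>j=1..<k. q j * r (k - j))"
      by (intro sum.cong) (auto simp: q_def r_def)
    then have "hensel_step S T p k = (S (w k), T (w k))"
      by (subst hensel_step.simps) (simp add: w_def Let_def)
    then show "q k = S (w k)" "r k = T (w k)" using that by (auto simp: q_def r_def)
  qed
  have dq: "coeff (q k) i = 0" if "k > 0" "i \<ge> degree Q" for k i using qw S that by simp
  have dr: "coeff (r k) i = 0" if "k > 0" "i \<ge> degree R" for k i using rw T that by simp
  have dqr: "coeff (q j * r l) i = 0" if "j > 0" "l > 0" "i \<ge> n" for j l i
  proof -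
    have "degree (q j) < degree Q" "degree (r l) < degree R"
      using dq[OF that(1)] dr[OF that(2)] QR by (metis leading_coeff_0_iff not_le degree_0)+
    then have "degree (q j * r l) < n" using degree_mult_le[of "q j" "r l"] n by linarith
    then show ?thesis using that(3) by (intro coeff_eq_0) simp
  qed
  have conv: "p k = (\<Sum>j\<le>k. q j * r (k - j))" for k
  proof (cases "k = 0")
    case True then show ?thesis by (simp add: p0 q_def r_def)
  next
    case False
    then have "Q * r k + R * q k = w k"
      using deg dqr unfolding qw[of k, OF False[unfolded neq0_conv]] rw[of k, OF False[unfolded neq0_conv]]
      by (intro sol) (simp add: w_def coeff_sum)
    moreover have "(\<Sum>j\<le>k. q j * r (k - j)) = Q * r k + (\<Sum>j=1..<k. q j * r (k - j)) + q k * R"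
    proof -
      have "{..k} = insert 0 (insert k {1..<k})" using False by auto
      then show ?thesis using False by (simp add: q_def r_def add_ac)
    qed
    ultimately show ?thesis by (simp add: w_def algebra_simps)
  qed
  \<comment> \<open>The quadratic terms contribute at most \<open>C * 8 * e\<^sup>2\<close>, which is \<open>e / 2\<close> for this choice of \<open>e\<close>;
    the other half is left for \<open>p\<close>.\<close>
  define e where "e = 1 / (16 * C)"
  define K where "K = 4 * L * (1 + 2 * C * M / e)"
  have e: "0 < e" "e \<le> 1" using C by (auto simp: e_def)
  have "2 * C * M / e \<ge> 0" using C M e by simp
  then have K1: "K \<ge> 1" unfolding K_def using L mult_mono[of 1 L 1 "1 + 2 * C * M / e"] by simp
  have main: "coeff_norm n (q k) \<le> e * K ^ k / (real k)\<^sup>2 \<and> coeff_norm n (r k) \<le> e * K ^ k / (real k)\<^sup>2"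
    if "k > 0" for k
    using that
  proof (induction k rule: less_induct)
    case (less k)
    have "coeff_norm n (\<Sum>j=1..<k. q j * r (k - j))
        \<le> (\<Sum>j=1..<k. coeff_norm n (q j * r (k - j)))" by (rule coeff_norm_sum)
    also have "\<dots> \<le> (\<Sum>j=1..<k. (e\<^sup>2 * K ^ k) * (1 / ((real j)\<^sup>2 * (real (k - j))\<^sup>2)))"
    proof (rule sum_mono)
      fix j assume j: "j \<in> {1..<k}"
      have "coeff_norm n (q j * r (k - j)) \<le> coeff_norm n (q j) * coeff_norm n (r (k - j))"
        by (rule coeff_norm_mult)
      also have "\<dots> \<le> (e * K ^ j / (real j)\<^sup>2) * (e * K ^ (k - j) / (real (k - j))\<^sup>2)"
        using j e K1 less.IH[of j] less.IH[of "k - j"] by (intro mult_mono) (auto simp: coeff_norm_nonneg)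
      also have "\<dots> = (e\<^sup>2 * (K ^ j * K ^ (k - j))) * (1 / ((real j)\<^sup>2 * (real (k - j))\<^sup>2))"
        by (simp add: power2_eq_square)
      also have "K ^ j * K ^ (k - j) = K ^ k" using j by (simp flip: power_add)
      finally show "coeff_norm n (q j * r (k - j)) \<le> (e\<^sup>2 * K ^ k) * (1 / ((real j)\<^sup>2 * (real (k - j))\<^sup>2))" .
    qed
    also have "\<dots> \<le> (e\<^sup>2 * K ^ k) * (8 / (real k)\<^sup>2)"
      unfolding sum_distrib_left[symmetric] using K1
      by (intro mult_left_mono convolution_inverse_squares_le) auto
    finally have quad: "C * coeff_norm n (\<Sum>j=1..<k. q j * r (k - j)) \<le> e / 2 * K ^ k / (real k)\<^sup>2"
    proof -
      assume "coeff_norm n (\<Sum>j=1..<k. q j * r (k - j)) \<le> (e\<^sup>2 * K ^ k) * (8 / (real k)\<^sup>2)"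
      then have "C * coeff_norm n (\<Sum>j=1..<k. q j * r (k - j)) \<le> C * ((e\<^sup>2 * K ^ k) * (8 / (real k)\<^sup>2))"
        using C by (intro mult_left_mono) auto
      also have "\<dots> = (C * e) * (8 * e * K ^ k / (real k)\<^sup>2)" by (simp add: power2_eq_square)
      also have "C * e = 1 / 16" using C by (simp add: e_def)
      finally show ?thesis by simp
    qed
    have lin: "C * coeff_norm n (p k) \<le> e / 2 * K ^ k / (real k)\<^sup>2"
    proof -
      define x where "x = 2 * C * M / e"
      have x: "x \<ge> 0" using C M e by (simp add: x_def)
      have "x \<le> 1 + real k * x" using x less.prems by (cases k) (auto simp: algebra_simps)
      also have "\<dots> \<le> (1 + x) ^ k" using x by (intro Bernoulli_inequality) auto
      finally have 1: "x \<le> (1 + x) ^ k" .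
      have "k < 2 ^ k" by (rule less_exp)
      then have "real k \<le> 2 ^ k" by (metis less_imp_le of_nat_less_iff of_nat_numeral of_nat_power)
      then have "(real k)\<^sup>2 \<le> (2 ^ k)\<^sup>2" by (intro power_mono) auto
      then have 2: "(real k)\<^sup>2 \<le> 4 ^ k" by (simp add: power2_eq_square flip: power_mult_distrib)
      have "(real k)\<^sup>2 * (x * L ^ k) \<le> 4 ^ k * ((1 + x) ^ k * L ^ k)"
        using 1 2 x L by (intro mult_mono mult_right_mono) auto
      also have "\<dots> = K ^ k" by (simp add: K_def x_def[symmetric] power_mult_distrib)
      finally have "x * L ^ k \<le> K ^ k / (real k)\<^sup>2" using less.prems by (simp add: field_simps)
      then have "e / 2 * (x * L ^ k) \<le> e / 2 * (K ^ k / (real k)\<^sup>2)" using e by (intro mult_left_mono) auto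
      moreover have "e / 2 * (x * L ^ k) = C * (M * L ^ k)" using e by (simp add: x_def)
      moreover have "C * coeff_norm n (p k) \<le> C * (M * L ^ k)" using bound C by (intro mult_left_mono) auto
      ultimately have "C * coeff_norm n (p k) \<le> e / 2 * (K ^ k / (real k)\<^sup>2)" by linarith
      then show ?thesis by simp
    qed
    have "C * coeff_norm n (w k) \<le> C * (coeff_norm n (p k) + coeff_norm n (\<Sum>j=1..<k. q j * r (k - j)))"
      using C unfolding w_def by (intro mult_left_mono coeff_norm_diff) auto
    also have "\<dots> \<le> e / 2 * K ^ k / (real k)\<^sup>2 + e / 2 * K ^ k / (real k)\<^sup>2"
      unfolding distrib_left by (rule add_mono[OF lin quad])
    also have "\<dots> = e * K ^ k / (real k)\<^sup>2" using less.prems by (simp add: field_simps)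
    finally have "C * coeff_norm n (w k) \<le> e * K ^ k / (real k)\<^sup>2" .
    then show ?case using SC[of "w k"] TC[of "w k"] qw[OF less.prems] rw[OF less.prems] by auto
  qed
  have le: "e * K ^ k / (real k)\<^sup>2 \<le> K ^ k" if "k > 0" for k
  proof -
    have "e * K ^ k / (real k)\<^sup>2 \<le> e * K ^ k / 1"
      using that e K1 by (intro divide_left_mono) auto
    also have "\<dots> \<le> K ^ k" using e K1 by simp
    finally show ?thesis .
  qed
  have bounds: "coeff_norm n (q k) \<le> K ^ k" "coeff_norm n (r k) \<le> K ^ k" if "k > 0" for k
    using main[OF that] le[OF that] by auto
  show ?thesis
    by (rule that[OF _ _ K1 dq dr conv bounds]) (simp_all add: q_def r_def)
qed

subsection \<open>Power series in a root of the inverse of t\<close>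

text \<open>The power series \<open>F\<close> evaluated at the \<open>m\<close>-th root of the inverse of \<open>t\<close>.\<close>

definition root_series :: "nat \<Rightarrow> complex fps \<Rightarrow> puiseux" where
  "root_series m F = Abs_puiseux (ps_of_fls m (fps_to_fls F))"

lemma coeff_of_root_series:
  assumes "m > 0" "fps_conv_radius F > 0"
  shows "coeff_of (root_series m F) = ps_of_fls m (fps_to_fls F)"
  unfolding root_series_def using ps_of_fls_puiseux[of m "fps_to_fls F"] assms
  by (subst Abs_puiseux_inverse) auto

lemma coeff_of_root_series_nth:
  assumes "m > 0" "fps_conv_radius F > 0"
  shows "coeff_of (root_series m F) (- of_nat k / of_nat m) = fps_nth F k"
  using ps_of_fls_nth[OF assms(1), of "fps_to_fls F" "int k"]
  by (simp add: coeff_of_root_series[OF assms])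

lemma coeff_of_root_series_0:
  "m > 0 \<Longrightarrow> fps_conv_radius F > 0 \<Longrightarrow> coeff_of (root_series m F) 0 = fps_nth F 0"
  using coeff_of_root_series_nth[of m F 0] by simp

lemma root_series_0 [simp]: "root_series m 0 = 0"
  by (simp add: root_series_def zero_puiseux_def flip: ps_of_fls_0)

lemma root_series_1 [simp]: "m > 0 \<Longrightarrow> root_series m 1 = 1"
  by (simp add: root_series_def one_puiseux_def flip: ps_of_fls_1)

lemma root_series_mult:
  assumes "m > 0" "fps_conv_radius F > 0" "fps_conv_radius G > 0"
  shows "root_series m (F * G) = root_series m F * root_series m G" "fps_conv_radius (F * G) > 0"
proof -
  show FG: "fps_conv_radius (F * G) > 0"
    using fps_conv_radius_mult[of F G] assms by (metis min_less_iff_conj order_less_le_trans)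
  show "root_series m (F * G) = root_series m F * root_series m G"
    unfolding coeff_of_inject[symmetric] coeff_of_mult using assms FG
    by (simp add: coeff_of_root_series ps_of_fls_mult fls_times_fps_to_fls)
qed

lemma root_series_add:
  assumes "m > 0" "fps_conv_radius F > 0" "fps_conv_radius G > 0"
  shows "root_series m (F + G) = root_series m F + root_series m G" "fps_conv_radius (F + G) > 0"
proof -
  show FG: "fps_conv_radius (F + G) > 0"
    using fps_conv_radius_add[of F G] assms by (metis min_less_iff_conj order_less_le_trans)
  show "root_series m (F + G) = root_series m F + root_series m G"
    unfolding coeff_of_inject[symmetric] fun_eq_iff coeff_of_add using assms FG
    by (auto simp: coeff_of_root_series ps_of_fls_def)
qed

lemma root_series_sum:
  assumes "m > 0" "\<And>a. a \<in> A \<Longrightarrow> fps_conv_radius (F a) > 0"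
  shows "root_series m (sum F A) = (\<Sum>a\<in>A. root_series m (F a)) \<and> fps_conv_radius (sum F A) > 0"
  using assms(2)
  by (induction A rule: infinite_finite_induct) (simp_all add: root_series_add[OF assms(1)])

text \<open>Each series has a common denominator of its exponents; for finitely many series, take the product.\<close>

lemma exp_le_0_root_series:
  assumes "finite X" "\<And>x. x \<in> X \<Longrightarrow> exp_le x 0"
  obtains m where "m > 0" "\<And>x. x \<in> X \<Longrightarrow> \<exists>F. fps_conv_radius F > 0 \<and> x = root_series m F"
proof -
  have "\<exists>m>0. \<forall>x\<in>X. puiseux_in m (coeff_of x)"
    using assms(1)
  proof (induction X rule: finite_induct)
    case (insert x X)
    then obtain m where m: "m > 0" "\<forall>x\<in>X. puiseux_in m (coeff_of x)" by blast
    obtain k where k: "k > 0" "puiseux_in k (coeff_of x)" using coeff_of[of x] by auto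
    show ?case using m k puiseux_in_mult[OF _ k(1) m(1), of "coeff_of x"] puiseux_in_mult[OF _ m(1) k(1)]
      by (intro exI[of _ "m * k"]) (auto simp: mult.commute)
  qed auto
  then obtain m where m: "m > 0" "\<forall>x\<in>X. puiseux_in m (coeff_of x)" by blast
  have "\<exists>F. fps_conv_radius F > 0 \<and> x = root_series m F" if x: "x \<in> X" for x
  proof -
    obtain F where F: "coeff_of x = ps_of_fls m F" "fls_conv_radius F > 0"
      using m x puiseux_in_iff_fls by blast
    have "fls_nth F i = 0" if "i < 0" for i
    proof -
      have "- of_int i / of_nat m > (0 :: rat)" using that m(1) by (simp add: divide_neg_pos)
      then have "coeff_of x (- of_int i / of_nat m) = 0"
        using assms(2)[OF x] by (simp add: exp_le_def)
      then show ?thesis unfolding F(1) ps_of_fls_nth[OF m(1)] .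
    qed
    then have "fps_to_fls (fls_regpart F) = F"
      by (metis fls_regpart_to_fls_trivial fls_subdegree_geI fls_zero_subdegree nle_le order.refl)
    then show ?thesis
      using F coeff_of_inverse[of x] unfolding root_series_def by (intro exI[of _ "fls_regpart F"])
        (auto simp: fls_conv_radius_def)
  qed
  then show ?thesis using that m(1) by blast
qed

lemma geometric_bound_imp_conv_radius:
  assumes "\<And>k. cmod (fps_nth F k) \<le> M * K ^ k" "K \<ge> 1"
  shows "fps_conv_radius F > 0"
proof -
  define z where "z = complex_of_real (1 / (2 * K))"
  have B: "norm (fps_nth F k * z ^ k) \<le> M * (1 / 2) ^ k" for k
  proof -
    have "norm z = 1 / (2 * K)" using assms(2) by (simp add: z_def norm_divide norm_mult)
    then have "norm (fps_nth F k * z ^ k) = cmod (fps_nth F k) * (1 / (2 * K)) ^ k"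
      by (simp add: norm_mult norm_power)
    also have "\<dots> \<le> (M * K ^ k) * (1 / (2 * K)) ^ k"
      using assms by (intro mult_right_mono) auto
    also have "\<dots> = M * (1 / 2) ^ k" using assms(2) by (simp add: power_divide power_mult_distrib)
    finally show ?thesis .
  qed
  have "summable (\<lambda>k. M * (1 / 2 :: real) ^ k)" by (intro summable_mult summable_geometric) simp
  then have "summable (\<lambda>k. fps_nth F k * z ^ k)"
    by (rule summable_comparison_test') (rule B)
  from conv_radius_geI[OF this] have "conv_radius (fps_nth F) \<ge> norm z" .
  moreover have "0 < ereal (norm z)" using assms(2) by (simp add: z_def)
  ultimately show ?thesis unfolding fps_conv_radius_def by (rule order_less_le_trans[rotated])
qed

lemma conv_radius_imp_geometric_bound:
  assumes "fps_conv_radius F > 0"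
  obtains K where "K \<ge> 1" "\<And>k. cmod (fps_nth F k) \<le> K ^ Suc k"
proof -
  obtain r where r: "r > 0" "ereal r < fps_conv_radius F"
    using assms ereal_dense2[of 0 "fps_conv_radius F"] by auto
  have "summable (\<lambda>k. fps_nth F k * of_real r ^ k)"
    using r by (intro summable_in_conv_radius) (simp add: fps_conv_radius_def)
  then have "Bseq (\<lambda>k. fps_nth F k * of_real r ^ k)"
    by (intro convergent_imp_Bseq) (metis convergent_def summable_LIMSEQ_zero)
  then obtain B where B: "\<And>k. cmod (fps_nth F k * of_real r ^ k) \<le> B" unfolding Bseq_def by blast
  define K where "K = 1 + \<bar>B\<bar> + 1 / r"
  have K: "K \<ge> 1" "\<bar>B\<bar> \<le> K" "1 / r \<le> K" using r by (auto simp: K_def)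
  have "cmod (fps_nth F k) \<le> K ^ Suc k" for k
  proof -
    have "cmod (fps_nth F k) = cmod (fps_nth F k * of_real r ^ k) * (1 / r) ^ k"
      using r by (simp add: norm_mult norm_power power_one_over)
    also have "\<dots> \<le> K * K ^ k"
      using B[of k] K r by (intro mult_mono power_mono) auto
    finally show ?thesis by simp
  qed
  then show ?thesis using that K(1) by blast
qed

text \<open>Hensel's lemma.  Reduction modulo the maximal ideal takes constant coefficients.  Once all
  coefficients of \<open>P\<close> are written as power series in one root of the inverse of \<open>t\<close>, the polynomial
  becomes a power series with polynomial coefficients, which \<open>hensel_sequences\<close> factors.\<close>

lemma puiseux_hensel:
  fixes P :: "puiseux poly"
  assumes monic: "lead_coeff P = 1" and int: "\<And>i. exp_le (coeff P i) 0"
    and red: "\<And>i. coeff (Q\<^sub>0 * R\<^sub>0) i = coeff_of (coeff P i) 0"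
    and QR: "coprime Q\<^sub>0 R\<^sub>0" "degree Q\<^sub>0 > 0" "degree R\<^sub>0 > 0"
  obtains Q R where "P = Q * R" "degree Q > 0" "degree R > 0"
proof -
  define n where "n = degree P"
  have n: "n = degree Q\<^sub>0 + degree R\<^sub>0"
  proof -
    have "degree (Q\<^sub>0 * R\<^sub>0) = n"
    proof (rule antisym)
      show "degree (Q\<^sub>0 * R\<^sub>0) \<le> n" by (rule degree_le) (auto simp: red n_def coeff_eq_0 coeff_of_0)
      show "n \<le> degree (Q\<^sub>0 * R\<^sub>0)" by (rule le_degree) (simp add: red n_def monic coeff_of_1)
    qed
    then show ?thesis using QR by (subst (asm) degree_mult_eq) auto
  qed
  obtain m where m: "m > 0"
    and "\<And>x. x \<in> coeff P ` {..n} \<Longrightarrow> \<exists>F. fps_conv_radius F > 0 \<and> x = root_series m F"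
    using exp_le_0_root_series[of "coeff P ` {..n}"] int by blast
  then have "\<forall>i. \<exists>F. i \<le> n \<longrightarrow> fps_conv_radius F > 0 \<and> coeff P i = root_series m F" by blast
  then obtain F' where F': "\<And>i. i \<le> n \<Longrightarrow> fps_conv_radius (F' i) > 0"
    "\<And>i. i \<le> n \<Longrightarrow> coeff P i = root_series m (F' i)" by metis
  \<comment> \<open>Writing the leading coefficient as the series \<open>1\<close> confines all later coefficients \<open>p k\<close> to degrees
    below \<open>n\<close>.\<close>
  define F where "F = (\<lambda>i. if i < n then F' i else if i = n then 1 else 0)"
  have F: "fps_conv_radius (F i) > 0" "coeff P i = root_series m (F i)" for i
    using F'[of i] monic m by (auto simp: F_def n_def coeff_eq_0)
  define p where "p = (\<lambda>k. \<Sum>i\<le>n. monom (fps_nth (F i) k) i)"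
  have p: "coeff (p k) i = fps_nth (F i) k" for k i
    unfolding p_def coeff_sum by (simp add: F_def)
  have p0: "p 0 = Q\<^sub>0 * R\<^sub>0"
    by (rule poly_eqI) (simp add: p red F(2) coeff_of_root_series_0[OF m F(1)])
  have pdeg: "coeff (p k) i = 0" if "k > 0" "i \<ge> n" for k i
    using that by (auto simp: p F_def)
  have "\<forall>i. \<exists>K\<ge>1. \<forall>k. cmod (fps_nth (F i) k) \<le> K ^ Suc k"
    using conv_radius_imp_geometric_bound[OF F(1)] by metis
  then obtain K where K: "\<And>i. K i \<ge> 1" "\<And>i k. cmod (fps_nth (F i) k) \<le> K i ^ Suc k" by metis
  define L where "L = 1 + (\<Sum>i<n. K i)"
  have KL: "K i \<le> L" if "i < n" for i
  proof -
    have "K i \<le> (\<Sum>i<n. K i)" using K(1) that by (intro member_le_sum) (auto intro: order_trans[of 0 1])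
    then show ?thesis by (simp add: L_def)
  qed
  have L1: "L \<ge> 1" unfolding L_def using K(1) by (auto intro!: sum_nonneg intro: order_trans[of 0 1])
  have norm_p: "coeff_norm n (p k) \<le> (real n * L) * L ^ k" for k
  proof -
    have "coeff_norm n (p k) \<le> (\<Sum>i<n. L ^ Suc k)"
      unfolding coeff_norm_def p
    proof (rule sum_mono)
      fix i assume "i \<in> {..<n}"
      then have "K i ^ Suc k \<le> L ^ Suc k" using KL K(1)[of i] by (intro power_mono) auto
      then show "cmod (fps_nth (F i) k) \<le> L ^ Suc k" using K(2)[of i k] by linarith
    qed
    then show ?thesis by simp
  qed
  have M0: "real n * L \<ge> 0" using L1 by simp
  obtain q r B where qr0: "q 0 = Q\<^sub>0" "r 0 = R\<^sub>0" and B: "B \<ge> 1"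
    and qdeg: "\<And>k i. k > 0 \<Longrightarrow> i \<ge> degree Q\<^sub>0 \<Longrightarrow> coeff (q k) i = 0"
    and rdeg: "\<And>k i. k > 0 \<Longrightarrow> i \<ge> degree R\<^sub>0 \<Longrightarrow> coeff (r k) i = 0"
    and conv: "\<And>k. p k = (\<Sum>j\<le>k. q j * r (k - j))"
    and qb: "\<And>k. k > 0 \<Longrightarrow> coeff_norm n (q k) \<le> B ^ k"
    and rb: "\<And>k. k > 0 \<Longrightarrow> coeff_norm n (r k) \<le> B ^ k"
    by (rule hensel_sequences[OF p0 QR n pdeg norm_p L1 M0]) (assumption, assumption, rule that)
  have lift: "\<exists>T. (\<forall>i. coeff T i = root_series m (Abs_fps (\<lambda>k. coeff (s k) i))) \<and> degree T = degree (s 0)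
      \<and> (\<forall>i. fps_conv_radius (Abs_fps (\<lambda>k. coeff (s k) i)) > 0)"
    if s: "\<And>k i. k > 0 \<Longrightarrow> i \<ge> degree (s 0) \<Longrightarrow> coeff (s k) i = 0"
      "\<And>k. k > 0 \<Longrightarrow> coeff_norm n (s k) \<le> B ^ k" "0 < degree (s 0)" "degree (s 0) \<le> n" for s
  proof -
    let ?G = "\<lambda>i. Abs_fps (\<lambda>k. coeff (s k) i)"
    have conv: "fps_conv_radius (?G i) > 0" for i
    proof (rule geometric_bound_imp_conv_radius[OF _ B])
      fix k
      have "cmod (coeff (s k) i) \<le> 1 * B ^ k" if "k > 0"
      proof (cases "i < n")
        case True
        then show ?thesis using s(2)[OF that] cmod_coeff_le_coeff_norm[of i n "s k"] by simp
      next
        case False then show ?thesis using s(1)[OF that, of i] s(4) B by simp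
      qed
      also have "\<dots> \<le> (1 + cmod (coeff (s 0) i)) * B ^ k" using B by (intro mult_right_mono) auto
      finally show "cmod (fps_nth (?G i) k) \<le> (1 + cmod (coeff (s 0) i)) * B ^ k"
        by (cases "k = 0") auto
    qed
    define T where "T = (\<Sum>i\<le>degree (s 0). monom (root_series m (?G i)) i)"
    have zero: "?G i = 0" if "i > degree (s 0)" for i
      using s(1)[of _ i] that by (auto simp: fps_eq_iff coeff_eq_0) (metis coeff_eq_0 less_imp_le neq0_conv)
    have T: "coeff T i = root_series m (?G i)" for i
      unfolding T_def coeff_sum using zero[of i] by (auto simp: not_le)
    have "degree T = degree (s 0)"
    proof (rule antisym)
      show "degree T \<le> degree (s 0)" by (rule degree_le) (simp add: T zero)
      have "coeff_of (coeff T (degree (s 0))) 0 = lead_coeff (s 0)"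
        unfolding T by (subst coeff_of_root_series_0[OF m conv]) simp
      moreover have "lead_coeff (s 0) \<noteq> 0" using s(3) by auto
      ultimately show "degree (s 0) \<le> degree T" by (intro le_degree) (auto simp: coeff_of_0)
    qed
    then show ?thesis using T conv by blast
  qed
  obtain Q where Q: "\<And>i. coeff Q i = root_series m (Abs_fps (\<lambda>k. coeff (q k) i))" "degree Q = degree Q\<^sub>0"
      "\<And>i. fps_conv_radius (Abs_fps (\<lambda>k. coeff (q k) i)) > 0"
    using lift[of q] qdeg qb QR n unfolding qr0 by auto
  obtain R where R: "\<And>i. coeff R i = root_series m (Abs_fps (\<lambda>k. coeff (r k) i))" "degree R = degree R\<^sub>0"
      "\<And>i. fps_conv_radius (Abs_fps (\<lambda>k. coeff (r k) i)) > 0"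
    using lift[of r] rdeg rb QR n unfolding qr0 by auto
  have "P = Q * R"
  proof (rule poly_eqI)
    fix i
    let ?G = "\<lambda>i. Abs_fps (\<lambda>k. coeff (q k) i)" and ?H = "\<lambda>i. Abs_fps (\<lambda>k. coeff (r k) i)"
    have "F i = (\<Sum>j\<le>i. ?G j * ?H (i - j))"
    proof (rule fps_ext)
      fix k
      have "fps_nth (\<Sum>j\<le>i. ?G j * ?H (i - j)) k
          = (\<Sum>j\<le>i. \<Sum>l\<le>k. coeff (q l) j * coeff (r (k - l)) (i - j))"
        by (simp add: fps_sum_nth fps_mult_nth atLeast0AtMost)
      also have "\<dots> = (\<Sum>l\<le>k. coeff (q l * r (k - l)) i)"
        unfolding coeff_mult by (rule sum.swap)
      also have "\<dots> = fps_nth (F i) k" unfolding p[symmetric] conv coeff_sum ..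
      finally show "fps_nth (F i) k = fps_nth (\<Sum>j\<le>i. ?G j * ?H (i - j)) k" ..
    qed
    then have "coeff P i = (\<Sum>j\<le>i. root_series m (?G j * ?H (i - j)))"
      using root_series_sum[OF m, of "{..i}" "\<lambda>j. ?G j * ?H (i - j)"] root_series_mult(2)[OF m Q(3) R(3)]
      by (simp add: F(2))
    then show "coeff P i = coeff (Q * R) i"
      unfolding coeff_mult Q(1) R(1) by (simp add: root_series_mult(1)[OF m Q(3) R(3)])
  qed
  then show ?thesis using that Q(2) R(2) QR by simp
qed

subsection \<open>Algebraic closedness\<close>

text \<open>The only polynomials without two distinct roots are powers of a linear factor; the
  vanishing next-to-leading coefficient then forces the root to be zero.\<close>

lemma two_distinct_roots:
  fixes p :: "complex poly"
  assumes "degree p = n" "n > 1" "lead_coeff p = 1" "coeff p (n - 1) = 0" "i < n" "coeff p i \<noteq> 0"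
  obtains x y where "poly p x = 0" "poly p y = 0" "x \<noteq> y"
proof (rule ccontr)
  note distinct = that
  assume "\<not> thesis"
  then have unique: "y = x" if "poly p x = 0" "poly p y = 0" for x y
    using that distinct by metis
  obtain x where x: "poly p x = 0" using alg_closed_imp_poly_has_root[of p] assms by auto
  obtain A where A: "size A = n" "p = (\<Prod>x\<in>#A. [:-x, 1:])"
    using alg_closed_imp_factorization[of p] assms by force
  have "y = x" if "y \<in># A" for y
  proof -
    have "poly p y = 0" unfolding A(2) using that by (auto simp: poly_prod_mset prod_mset_zero_iff)
    then show ?thesis using unique x by blast
  qed
  then have "A = replicate_mset n x" using A(1) set_mset_subset_singletonD[of A x] by auto
  then have p: "p = [:-x, 1:] ^ n" using A(2) by simp
  have "of_nat (n choose (n - 1)) * (- x) = 0"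
    using assms(2,4) coeff_linear_poly_power[of "n - 1" n "-x" 1] unfolding p by simp
  then have "x = 0" using assms(2) by auto
  then show False using assms(5,6) coeff_linear_poly_power[of i n "-x" 1] unfolding p by simp
qed

text \<open>Newton and Puiseux: rescaling the variable by the power of \<open>t\<close> given by the steepest slope of the
  Newton polygon makes all coefficients integral and some lower one a unit.  Then the reduction has
  two distinct roots, hence coprime factors, and Hensel's lemma applies.\<close>

instance puiseux :: alg_closed_field
proof (rule alg_closedI_reducible_coeff_deg_minus_one_eq_0)
  fix p :: "puiseux poly"
  assume p: "degree p > 1" "lead_coeff p = 1" "coeff p (degree p - 1) = 0" "coeff p 0 \<noteq> 0"
  define n where "n = degree p"
  define I where "I = {i. i < n \<and> coeff p i \<noteq> 0}"
  define slope where "slope = (\<lambda>i. lead_exp (coeff p i) / of_nat (n - i))"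
  define s where "s = Max (slope ` I)"
  have "0 \<in> I" using p by (simp add: I_def n_def)
  then have I: "finite I" "I \<noteq> {}" by (auto simp: I_def)
  define c where "c = tpow s"
  have c: "c \<noteq> 0" "lead_exp c = s" by (simp_all add: c_def)
  define P where "P = smult (inverse c ^ n) (pcompose p [:0, c:])"
  have coeffP: "coeff P i = inverse c ^ n * c ^ i * coeff p i" for i
    by (simp add: P_def coeff_pcompose_linear)
  have lP: "lead_exp (coeff P i) = lead_exp (coeff p i) - of_nat (n - i) * s"
    if "i \<le> n" "coeff p i \<noteq> 0" for i
    using that c by (simp add: coeffP lead_exp_mult lead_exp_power lead_exp_inverse of_nat_diff algebra_simps)
  have degP: "degree P = n" using c by (simp add: P_def n_def degree_pcompose)
  have monic: "lead_coeff P = 1"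
    unfolding degP coeffP using c p by (simp add: n_def flip: power_mult_distrib)
  have slope: "lead_exp (coeff p i) = of_nat (n - i) * slope i" if "i \<in> I" for i
    using that by (simp add: slope_def I_def)
  have int: "exp_le (coeff P i) 0" for i
  proof (cases "i \<in> I")
    case True
    then have "slope i \<le> s" using I by (simp add: s_def)
    then have "lead_exp (coeff P i) \<le> 0"
      using True slope[OF True] lP[of i] by (simp add: I_def mult_left_mono)
    then show ?thesis using exp_le_mono[OF exp_le_lead_exp] by blast
  next
    case False
    then have "coeff p i = 0 \<or> i = n" by (auto simp: I_def n_def not_less intro: coeff_eq_0)
    then show ?thesis using monic degP by (auto simp: coeffP)
  qed
  have "s \<in> slope ` I" unfolding s_def using I by (intro Max_in) auto
  then obtain i where i: "i \<in> I" "slope i = s" by blast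
  have unit: "coeff_of (coeff P i) 0 \<noteq> 0"
  proof -
    have "coeff P i \<noteq> 0" using i c by (simp add: coeffP I_def)
    moreover have "lead_exp (coeff P i) = 0" using lP[of i] i slope[OF i(1)] by (simp add: I_def)
    ultimately show ?thesis using lead_coeff_nonzero by metis
  qed
  define p0 where "p0 = (\<Sum>i\<le>n. monom (coeff_of (coeff P i) 0) i)"
  have p0: "coeff p0 j = coeff_of (coeff P j) 0" for j
    unfolding p0_def coeff_sum using degP by (auto simp: coeff_eq_0 coeff_of_0)
  have deg0: "degree p0 = n"
  proof (rule antisym)
    show "degree p0 \<le> n" by (rule degree_le) (simp add: p0 degP coeff_eq_0 coeff_of_0)
    show "n \<le> degree p0" using monic by (intro le_degree) (simp add: p0 degP coeff_of_1)
  qed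
  have monic0: "lead_coeff p0 = 1" and next0: "coeff p0 (n - 1) = 0"
    using monic p(3) unfolding p0 deg0 degP by (simp_all add: coeff_of_1 coeffP n_def coeff_of_0)
  have "n > 1" "i < n" "coeff p0 i \<noteq> 0" using p(1) i(1) unit by (simp_all add: n_def I_def p0)
  then obtain x y where xy: "poly p0 x = 0" "poly p0 y = 0" "x \<noteq> y"
    by (rule two_distinct_roots[OF deg0 _ monic0 next0])
  have "degree p0 > 1" using p(1) deg0 by (simp add: n_def)
  then obtain Q0 R0 where QR0: "degree Q0 > 0" "degree R0 > 0" "coprime Q0 R0" "p0 = Q0 * R0"
    by (rule alg_closed_imp_poly_splits_coprime[OF _ xy])
  have red: "coeff (Q0 * R0) j = coeff_of (coeff P j) 0" for j
    using p0 unfolding QR0(4) .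
  obtain Q R where QR: "P = Q * R" "degree Q > 0" "degree R > 0"
    by (rule puiseux_hensel[OF monic int red QR0(3,1,2)])
  define Q' R' where "Q' = smult (c ^ n) (pcompose Q [:0, inverse c:])" "R' = pcompose R [:0, inverse c:]"
  have "p = Q' * R'"
  proof (rule poly_eqI)
    fix j
    have "Q' * R' = smult (c ^ n) (pcompose P [:0, inverse c:])"
      by (simp add: Q'_R'_def QR(1) pcompose_mult)
    then have "coeff (Q' * R') j = c ^ n * (inverse c ^ j * (inverse c ^ n * c ^ j * coeff p j))"
      by (simp add: coeff_pcompose_linear coeffP)
    also have "\<dots> = coeff p j" using c(1) by (simp add: field_simps)
    finally show "coeff p j = coeff (Q' * R') j" ..
  qed
  moreover have "degree Q' > 0" "degree R' > 0"
    using QR c by (simp_all add: Q'_R'_def degree_pcompose)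
  then have "\<not> is_unit Q'" "\<not> is_unit R'" by (auto simp: is_unit_iff_degree)
  ultimately show "\<not> irreducible p" by (auto simp: irreducible_def)
qed

section \<open>Existence of singular values\<close>

lemma index_mat_adjoint:
  "A \<in> carrier_mat m n \<Longrightarrow> i < n \<Longrightarrow> j < m \<Longrightarrow> mat_adjoint A $$ (i, j) = conjugate (A $$ (j, i))"
  by (simp add: mat_adjoint_def mat_of_rows_index)

lemma mat_adjoint_carrier: "A \<in> carrier_mat m n \<Longrightarrow> mat_adjoint A \<in> carrier_mat n m"
  by (intro carrier_matI) (auto simp: mat_adjoint_def)

lemma norm_sq_pos: "x \<noteq> 0 \<Longrightarrow> ps_pos (x * conjugate x)"
  using sum_norm_sq(1)[of "{x}" x "\<lambda>x. x"] by (simp add: exp_le_lead_exp)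

text \<open>If a square root \<open>s\<close> of a positive element were not real, then \<open>s\<close> would be purely
  imaginary and \<open>s\<^sup>2\<close> negative.\<close>

lemma ps_pos_sqrt:
  assumes x: "ps_pos x"
  obtains s where "ps_pos s" "s\<^sup>2 = x"
proof -
  obtain s where s: "s\<^sup>2 = x" using nth_root_exists[of 2 x] by auto
  have s0: "s \<noteq> 0" using s x by (auto simp: ps_pos_def)
  have "(conjugate s)\<^sup>2 = s\<^sup>2"
    using s x by (simp add: power2_eq_square ps_pos_def ps_real_iff flip: conjugate_dist_mul)
  then consider "conjugate s = s" | "conjugate s = - s" by (auto simp: power2_eq_iff)
  then show ?thesis
  proof cases
    case 1
    then have real: "ps_real s" "ps_real (- s)" by (simp_all add: ps_real_iff conjugate_neg)
    then obtain r where r: "coeff_of s (lead_exp s) = of_real r" unfolding ps_real_def by (metis Reals_cases)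
    have "r \<noteq> 0" using lead_coeff_nonzero[OF s0] r by auto
    then have "ps_pos s \<or> ps_pos (- s)"
      using real s0 r by (auto simp: ps_pos_def coeff_of_uminus)
    then show ?thesis using that s by (metis power2_minus)
  next
    case 2
    then have "ps_pos (- x)" using norm_sq_pos[OF s0] s by (simp add: power2_eq_square)
    then show ?thesis using ps_pos_uminus x by auto
  qed
qed

lemma ps_ge_total: "ps_real x \<Longrightarrow> ps_real y \<Longrightarrow> ps_ge x y \<or> ps_ge y x"
proof -
  assume xy: "ps_real x" "ps_real y"
  define d where "d = x - y"
  have d: "ps_real d" "ps_real (- d)" using xy by (simp_all add: d_def ps_real_iff conjugate_diff)
  then obtain r where r: "coeff_of d (lead_exp d) = of_real r" unfolding ps_real_def by (metis Reals_cases)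
  show ?thesis
  proof (cases "d = 0")
    case False
    then have "r \<noteq> 0" using lead_coeff_nonzero[OF False] r by auto
    then have "ps_pos d \<or> ps_pos (- d)"
      using d False r by (auto simp: ps_pos_def coeff_of_uminus)
    then show ?thesis by (auto simp: ps_ge_def d_def)
  qed (simp add: d_def ps_ge_def)
qed

lemma ps_ge_trans: "ps_ge x y \<Longrightarrow> ps_ge y z \<Longrightarrow> ps_ge x z"
  using ps_pos_add[of "x - y" "y - z"] by (auto simp: ps_ge_def)

lemma ps_ge_sorted_list_exists:
  "(\<And>x. x \<in># M \<Longrightarrow> ps_real x) \<Longrightarrow> \<exists>xs. mset xs = M \<and> sorted_wrt ps_ge xs"
proof (induction M)
  case (add x M)
  then obtain xs where xs: "mset xs = M" "sorted_wrt ps_ge xs" by auto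
  define us vs where "us = filter (\<lambda>y. ps_ge y x) xs" "vs = filter (\<lambda>y. \<not> ps_ge y x) xs"
  have real: "ps_real y" if "y \<in> set xs" for y using add.prems xs(1) that by auto
  have v: "ps_ge x y" if "y \<in> set vs" for y
    using that ps_ge_total[of x y] real[of y] add.prems[of x] by (auto simp: us_vs_def)
  have u: "ps_ge y x" if "y \<in> set us" for y using that by (auto simp: us_vs_def)
  have "sorted_wrt ps_ge (us @ x # vs)"
    unfolding sorted_wrt_append using xs(2) u v ps_ge_trans
    by (auto simp: us_vs_def sorted_wrt_filter)
  moreover have "mset (us @ x # vs) = add_mset x M" by (simp add: us_vs_def flip: xs(1))
  ultimately show ?case by blast
qed auto

lemma char_poly_splits:
  fixes M :: "puiseux mat"
  assumes "M \<in> carrier_mat n n"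
  shows "char_poly M = (\<Prod>x\<in>#proots (char_poly M). [:-x, 1:])" "size (proots (char_poly M)) = n"
proof -
  have m: "degree (char_poly M) = n" "lead_coeff (char_poly M) = 1"
    using degree_monic_char_poly[OF assms] by auto
  then have "char_poly M \<noteq> 0" by auto
  then obtain E where E: "size E = n" "char_poly M = (\<Prod>x\<in>#E. [:-x, 1:])"
    using alg_closed_imp_factorization[of "char_poly M"] m by auto
  have nz: "(\<Prod>x\<in>#E. [:-x, 1:]) \<noteq> (0 :: puiseux poly)" for E
    by (auto simp: prod_mset_zero_iff)
  have "proots (\<Prod>x\<in>#E. [:-x, 1:]) = E" for E :: "puiseux multiset"
  proof (induction E)
    case (add x E)
    have "proots ([:-x, 1:] * (\<Prod>x\<in>#E. [:-x, 1:])) = proots [:-x, 1:] + proots (\<Prod>x\<in>#E. [:-x, 1:])"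
      by (rule proots_mult) (use nz in auto)
    then show ?case by (simp add: add.IH del: mult_pCons_left)
  qed simp
  then show "char_poly M = (\<Prod>x\<in>#proots (char_poly M). [:-x, 1:])" "size (proots (char_poly M)) = n"
    using E by auto
qed

text \<open>An eigenvalue of \<open>A\<^sup>* A\<close> with eigenvector \<open>v\<close> is the Rayleigh quotient \<open>\<bar>A v\<bar>\<^sup>2 / \<bar>v\<bar>\<^sup>2\<close>.\<close>

lemma eigenvalue_gram_pos:
  fixes A :: "puiseux mat"
  assumes A: "A \<in> carrier_mat n n" and det: "det A \<noteq> 0"
    and root: "poly (char_poly (mat_adjoint A * A)) x = 0"
  shows "ps_pos x"
proof -
  let ?H = "mat_adjoint A * A"
  have A': "mat_adjoint A \<in> carrier_mat n n" using A by (rule mat_adjoint_carrier)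
  have H: "?H \<in> carrier_mat n n" using A A' by simp
  obtain v where v: "v \<in> carrier_vec n" "v \<noteq> 0\<^sub>v n" "?H *\<^sub>v v = x \<cdot>\<^sub>v v"
    using eigenvalue_root_char_poly[OF H, of x] root H A' by (auto simp: eigenvalue_def eigenvector_def)
  define w where "w = A *\<^sub>v v"
  have w: "w \<in> carrier_vec n" using A v by (simp add: w_def)
  have w0: "w \<noteq> 0\<^sub>v n" using det det_0_iff_vec_prod_zero[OF A] v unfolding w_def by auto
  have pos: "ps_pos (\<Sum>i<n. u $ i * conjugate (u $ i))" if u: "u \<in> carrier_vec n" "u \<noteq> 0\<^sub>v n" for u :: "puiseux vec"
  proof -
    let ?I = "{i. i < n \<and> u $ i \<noteq> 0}"
    have I: "finite ?I" "?I \<noteq> {}" using u by auto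
    have "Max ((\<lambda>i. lead_exp (u $ i)) ` ?I) \<in> (\<lambda>i. lead_exp (u $ i)) ` ?I"
      using I by (intro Max_in) auto
    then obtain i where i: "i < n" "u $ i \<noteq> 0" "lead_exp (u $ i) = Max ((\<lambda>i. lead_exp (u $ i)) ` ?I)"
      by auto
    have "exp_le (u $ j) (lead_exp (u $ i))" if "j < n" for j
      using I that by (cases "u $ j = 0") (auto simp: i(3) exp_le_iff)
    then show ?thesis using i by (intro sum_norm_sq(1)[of _ i]) auto
  qed
  have comp: "x * v $ i = (\<Sum>r<n. conjugate (A $$ (r, i)) * w $ r)" if "i < n" for i
  proof -
    have "x * v $ i = (?H *\<^sub>v v) $ i" using v that by simp
    also have "?H *\<^sub>v v = mat_adjoint A *\<^sub>v w" using A A' v unfolding w_def by (rule_tac assoc_mult_mat_vec) auto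
    also have "\<dots> $ i = (\<Sum>r<n. conjugate (A $$ (r, i)) * w $ r)"
      using that A A' w by (simp add: scalar_prod_def index_mat_adjoint[OF A] atLeast0LessThan)
    finally show ?thesis .
  qed
  have wr: "w $ r = (\<Sum>i<n. A $$ (r, i) * v $ i)" if "r < n" for r
    using that A v by (simp add: w_def scalar_prod_def atLeast0LessThan)
  have "x * (\<Sum>i<n. v $ i * conjugate (v $ i)) = (\<Sum>i<n. x * v $ i * conjugate (v $ i))"
    by (simp add: sum_distrib_left mult.assoc)
  also have "\<dots> = (\<Sum>i<n. \<Sum>r<n. w $ r * conjugate (A $$ (r, i) * v $ i))"
    by (intro sum.cong) (simp_all add: comp sum_distrib_right sum_distrib_left conjugate_dist_mul mult_ac)
  also have "\<dots> = (\<Sum>r<n. w $ r * conjugate (w $ r))"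
    unfolding sum_distrib_left[symmetric] by (subst sum.swap) (simp add: wr sum_conjugate sum_distrib_left)
  finally have eq: "x * (\<Sum>i<n. v $ i * conjugate (v $ i)) = (\<Sum>r<n. w $ r * conjugate (w $ r))" .
  have pv: "ps_pos (\<Sum>i<n. v $ i * conjugate (v $ i))" using pos v by blast
  then have "(\<Sum>i<n. v $ i * conjugate (v $ i)) \<noteq> 0" by (simp add: ps_pos_def)
  then have "x = (\<Sum>r<n. w $ r * conjugate (w $ r)) / (\<Sum>i<n. v $ i * conjugate (v $ i))"
    using eq by (simp add: nonzero_eq_divide_eq)
  then show ?thesis using ps_pos_divide pos w w0 pv by simp
qed

lemma is_Sing_exists:
  fixes A :: "puiseux mat"
  assumes A: "A \<in> carrier_mat n n" and det: "det A \<noteq> 0"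
  obtains ss where "is_Sing A ss"
proof -
  let ?H = "mat_adjoint A * A"
  have H: "?H \<in> carrier_mat n n" using A mat_adjoint_carrier[OF A] by simp
  define E where "E = proots (char_poly ?H)"
  have "char_poly ?H \<noteq> 0" using degree_monic_char_poly[OF H] by auto
  then have pos: "ps_pos x" if "x \<in># E" for x
    using that eigenvalue_gram_pos[OF A det] by (simp add: E_def)
  then have "\<forall>x. \<exists>s. x \<in># E \<longrightarrow> ps_pos s \<and> s\<^sup>2 = x" using ps_pos_sqrt by metis
  then obtain f where f: "\<And>x. x \<in># E \<Longrightarrow> ps_pos (f x) \<and> (f x)\<^sup>2 = x" by metis
  obtain ss where ss: "mset ss = image_mset f E" "sorted_wrt ps_ge ss"
    using ps_ge_sorted_list_exists[of "image_mset f E"] f by (auto simp: ps_pos_def)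
  have "image_mset (\<lambda>s. s\<^sup>2) (mset ss) = image_mset (\<lambda>x. x) E"
    unfolding ss(1) multiset.map_comp comp_def using f by (intro image_mset_cong) auto
  moreover have "length ss = n" using char_poly_splits(2)[OF H] ss(1) by (metis E_def size_image_mset size_mset)
  moreover have "\<forall>s\<in>set ss. ps_pos s" using f by (auto simp flip: set_mset_mset simp: ss(1))
  ultimately show ?thesis using that ss(2) A by (auto simp: is_Sing_def E_def)
qed

lemma char_poly_is_Sing:
  assumes A: "A \<in> carrier_mat n n" and S: "is_Sing A ss"
  shows "char_poly (mat_adjoint A * A) = (\<Prod>x\<leftarrow>map (\<lambda>s. s\<^sup>2) ss. [:-x, 1:])"
proof -
  have H: "mat_adjoint A * A \<in> carrier_mat n n" using A mat_adjoint_carrier[OF A] by simp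
  have "proots (char_poly (mat_adjoint A * A)) = mset (map (\<lambda>s. s\<^sup>2) ss)"
    using S by (simp add: is_Sing_def)
  then show ?thesis using char_poly_splits(1)[OF H] by (simp flip: prod_mset_prod_list add: multiset.map_comp comp_def)
qed

lemma lead_exp_mono_ps_ge:
  assumes "ps_ge x y" "ps_pos y"
  shows "lead_exp y \<le> lead_exp x"
  using assms lead_exp_add_pos[of y "x - y"] unfolding ps_ge_def by auto

lemma is_Sing_lead_exps_sorted:
  assumes "is_Sing A ss"
  shows "sorted_wrt (\<ge>) (map lead_exp ss)"
proof -
  have "sorted_wrt ps_ge ss" "\<forall>s\<in>set ss. ps_pos s" using assms by (auto simp: is_Sing_def)
  then show ?thesis by (induction ss) (auto simp: lead_exp_mono_ps_ge)
qed

section \<open>Singular values and minors\<close>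

text \<open>Positivity rules out cancellation in the elementary symmetric functions, and the largest term of
  the \<open>m\<close>-th one is the product of the first \<open>m\<close> elements of the sorted list.\<close>

lemma coeff_prod_linear_factors:
  assumes "\<And>x. x \<in> set xs \<Longrightarrow> ps_pos x" "sorted_wrt (\<ge>) (map lead_exp xs)" "m \<le> length xs"
  shows "\<exists>E. ps_pos E \<and> lead_exp E = (\<Sum>i<m. lead_exp (xs ! i)) \<and>
    coeff (\<Prod>x\<leftarrow>xs. [:-x, 1:]) (length xs - m) = (-1) ^ m * E"
  using assms
proof (induction xs arbitrary: m rule: rev_induct)
  case Nil
  have "ps_pos 1" using norm_sq_pos[of 1] conjugate_divide[of "1 :: puiseux" 1]
    ps_pos_divide[of "1 * conjugate 1" "1 * conjugate 1"] by simp
  then show ?case using Nil by (intro exI[of _ 1]) auto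
next
  case (snoc y xs)
  let ?P = "\<Prod>x\<leftarrow>xs. [:-x, 1:]" and ?n = "length xs"
  have y: "ps_pos y" using snoc.prems by simp
  have IH: "\<exists>E. ps_pos E \<and> lead_exp E = (\<Sum>i<m. lead_exp (xs ! i)) \<and> coeff ?P (?n - m) = (-1) ^ m * E"
    if "m \<le> ?n" for m
    using snoc that by (auto simp: sorted_wrt_append)
  have P: "(\<Prod>x\<leftarrow>xs @ [y]. [:-x, 1:]) = pCons 0 ?P - smult y ?P"
    by (simp add: mult.commute[of ?P])
  have deg: "coeff ?P (Suc ?n) = 0"
  proof -
    have "degree ?P \<le> ?n" by (induction xs) (auto intro: order_trans[OF degree_mult_le] simp del: mult_pCons_left)
    then show ?thesis by (intro coeff_eq_0) simp
  qed
  have sum_nth: "(\<Sum>i<k. lead_exp ((xs @ [y]) ! i)) = (\<Sum>i<k. lead_exp (xs ! i))" if "k \<le> ?n" for k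
    using that by (intro sum.cong) (auto simp: nth_append)
  consider "m = 0" | k where "m = Suc k" "m \<le> ?n" | "m = Suc ?n"
    using snoc.prems(3) by (cases m) force+
  then show ?case
  proof cases
    case 1
    then show ?thesis using IH[of 0] deg unfolding P by (auto simp: coeff_pCons)
  next
    case (2 k)
    obtain E where E: "ps_pos E" "lead_exp E = (\<Sum>i<m. lead_exp (xs ! i))" "coeff ?P (?n - m) = (-1) ^ m * E"
      using IH 2 by blast
    obtain D where D: "ps_pos D" "lead_exp D = (\<Sum>i<k. lead_exp (xs ! i))" "coeff ?P (?n - k) = (-1) ^ k * D"
      using IH[of k] 2 by auto
    have yD: "ps_pos (y * D)" using y D ps_pos_mult by blast
    have l: "lead_exp (y * D) \<le> lead_exp E"
    proof -
      have "lead_exp y \<le> lead_exp (xs ! k)" using snoc.prems(2) 2 by (auto simp: sorted_wrt_append)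
      then show ?thesis using y D 2 by (simp add: lead_exp_mult ps_pos_def E(2))
    qed
    have "length (xs @ [y]) - m = Suc (?n - m)" "?n - k = Suc (?n - m)" using 2 by auto
    then have "coeff (\<Prod>x\<leftarrow>xs @ [y]. [:-x, 1:]) (length (xs @ [y]) - m) = (-1) ^ m * (E + y * D)"
      unfolding P using E(3) D(3) 2 by (simp add: algebra_simps)
    moreover have "lead_exp (E + y * D) = (\<Sum>i<m. lead_exp ((xs @ [y]) ! i))"
      using lead_exp_add_pos[OF E(1) yD] l E(2) sum_nth[OF 2(2)] by simp
    ultimately show ?thesis using ps_pos_add[OF E(1) yD] by blast
  next
    case 3
    obtain D where D: "ps_pos D" "lead_exp D = (\<Sum>i<?n. lead_exp (xs ! i))" "coeff ?P 0 = (-1) ^ ?n * D"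
      using IH[of ?n] by auto
    have "coeff (\<Prod>x\<leftarrow>xs @ [y]. [:-x, 1:]) (length (xs @ [y]) - m) = (-1) ^ m * (y * D)"
      unfolding P using D(3) 3 by simp
    moreover have "lead_exp (y * D) = (\<Sum>i<m. lead_exp ((xs @ [y]) ! i))"
      using y D 3 sum_nth[of ?n] by (simp add: lead_exp_mult ps_pos_def)
    ultimately show ?thesis using ps_pos_mult[OF y D(1)] by blast
  qed
qed

subsection \<open>A Cauchy--Binet formula\<close>

text \<open>Summing over all functions instead of over subsets counts each minor once per ordering of
  its indices, hence the factorial.\<close>

lemma cauchy_binet:
  fixes L :: "nat \<Rightarrow> 'l \<Rightarrow> 'a :: comm_ring_1" and R :: "'l \<Rightarrow> nat \<Rightarrow> 'a"
  assumes S: "finite S"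
  shows "of_nat (fact n) * det (mat n n (\<lambda>(i,j). \<Sum>p\<in>S. L i p * R p j)) =
    (\<Sum>f\<in>{0..<n} \<rightarrow>\<^sub>E S. det (mat n n (\<lambda>(i,j). L i (f j))) * det (mat n n (\<lambda>(i,j). R (f i) j)))"
proof -
  let ?P = "{p. p permutes {0..<n}}" and ?F = "{0..<n} \<rightarrow>\<^sub>E S"
  define dR where "dR = (\<lambda>f. det (mat n n (\<lambda>(i,j). R (f i) j)))"
  define D where "D = det (mat n n (\<lambda>(i,j). \<Sum>p\<in>S. L i p * R p j))"
  have dR: "dR f = (\<Sum>p\<in>?P. signof p * (\<Prod>i=0..<n. R (f i) (p i)))" for f
    unfolding dR_def by (subst det_def'[of _ n]) (auto intro!: sum.cong prod.cong)
  have "D = (\<Sum>p\<in>?P. signof p * (\<Prod>i=0..<n. \<Sum>q\<in>S. L i q * R q (p i)))"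
    unfolding D_def by (subst det_def'[of _ n]) (auto intro!: sum.cong prod.cong)
  also have "\<dots> = (\<Sum>p\<in>?P. \<Sum>f\<in>?F. (\<Prod>i=0..<n. L i (f i)) * (signof p * (\<Prod>i=0..<n. R (f i) (p i))))"
    using S by (simp add: prod_sum_PiE prod.distrib sum_distrib_left mult_ac)
  also have "\<dots> = (\<Sum>f\<in>?F. (\<Prod>i=0..<n. L i (f i)) * dR f)"
    unfolding dR sum_distrib_left by (rule sum.swap)
  finally have D: "D = (\<Sum>f\<in>?F. (\<Prod>i=0..<n. L i (f i)) * dR f)" .
  have perm: "D = (\<Sum>f\<in>?F. signof s * (\<Prod>i=0..<n. L i (f (s i))) * dR f)" if s: "s permutes {0..<n}" for s
  proof -
    have s': "inv_into UNIV s permutes {0..<n}" using s by (rule permutes_inv)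
    have comp: "f \<circ> p \<in> ?F" if "f \<in> ?F" "p permutes {0..<n}" for f p
      using that permutes_in_image[OF that(2)] permutes_not_in[OF that(2)]
      by (auto simp: PiE_iff extensional_def)
    have "D = (\<Sum>f\<in>?F. (\<Prod>i=0..<n. L i ((f \<circ> s) i)) * dR (f \<circ> s))"
      unfolding D
      by (rule sum.reindex_bij_witness[of _ "\<lambda>f. f \<circ> s" "\<lambda>f. f \<circ> inv_into UNIV s"])
        (use comp s s' permutes_inv_o[OF s] in \<open>auto simp: comp_assoc\<close>)
    moreover have "dR (f \<circ> s) = signof s * dR f" for f
    proof -
      have "mat n n (\<lambda>(i,j). R ((f \<circ> s) i) j) = mat n n (\<lambda>(i,j). mat n n (\<lambda>(i,j). R (f i) j) $$ (s i, j))"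
        using permutes_in_image[OF s] by (intro eq_matI) auto
      then show ?thesis unfolding dR_def using det_permute_rows[OF _ s, of "mat n n (\<lambda>(i,j). R (f i) j)"] by simp
    qed
    ultimately show ?thesis by (simp add: mult_ac)
  qed
  have "of_nat (fact n) * D = (\<Sum>s\<in>?P. D)"
    by (simp add: card_permutations)
  also have "\<dots> = (\<Sum>s\<in>?P. \<Sum>f\<in>?F. signof s * (\<Prod>i=0..<n. L i (f (s i))) * dR f)"
    using perm by (intro sum.cong) auto
  also have "\<dots> = (\<Sum>f\<in>?F. (\<Sum>s\<in>?P. signof s * (\<Prod>i=0..<n. L i (f (s i)))) * dR f)"
    unfolding sum_distrib_right by (rule sum.swap)
  also have "\<dots> = (\<Sum>f\<in>?F. det (mat n n (\<lambda>(i,j). L i (f j))) * dR f)"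
  proof (intro sum.cong refl arg_cong2[of _ _ _ _ "(*)"])
    fix f
    show "(\<Sum>s\<in>?P. signof s * (\<Prod>i=0..<n. L i (f (s i)))) = det (mat n n (\<lambda>(i,j). L i (f j)))"
      by (subst det_def'[of _ n]) (auto intro!: sum.cong prod.cong)
  qed
  finally show ?thesis unfolding D_def dR_def .
qed

subsection \<open>Determinants of columns chosen from several matrices\<close>

text \<open>A choice \<open>f\<close> assigns to each column position a pair: the index of a matrix of the family
  \<open>X\<close>, and the index of a column of it.\<close>

definition choice_det :: "nat \<Rightarrow> (nat \<Rightarrow> 'a :: comm_ring_1 mat) \<Rightarrow> (nat \<Rightarrow> nat \<times> nat) \<Rightarrow> 'a" where
  "choice_det n X f = det (mat n n (\<lambda>(i,p). X (fst (f p)) $$ (i, snd (f p))))"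

definition choices :: "nat \<Rightarrow> nat set \<Rightarrow> (nat \<Rightarrow> nat \<times> nat) set" where
  "choices n T = {0..<n} \<rightarrow>\<^sub>E T \<times> {0..<n}"

definition count_from :: "nat \<Rightarrow> (nat \<Rightarrow> nat \<times> nat) \<Rightarrow> nat \<Rightarrow> nat" where
  "count_from n f a = card {p \<in> {0..<n}. fst (f p) = a}"

lemma finite_choices: "finite T \<Longrightarrow> finite (choices n T)"
  unfolding choices_def by (intro finite_PiE) auto

lemma comm_ring_hom_const_poly: "comm_ring_hom (\<lambda>c :: 'a :: comm_ring_1. [:c:])"
  by unfold_locales (auto simp: one_pCons)

lemma comm_ring_hom_conjugate: "comm_ring_hom (conjugate :: puiseux \<Rightarrow> puiseux)"
proof
  show "conjugate (1 :: puiseux) = 1" using conjugate_divide[of "1 :: puiseux" 1]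
    by (metis conjugate_zero_iff div_by_1 divide_self one_neq_zero)
qed (simp_all add: conjugate_dist_add conjugate_dist_mul)

text \<open>Apply the Cauchy--Binet formula to the factorization of the characteristic matrix
  \<open>x - A A\<^sup>*\<close> as a product of \<open>(1 | A)\<close> with \<open>x\<close> stacked upon \<open>- A\<^sup>*\<close>.\<close>

lemma coeff_char_poly_gram:
  fixes A :: "puiseux mat"
  assumes A: "A \<in> carrier_mat n n" and ab: "a \<noteq> b" and X: "X a = 1\<^sub>m n" "X b = A" and m: "m \<le> n"
  shows "of_nat (fact n) * coeff (char_poly (A * mat_adjoint A)) (n - m) =
    (-1) ^ m * (\<Sum>f | f \<in> choices n {a,b} \<and> count_from n f b = m.
      choice_det n X f * conjugate (choice_det n X f))"
proof -
  let ?S = "{a,b} \<times> {0..<n}"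
  define c where "c = (\<lambda>x. if x = a then [:0,1:] else - 1 :: puiseux poly)"
  define L where "L = (\<lambda>i p. [: X (fst p) $$ (i, snd p) :])"
  define R where "R = (\<lambda>p j. c (fst p) * [: conjugate (X (fst p) $$ (j, snd p)) :])"
  have A': "mat_adjoint A \<in> carrier_mat n n" by (rule mat_adjoint_carrier[OF A])
  have entry: "(\<Sum>p\<in>?S. L i p * R p j) = char_poly_matrix (A * mat_adjoint A) $$ (i, j)"
    if ij: "i < n" "j < n" for i j
  proof -
    interpret const: comm_ring_hom "\<lambda>c :: puiseux. [:c:]" by (rule comm_ring_hom_const_poly)
    interpret conj: comm_ring_hom "conjugate :: puiseux \<Rightarrow> puiseux" by (rule comm_ring_hom_conjugate)
    have "(\<Sum>p\<in>?S. L i p * R p j) = (\<Sum>q=0..<n. L i (a,q) * R (a,q) j) + (\<Sum>q=0..<n. L i (b,q) * R (b,q) j)"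
    proof -
      have "(\<Sum>p\<in>?S. L i p * R p j) = (\<Sum>x\<in>{a,b}. \<Sum>q=0..<n. L i (x,q) * R (x,q) j)"
        unfolding sum.cartesian_product by (rule sum.cong) auto
      then show ?thesis using ab by simp
    qed
    also have "(\<Sum>q=0..<n. L i (a,q) * R (a,q) j) = (\<Sum>q=0..<n. if q = i then (if i = j then [:0,1:] else 0) else 0)"
      using ij X by (intro sum.cong) (auto simp: L_def R_def c_def)
    also have "\<dots> = (if i = j then [:0,1:] else 0)" using ij by simp
    also have "(\<Sum>q=0..<n. L i (b,q) * R (b,q) j) = - [: \<Sum>q=0..<n. A $$ (i,q) * conjugate (A $$ (j,q)) :]"
      using ab X by (simp add: L_def R_def c_def const.hom_sum mult.commute flip: sum_negf)
    also have "(\<Sum>q=0..<n. A $$ (i,q) * conjugate (A $$ (j,q))) = (A * mat_adjoint A) $$ (i, j)"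
      using ij A A' by (simp add: scalar_prod_def index_mat_adjoint[OF A])
    finally show ?thesis using ij A A' by (simp add: char_poly_matrix_def)
  qed
  have "char_poly_matrix (A * mat_adjoint A) = mat n n (\<lambda>(i,j). \<Sum>p\<in>?S. L i p * R p j)"
    using A A' by (intro eq_matI) (auto simp: entry char_poly_matrix_def)
  then have "of_nat (fact n) * char_poly (A * mat_adjoint A) =
      (\<Sum>f\<in>choices n {a,b}. det (mat n n (\<lambda>(i,j). L i (f j))) * det (mat n n (\<lambda>(i,j). R (f i) j)))"
    unfolding char_poly_def choices_def using cauchy_binet[of ?S n L R] by simp
  also have "\<dots> = (\<Sum>f\<in>choices n {a,b}. monom ((-1) ^ count_from n f b *
      (choice_det n X f * conjugate (choice_det n X f))) (n - count_from n f b))"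
  proof (rule sum.cong[OF refl])
    fix f assume f: "f \<in> choices n {a,b}"
    interpret const: comm_ring_hom "\<lambda>c :: puiseux. [:c:]" by (rule comm_ring_hom_const_poly)
    interpret conj: comm_ring_hom "conjugate :: puiseux \<Rightarrow> puiseux" by (rule comm_ring_hom_conjugate)
    let ?M = "mat n n (\<lambda>(i,p). X (fst (f p)) $$ (i, snd (f p)))"
    have "mat n n (\<lambda>(i,j). L i (f j)) = map_mat (\<lambda>c. [:c:]) ?M"
      by (intro eq_matI) (auto simp: L_def)
    then have dL: "det (mat n n (\<lambda>(i,j). L i (f j))) = [: choice_det n X f :]"
      by (simp add: choice_det_def const.hom_det)
    define N where "N = map_mat (\<lambda>c. [:c:]) (map_mat conjugate (transpose_mat ?M))"
    have N: "N \<in> carrier_mat n n" by (simp add: N_def)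
    have "det N = [: conjugate (choice_det n X f) :]"
      unfolding N_def const.hom_det conj.hom_det choice_det_def by (subst det_transpose[of _ n]) auto
    moreover have "det (mat n n (\<lambda>(i,j). R (f i) j)) = (\<Prod>i=0..<n. c (fst (f i))) * det N"
    proof -
      have perm: "p i < n" if "p permutes {0..<n}" "i < n" for p i
        using permutes_in_image[OF that(1), of i] that(2) by simp
      have "det (mat n n (\<lambda>(i,j). R (f i) j)) =
          (\<Sum>p | p permutes {0..<n}. signof p * (\<Prod>i=0..<n. c (fst (f i)) * N $$ (i, p i)))"
        by (subst det_def'[of _ n]) (auto intro!: sum.cong prod.cong simp: R_def N_def perm)
      also have "\<dots> = (\<Prod>i=0..<n. c (fst (f i))) * det N"
        unfolding det_def'[OF N] prod.distrib sum_distrib_left by (simp add: mult_ac)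
      finally show ?thesis .
    qed
    moreover have "(\<Prod>i=0..<n. c (fst (f i))) = monom ((-1) ^ count_from n f b) (n - count_from n f b)"
    proof -
      let ?B = "{i \<in> {0..<n}. fst (f i) = b}"
      have "fst (f i) = a" if "i \<in> {0..<n} - ?B" for i
        using f that by (cases "f i") (force simp: choices_def PiE_iff)
      then have "(\<Prod>i\<in>{0..<n} - ?B. c (fst (f i))) = (\<Prod>i\<in>{0..<n} - ?B. [:0,1:])"
        by (intro prod.cong) (auto simp: c_def)
      moreover have "(\<Prod>i\<in>?B. c (fst (f i))) = (\<Prod>i\<in>?B. - 1)"
        using ab by (intro prod.cong) (auto simp: c_def)
      moreover have "(\<Prod>i=0..<n. c (fst (f i))) = (\<Prod>i\<in>{0..<n} - ?B. c (fst (f i))) * (\<Prod>i\<in>?B. c (fst (f i)))"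
        by (rule prod.subset_diff) auto
      moreover have "card ({0..<n} - ?B) = n - count_from n f b"
        by (subst card_Diff_subset) (auto simp: count_from_def)
      ultimately have "(\<Prod>i=0..<n. c (fst (f i))) = [:0,1:] ^ (n - count_from n f b) * (- 1) ^ count_from n f b"
        by (simp add: count_from_def)
      then show ?thesis
        by (cases "even (count_from n f b)") (simp_all add: monom_altdef)
    qed
    ultimately show "det (mat n n (\<lambda>(i,j). L i (f j))) * det (mat n n (\<lambda>(i,j). R (f i) j)) =
        monom ((-1) ^ count_from n f b * (choice_det n X f * conjugate (choice_det n X f))) (n - count_from n f b)"
      unfolding dL by (simp add: smult_monom mult_ac)
  qed
  finally have eq: "of_nat (fact n) * char_poly (A * mat_adjoint A) =
      (\<Sum>f\<in>choices n {a,b}. monom ((-1) ^ count_from n f b *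
      (choice_det n X f * conjugate (choice_det n X f))) (n - count_from n f b))" .
  have le: "count_from n f b \<le> n" for f
  proof -
    have "count_from n f b \<le> card {0..<n}" unfolding count_from_def by (rule card_mono) auto
    then show ?thesis by simp
  qed
  have "of_nat (fact n) * coeff (char_poly (A * mat_adjoint A)) (n - m)
      = coeff (of_nat (fact n) * char_poly (A * mat_adjoint A)) (n - m)"
    by (simp add: of_nat_poly)
  also have "\<dots> = (\<Sum>f\<in>choices n {a,b}. if count_from n f b = m then (-1) ^ m *
      (choice_det n X f * conjugate (choice_det n X f)) else 0)"
  proof -
    have "n - count_from n f b = n - m \<longleftrightarrow> count_from n f b = m" for f using le[of f] m by linarith
    then show ?thesis unfolding eq coeff_sum by (intro sum.cong) auto
  qed
  also have "\<dots> = (\<Sum>f | f \<in> choices n {a,b} \<and> count_from n f b = m.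
      (-1) ^ m * (choice_det n X f * conjugate (choice_det n X f)))"
    by (subst sum.inter_filter[symmetric]) (auto simp: finite_choices)
  finally show ?thesis by (simp add: sum_distrib_left)
qed

text \<open>Compare leading exponents in \<open>coeff_char_poly_gram\<close>: one side is an elementary symmetric function of
  the squared singular values, the other a sum of terms \<open>x * conjugate x\<close>.  A minor of \<open>A\<close> of size \<open>m\<close>
  appears here, up to sign, as a determinant with \<open>m\<close> columns from \<open>A\<close> and the others from the
  identity matrix.\<close>

theorem is_Sing_minors:
  fixes A :: "puiseux mat"
  assumes A: "A \<in> carrier_mat n n" and det: "det A \<noteq> 0" and S: "is_Sing A ss"
    and ab: "a \<noteq> b" and X: "X a = 1\<^sub>m n" "X b = A" and m: "m \<le> n"
  shows "\<exists>f\<in>choices n {a,b}. count_from n f b = m \<and> choice_det n X f \<noteq> 0 \<and>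
      lead_exp (choice_det n X f) = (\<Sum>i<m. lead_exp (ss ! i))"
    and "\<And>f. f \<in> choices n {a,b} \<Longrightarrow> count_from n f b = m \<Longrightarrow>
      exp_le (choice_det n X f) (\<Sum>i<m. lead_exp (ss ! i))"
proof -
  let ?A' = "mat_adjoint A"
  let ?C = "{f. f \<in> choices n {a,b} \<and> count_from n f b = m}"
  have A': "?A' \<in> carrier_mat n n" by (rule mat_adjoint_carrier[OF A])
  have len: "length ss = n" using S A by (simp add: is_Sing_def)
  obtain B where B: "B \<in> carrier_mat n n" "A * B = 1\<^sub>m n" "B * A = 1\<^sub>m n"
    using det_non_zero_imp_unit[OF A det, of "()"] by (auto simp: Units_def ring_mat_def)
  have "?A' * A = B * (A * ?A') * A"
  proof -
    have "B * (A * ?A') = (B * A) * ?A'" by (rule assoc_mult_mat[OF B(1) A A', symmetric])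
    then show ?thesis using A A' B by simp
  qed
  then have "similar_mat (?A' * A) (A * ?A')"
    using A A' B by (intro similar_matI[of _ _ B A n]) auto
  then have cp: "char_poly (A * ?A') = (\<Prod>x\<leftarrow>map (\<lambda>s. s\<^sup>2) ss. [:-x, 1:])"
    using char_poly_is_Sing[OF A S] char_poly_similar by metis
  have pos: "ps_pos s" if "s \<in> set ss" for s using S that by (simp add: is_Sing_def)
  have l2: "lead_exp (s\<^sup>2) = 2 * lead_exp s" if "s \<in> set ss" for s
    using pos[OF that] lead_exp_power[of s 2] by (simp add: ps_pos_def)
  have "sorted_wrt (\<ge>) (map lead_exp (map (\<lambda>s. s\<^sup>2) ss))"
    using is_Sing_lead_exps_sorted[OF S] l2 unfolding sorted_wrt_map by (simp add: sorted_wrt_iff_nth_less)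
  then obtain E where E: "ps_pos E" "lead_exp E = (\<Sum>i<m. lead_exp (map (\<lambda>s. s\<^sup>2) ss ! i))"
      "coeff (char_poly (A * ?A')) (n - m) = (-1) ^ m * E"
    using coeff_prod_linear_factors[of "map (\<lambda>s. s\<^sup>2) ss" m] pos ps_pos_mult m
    unfolding cp by (auto simp: len power2_eq_square)
  have "lead_exp E = (\<Sum>i<m. 2 * lead_exp (ss ! i))"
    unfolding E(2) using m by (intro sum.cong) (auto simp: len l2)
  then have lE: "lead_exp E = 2 * (\<Sum>i<m. lead_exp (ss ! i))" by (simp add: sum_distrib_left)
  have "(-1) ^ m * (of_nat (fact n) * E) = (-1) ^ m * (\<Sum>f\<in>?C. choice_det n X f * conjugate (choice_det n X f))"
    using coeff_char_poly_gram[OF A ab X m] unfolding E(3) by (simp add: mult_ac)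
  then have eq: "of_nat (fact n) * E = (\<Sum>f\<in>?C. choice_det n X f * conjugate (choice_det n X f))"
    by simp
  have E0: "E \<noteq> 0" using E(1) by (simp add: ps_pos_def)
  have fin: "finite ?C" by (rule finite_subset[OF _ finite_choices[of "{a,b}" n]]) auto
  let ?D = "{f \<in> ?C. choice_det n X f \<noteq> 0}"
  have "?D \<noteq> {}"
  proof
    assume "?D = {}"
    then have "(\<Sum>f\<in>?C. choice_det n X f * conjugate (choice_det n X f)) = 0" by (intro sum.neutral) auto
    then show False using eq E0 by simp
  qed
  moreover have finD: "finite ?D" by (rule finite_subset[OF _ fin]) auto
  ultimately have "Max ((\<lambda>f. lead_exp (choice_det n X f)) ` ?D) \<in> (\<lambda>f. lead_exp (choice_det n X f)) ` ?D"
    by (intro Max_in finite_imageI) auto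
  then obtain g where g: "g \<in> ?D" "lead_exp (choice_det n X g) = Max ((\<lambda>f. lead_exp (choice_det n X f)) ` ?D)"
    by auto
  have le: "exp_le (choice_det n X f) (lead_exp (choice_det n X g))" if "f \<in> ?C" for f
  proof (cases "choice_det n X f = 0")
    case False
    have "lead_exp (choice_det n X f) \<le> lead_exp (choice_det n X g)"
      unfolding g(2) using finD that False by (intro Max_ge finite_imageI) auto
    then show ?thesis using False by (simp add: exp_le_iff)
  qed simp
  have "lead_exp (of_nat (fact n) * E) = 2 * lead_exp (choice_det n X g)"
    unfolding eq using g(1) by (intro sum_norm_sq(2)[OF fin]) (use le in auto)
  then have "lead_exp (choice_det n X g) = (\<Sum>i<m. lead_exp (ss ! i))"
    using E0 lE lead_exp_of_nat[of "fact n"] by (simp add: lead_exp_mult del: of_nat_fact)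
  then show "\<exists>f\<in>choices n {a,b}. count_from n f b = m \<and> choice_det n X f \<noteq> 0 \<and>
      lead_exp (choice_det n X f) = (\<Sum>i<m. lead_exp (ss ! i))"
    and "\<And>f. f \<in> choices n {a,b} \<Longrightarrow> count_from n f b = m \<Longrightarrow>
      exp_le (choice_det n X f) (\<Sum>i<m. lead_exp (ss ! i))"
    using g(1) le by auto
qed

section \<open>The hive of three lattices\<close>

subsection \<open>The exchange property\<close>

lemma det_replace_col:
  fixes A :: "'a :: comm_ring_1 mat"
  assumes A: "A \<in> carrier_mat n n" and k: "k < n"
  shows "det (replace_col A b k) = (\<Sum>r<n. b $ r * cofactor A r k)"
proof -
  have R: "replace_col A b k \<in> carrier_mat n n" using A by (auto simp: replace_col_def)
  have "mat_delete (replace_col A b k) r k = mat_delete A r k" for r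
    using A by (intro eq_matI) (auto simp: mat_delete_def replace_col_def)
  then show ?thesis
    unfolding laplace_expansion_column[OF R k] cofactor_def
    using A k by (intro sum.cong) (auto simp: replace_col_def)
qed

text \<open>Cramer's rule expresses \<open>det Y\<close> times the column \<open>u\<close> of \<open>X\<close> through the columns of
  \<open>Y\<close>; insert this expression into \<open>X\<close>.\<close>

lemma det_exchange:
  fixes X Y :: "'a :: comm_ring_1 mat"
  assumes X: "X \<in> carrier_mat n n" and Y: "Y \<in> carrier_mat n n" and u: "u < n"
  shows "det X * det Y =
    (\<Sum>i<n. det (replace_col X (col Y i) u) * det (replace_col Y (col X u) i))"
proof -
  define y where "y = (\<lambda>i. det (replace_col Y (col X u) i))"
  have y: "y i = (\<Sum>r<n. X $$ (r, u) * cofactor Y r i)" if "i < n" for i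
    unfolding y_def det_replace_col[OF Y that] using X u by (intro sum.cong) auto
  have Yy: "(\<Sum>i<n. Y $$ (r, i) * y i) = det Y * X $$ (r, u)" if r: "r < n" for r
  proof -
    have "(\<Sum>i<n. Y $$ (r, i) * y i) = (\<Sum>s<n. X $$ (s, u) * (\<Sum>i<n. Y $$ (r, i) * cofactor Y s i))"
      by (simp add: y sum_distrib_left mult_ac) (rule sum.swap)
    also have "\<dots> = (\<Sum>s<n. X $$ (s, u) * (if s = r then det Y else 0))"
    proof (intro sum.cong refl arg_cong2[of _ _ _ _ "(*)"])
      fix s assume s: "s \<in> {..<n}"
      have "(\<Sum>i<n. Y $$ (r, i) * cofactor Y s i) = (Y * adj_mat Y) $$ (r, s)"
        using Y r s by (simp add: adj_mat_def scalar_prod_def atLeast0LessThan)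
      then show "(\<Sum>i<n. Y $$ (r, i) * cofactor Y s i) = (if s = r then det Y else 0)"
        unfolding adj_mat(2)[OF Y] using r s by simp
    qed
    also have "\<dots> = det Y * X $$ (r, u)" using r by (simp add: if_distrib mult.commute cong: if_cong)
    finally show ?thesis .
  qed
  have "det X * det Y = (\<Sum>r<n. det Y * X $$ (r, u) * cofactor X r u)"
    unfolding laplace_expansion_column[OF X u] by (simp add: sum_distrib_left mult_ac)
  also have "\<dots> = (\<Sum>r<n. (\<Sum>i<n. Y $$ (r, i) * y i) * cofactor X r u)"
    by (intro sum.cong) (simp_all add: Yy)
  also have "\<dots> = (\<Sum>i<n. \<Sum>r<n. Y $$ (r, i) * y i * cofactor X r u)"
    unfolding sum_distrib_right by (rule sum.swap)
  also have "\<dots> = (\<Sum>i<n. det (replace_col X (col Y i) u) * y i)"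
    using Y by (intro sum.cong) (auto simp: det_replace_col[OF X u] sum_distrib_left mult_ac)
  finally show ?thesis unfolding y_def .
qed

lemma choice_det_exchange:
  assumes "u < n"
  shows "choice_det n X f * choice_det n X g =
    (\<Sum>i<n. choice_det n X (f(u := g i)) * choice_det n X (g(i := f u)))"
proof -
  let ?M = "\<lambda>f. mat n n (\<lambda>(i,p). X (fst (f p)) $$ (i, snd (f p)))"
  have "replace_col (?M f) (col (?M g) i) u = ?M (f(u := g i))" if "i < n" for i
    using assms that by (intro eq_matI) (auto simp: replace_col_def)
  moreover have "replace_col (?M g) (col (?M f) u) i = ?M (g(i := f u))" if "i < n" for i
    using assms that by (intro eq_matI) (auto simp: replace_col_def)
  ultimately show ?thesis
    using det_exchange[of "?M f" n "?M g" u] assms by (simp add: choice_det_def)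
qed

text \<open>The exchange axiom of valuated matroids: if all terms of the exchange identity had smaller
  leading exponents than the left-hand side, the leading term there would be lost.\<close>

lemma valuated_exchange:
  fixes X :: "nat \<Rightarrow> puiseux mat"
  assumes u: "u < n" and f: "choice_det n X f \<noteq> 0" and g: "choice_det n X g \<noteq> 0"
  obtains i where "i < n" "choice_det n X (f(u := g i)) \<noteq> 0" "choice_det n X (g(i := f u)) \<noteq> 0"
    "lead_exp (choice_det n X f) + lead_exp (choice_det n X g)
      \<le> lead_exp (choice_det n X (f(u := g i))) + lead_exp (choice_det n X (g(i := f u)))"
proof (rule ccontr)
  note found = that
  assume "\<not> thesis"
  then have none: "\<not> (choice_det n X (f(u := g i)) \<noteq> 0 \<and> choice_det n X (g(i := f u)) \<noteq> 0 \<and>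
    lead_exp (choice_det n X f) + lead_exp (choice_det n X g)
      \<le> lead_exp (choice_det n X (f(u := g i))) + lead_exp (choice_det n X (g(i := f u))))" if "i < n" for i
    using that found by metis
  let ?q = "lead_exp (choice_det n X f) + lead_exp (choice_det n X g)"
  let ?t = "\<lambda>i. choice_det n X (f(u := g i)) * choice_det n X (g(i := f u))"
  have "coeff_of (?t i) ?q = 0" if i: "i < n" for i
  proof (cases "?t i = 0")
    case False
    then have nz: "choice_det n X (f(u := g i)) \<noteq> 0" "choice_det n X (g(i := f u)) \<noteq> 0" by auto
    then have "lead_exp (?t i) < ?q" using none[OF i] by (simp add: lead_exp_mult)
    then show ?thesis using exp_le_lead_exp[of "?t i"] unfolding exp_le_def by blast
  qed (auto simp: coeff_of_0)
  then have "coeff_of (\<Sum>i<n. ?t i) ?q = 0" unfolding coeff_of_sum by (intro sum.neutral) simp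
  then have "coeff_of (choice_det n X f * choice_det n X g) ?q = 0"
    by (simp only: choice_det_exchange[OF u, of X f g, symmetric])
  then show False
    using lead_exp_mult(2)[OF f g] lead_coeff_nonzero[OF f] lead_coeff_nonzero[OF g] by simp
qed

lemma choice_det_eq_0:
  assumes "p < n" "q < n" "p \<noteq> q" "f p = f q"
  shows "choice_det n X f = 0"
  unfolding choice_det_def
  by (rule det_identical_columns[OF _ assms(3,1,2)]) (use assms in \<open>auto intro!: eq_vecI\<close>)

lemma choice_det_inj:
  assumes "choice_det n X f \<noteq> 0"
  shows "inj_on f {0..<n}"
  using choice_det_eq_0[of _ n _ f X] assms by (intro inj_onI) force

lemma choice_det_mult:
  assumes Z: "Z \<in> carrier_mat n n" and X: "\<And>a. a \<in> T \<Longrightarrow> X a \<in> carrier_mat n n" and f: "f \<in> choices n T"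
  shows "choice_det n (\<lambda>a. Z * X a) f = det Z * choice_det n X f"
proof -
  have fT: "fst (f p) \<in> T" "snd (f p) < n" if "p < n" for p
    using f that by (cases "f p"; force simp: choices_def PiE_iff)+
  let ?M = "mat n n (\<lambda>(i,p). X (fst (f p)) $$ (i, snd (f p)))"
  have "mat n n (\<lambda>(i,p). (Z * X (fst (f p))) $$ (i, snd (f p))) = Z * ?M"
  proof (rule eq_matI)
    fix i p assume "i < dim_row (Z * ?M)" "p < dim_col (Z * ?M)"
    then have ip: "i < n" "p < n" using Z by auto
    have Xp: "X (fst (f p)) \<in> carrier_mat n n" by (rule X[OF fT(1)[OF ip(2)]])
    then have "col ?M p = col (X (fst (f p))) (snd (f p))"
      using ip fT(2)[OF ip(2)] by (intro eq_vecI) simp_all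
    then show "mat n n (\<lambda>(i,p). (Z * X (fst (f p))) $$ (i, snd (f p))) $$ (i, p) = (Z * ?M) $$ (i, p)"
      using Z Xp ip fT(2)[OF ip(2)] by simp
  qed (use Z in auto)
  then show ?thesis unfolding choice_det_def using Z by (simp add: det_mult)
qed

lemma count_from_upd:
  assumes "u < n"
  shows "count_from n (f(u := v)) a + (if fst (f u) = a then 1 else 0)
    = count_from n f a + (if fst v = a then 1 else 0)"
proof -
  have c: "count_from n f a = (\<Sum>p\<in>{0..<n}. if fst (f p) = a then 1 else 0)" for f
    by (simp add: count_from_def sum.If_cases Int_def)
  have "(\<Sum>p\<in>{0..<n} - {u}. if fst ((f(u := v)) p) = a then 1 else 0)
      = (\<Sum>p\<in>{0..<n} - {u}. if fst (f p) = a then 1 else (0 :: nat))"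
    by (intro sum.cong) auto
  then show ?thesis using assms unfolding c
    by (simp add: sum.remove[of "{0..<n}" u])
qed

lemma choices_upd: "f \<in> choices n T \<Longrightarrow> u < n \<Longrightarrow> v \<in> T \<times> {0..<n} \<Longrightarrow> f(u := v) \<in> choices n T"
  by (auto simp: choices_def PiE_iff extensional_def)

subsection \<open>Maximal determinants\<close>

text \<open>The bases are those of the valuated matroid on the columns of three matrices, sorted by the number
  of columns from each of them.\<close>

definition bases :: "nat \<Rightarrow> (nat \<Rightarrow> puiseux mat) \<Rightarrow> (nat \<Rightarrow> nat) \<Rightarrow> (nat \<Rightarrow> nat \<times> nat) set" where
  "bases n X c = {f \<in> choices n {0,1,2}. (\<forall>a\<in>{0,1,2}. count_from n f a = c a) \<and> choice_det n X f \<noteq> 0}"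

definition max_exp :: "nat \<Rightarrow> (nat \<Rightarrow> puiseux mat) \<Rightarrow> (nat \<Rightarrow> nat) \<Rightarrow> rat" where
  "max_exp n X c = Max ((\<lambda>f. lead_exp (choice_det n X f)) ` bases n X c)"

lemma finite_bases: "finite (bases n X c)"
  by (rule finite_subset[OF _ finite_choices[of "{0,1,2}" n]]) (auto simp: bases_def)

lemma max_exp_ge: "f \<in> bases n X c \<Longrightarrow> lead_exp (choice_det n X f) \<le> max_exp n X c"
  unfolding max_exp_def using finite_bases by (intro Max_ge) auto

lemma max_exp_attained:
  assumes "bases n X c \<noteq> {}"
  obtains f where "f \<in> bases n X c" "lead_exp (choice_det n X f) = max_exp n X c"
proof -
  have "max_exp n X c \<in> (\<lambda>f. lead_exp (choice_det n X f)) ` bases n X c"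
    unfolding max_exp_def using assms finite_bases by (intro Max_in) auto
  then show ?thesis using that by auto
qed

lemma max_exp_eqI:
  assumes "f \<in> bases n X c" "lead_exp (choice_det n X f) = q"
    "\<And>g. g \<in> bases n X c \<Longrightarrow> exp_le (choice_det n X g) q"
  shows "max_exp n X c = q"
proof (rule antisym)
  show "q \<le> max_exp n X c" using max_exp_ge assms by blast
  obtain g where g: "g \<in> bases n X c" "lead_exp (choice_det n X g) = max_exp n X c"
    using max_exp_attained assms(1) by blast
  then have "choice_det n X g \<noteq> 0" by (simp add: bases_def)
  then show "max_exp n X c \<le> q" using assms(3)[OF g(1)] g(2) by (simp add: exp_le_iff)
qed

text \<open>Start from bases \<open>f\<close> and \<open>g\<close> of maximal leading exponents, with \<open>f\<close> as close to \<open>g\<close> as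
  possible, and exchange a column of \<open>f\<close> of the type \<open>s\<close> that \<open>f\<close> has in excess.  If the column
  entering \<open>f\<close> also had type \<open>s\<close>, then the new \<open>f\<close> would again be maximal and closer to \<open>g\<close>.\<close>

theorem max_exp_rhombus:
  assumes stu: "{s, t1, t2} = {0, 1, 2 :: nat}" "s \<noteq> t1" "s \<noteq> t2" "t1 \<noteq> t2" and c: "c s \<ge> 2"
  defines "c' \<equiv> c(s := c s - 2, t1 := c t1 + 1, t2 := c t2 + 1)"
    and "d1 \<equiv> c(s := c s - 1, t1 := c t1 + 1)" and "d2 \<equiv> c(s := c s - 1, t2 := c t2 + 1)"
  assumes ne: "bases n X c \<noteq> {}" "bases n X c' \<noteq> {}"
  shows "max_exp n X c + max_exp n X c' \<le> max_exp n X d1 + max_exp n X d2"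
proof -
  obtain g where g: "g \<in> bases n X c'" "lead_exp (choice_det n X g) = max_exp n X c'"
    using max_exp_attained[OF ne(2)] .
  let ?dist = "\<lambda>f. card {p \<in> {0..<n}. f p \<notin> g ` {0..<n}}"
  let ?opt = "\<lambda>f. f \<in> bases n X c \<and> lead_exp (choice_det n X f) = max_exp n X c"
  obtain f0 where "?opt f0" using max_exp_attained[OF ne(1)] by blast
  then obtain f where f: "f \<in> bases n X c" "lead_exp (choice_det n X f) = max_exp n X c"
    and least: "\<And>f'. ?opt f' \<Longrightarrow> ?dist f \<le> ?dist f'"
    using ex_has_least_nat[of ?opt f0 ?dist] by blast
  have fg: "choice_det n X f \<noteq> 0" "choice_det n X g \<noteq> 0" "f \<in> choices n {0,1,2}" "g \<in> choices n {0,1,2}"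
    using f g by (auto simp: bases_def)
  have cf: "count_from n f a = c a" and cg: "count_from n g a = c' a" if "a \<in> {s, t1, t2}" for a
    using f(1) g(1) that unfolding stu(1) by (auto simp: bases_def)
  have "\<exists>u<n. fst (f u) = s \<and> f u \<notin> g ` {0..<n}"
  proof (rule ccontr)
    assume "\<not> ?thesis"
    then have "f ` {p \<in> {0..<n}. fst (f p) = s} \<subseteq> g ` {p \<in> {0..<n}. fst (g p) = s}" by force
    then have "card (f ` {p \<in> {0..<n}. fst (f p) = s}) \<le> card {p \<in> {0..<n}. fst (g p) = s}"
      by (intro surj_card_le) auto
    then have "count_from n f s \<le> count_from n g s"
      by (subst (asm) card_image) (auto simp: count_from_def intro: inj_on_subset[OF choice_det_inj[OF fg(1)]])
    moreover have "count_from n f s = c s" "count_from n g s = c' s" using cf cg by blast+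
    ultimately show False using c stu(2,3) by (simp add: c'_def)
  qed
  then obtain u where u: "u < n" "fst (f u) = s" "f u \<notin> g ` {0..<n}" by blast
  obtain i where i: "i < n" "choice_det n X (f(u := g i)) \<noteq> 0" "choice_det n X (g(i := f u)) \<noteq> 0"
    "lead_exp (choice_det n X f) + lead_exp (choice_det n X g)
      \<le> lead_exp (choice_det n X (f(u := g i))) + lead_exp (choice_det n X (g(i := f u)))"
    using valuated_exchange[OF u(1) fg(1,2)] .
  have range: "f u \<in> {0,1,2} \<times> {0..<n}" "g i \<in> {0,1,2} \<times> {0..<n}"
    using fg(3,4) u(1) i(1) by (auto simp: choices_def PiE_iff)
  have ch: "f(u := g i) \<in> choices n {0,1,2}" "g(i := f u) \<in> choices n {0,1,2}"
    by (rule choices_upd[OF fg(3) u(1) range(2)] choices_upd[OF fg(4) i(1) range(1)])+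
  have cnt: "count_from n (f(u := g i)) a + (if s = a then 1 else 0) = c a + (if fst (g i) = a then 1 else 0)"
    "count_from n (g(i := f u)) a + (if fst (g i) = a then 1 else 0) = c' a + (if s = a then 1 else 0)"
    if "a \<in> {s, t1, t2}" for a
    using count_from_upd[OF u(1), of f "g i" a] count_from_upd[OF i(1), of g "f u" a] cf[OF that] cg[OF that] u(2)
    by auto
  have basesI: "f' \<in> bases n X d" if "f' \<in> choices n {0,1,2}" "choice_det n X f' \<noteq> 0"
    "count_from n f' s = d s" "count_from n f' t1 = d t1" "count_from n f' t2 = d t2" for f' d
    using that unfolding bases_def stu(1)[symmetric] by auto
  have "fst (g i) \<in> {s, t1, t2}" using range(2) unfolding stu(1) by (auto simp: mem_Times_iff)
  then consider "fst (g i) = s" | "fst (g i) = t1" | "fst (g i) = t2" by blast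
  then show ?thesis
  proof cases
    case 1
    have f': "f(u := g i) \<in> bases n X c" and g': "g(i := f u) \<in> bases n X c'"
      by (rule basesI; use ch i cnt[of s] cnt[of t1] cnt[of t2] 1 stu(2-4) in simp)+
    have "lead_exp (choice_det n X (f(u := g i))) = max_exp n X c"
      using max_exp_ge[OF f'] max_exp_ge[OF g'] i(4) f(2) g(2) by linarith
    then have "?dist f \<le> ?dist (f(u := g i))" using least f' by blast
    moreover have "{p \<in> {0..<n}. (f(u := g i)) p \<notin> g ` {0..<n}} \<subset> {p \<in> {0..<n}. f p \<notin> g ` {0..<n}}"
      using u i(1) by (auto split: if_splits)
    then have "?dist (f(u := g i)) < ?dist f" by (intro psubset_card_mono) auto
    ultimately show ?thesis by simp
  next
    case 2
    have f': "f(u := g i) \<in> bases n X d1" and g': "g(i := f u) \<in> bases n X d2"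
      by (rule basesI; use ch i cnt[of s] cnt[of t1] cnt[of t2] 2 stu(2-4) c in \<open>simp add: c'_def d1_def d2_def\<close>)+
    show ?thesis using max_exp_ge[OF f'] max_exp_ge[OF g'] i(4) f(2) g(2) by linarith
  next
    case 3
    have f': "f(u := g i) \<in> bases n X d2" and g': "g(i := f u) \<in> bases n X d1"
      by (rule basesI; use ch i cnt[of s] cnt[of t1] cnt[of t2] 3 stu(2-4) c in \<open>simp add: c'_def d1_def d2_def\<close>)+
    show ?thesis using max_exp_ge[OF f'] max_exp_ge[OF g'] i(4) f(2) g(2) by linarith
  qed
qed

text \<open>The value \<open>0\<close> beyond the three matrices makes the updates at \<open>0\<close>, \<open>1\<close>, \<open>2\<close> in \<open>max_exp_rhombus\<close> yield
  functions of the same form.\<close>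

definition counts :: "nat \<Rightarrow> nat \<Rightarrow> nat \<Rightarrow> nat \<Rightarrow> nat" where
  "counts i j k = (\<lambda>a. if a = 0 then i else if a = 1 then j else if a = 2 then k else 0)"

lemma counts_simps [simp]:
  "counts i j k 0 = i" "counts i j k 1 = j" "counts i j k (Suc 0) = j" "counts i j k 2 = k"
  by (simp_all add: counts_def)

text \<open>Exchange the columns of the first matrix, one at a time, for columns of the other two, which are
  bases themselves.\<close>

lemma bases_nonempty:
  assumes X: "\<And>a. a \<in> {0,1,2} \<Longrightarrow> X a \<in> carrier_mat n n" "\<And>a. a \<in> {0,1,2} \<Longrightarrow> det (X a) \<noteq> 0"
    and n: "i + j + k = n"
  shows "bases n X (counts i j k) \<noteq> {}"
proof -
  define full where "full = (\<lambda>a. \<lambda>p\<in>{0..<n}. (a, p) :: nat \<times> nat)"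
  have full: "choice_det n X (full a) = det (X a)" "full a \<in> choices n {0,1,2}" if "a \<in> {0,1,2}" for a
  proof -
    have "mat n n (\<lambda>(i,p). X (fst (full a p)) $$ (i, snd (full a p))) = X a"
      using X(1)[OF that] by (intro eq_matI) (auto simp: full_def)
    then show "choice_det n X (full a) = det (X a)" by (simp add: choice_det_def)
    show "full a \<in> choices n {0,1,2}" using that by (auto simp: full_def choices_def)
  qed
  have step: "bases n X (c(s := c s - 1, t := c t + 1)) \<noteq> {}"
    if ne: "bases n X c \<noteq> {}" and c: "c s > 0" and st: "s \<in> {0,1,2}" "t \<in> {0,1,2}" "s \<noteq> t" for c s t
  proof -
    obtain f where f: "f \<in> bases n X c" using ne by blast
    then have f': "choice_det n X f \<noteq> 0" "f \<in> choices n {0,1,2}" "\<And>a. a \<in> {0,1,2} \<Longrightarrow> count_from n f a = c a"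
      by (auto simp: bases_def)
    have "card {p \<in> {0..<n}. fst (f p) = s} > 0" using f'(3)[OF st(1)] c by (simp add: count_from_def)
    then obtain u where u: "u < n" "fst (f u) = s" by (auto simp: card_gt_0_iff)
    have "choice_det n X (full t) \<noteq> 0" using full(1)[OF st(2)] X(2)[OF st(2)] by simp
    then obtain l where l: "l < n" "choice_det n X (f(u := full t l)) \<noteq> 0"
      using valuated_exchange[OF u(1) f'(1)] by blast
    have "f(u := full t l) \<in> bases n X (c(s := c s - 1, t := c t + 1))"
    proof -
      have "f(u := full t l) \<in> choices n {0,1,2}"
        using st l by (intro choices_upd f' u) (auto simp: full_def)
      moreover have "count_from n (f(u := full t l)) a = (c(s := c s - 1, t := c t + 1)) a" if "a \<in> {0,1,2}" for a
        using count_from_upd[OF u(1), of f "full t l" a] f'(3)[OF that] u(2) l(1) st(3) c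
        by (auto simp: full_def split: if_splits)
      ultimately show ?thesis using l(2) by (simp add: bases_def)
    qed
    then show ?thesis by blast
  qed
  have "full 0 \<in> bases n X (counts n 0 0)"
    using full[of 0] X(2)[of 0] by (auto simp: bases_def count_from_def full_def counts_def)
  then have 0: "bases n X (counts n 0 0) \<noteq> {}" by blast
  have 1: "bases n X (counts (n - j) j 0) \<noteq> {}" if "j \<le> n" for j
    using that
  proof (induction j)
    case (Suc j)
    have "(counts (n - j) j 0)(0 := counts (n - j) j 0 0 - 1, 1 := counts (n - j) j 0 1 + 1) = counts (n - Suc j) (Suc j) 0"
      by (auto simp: counts_def)
    then show ?case using step[of "counts (n - j) j 0" 0 1] Suc by auto
  qed (use 0 in simp)
  have "bases n X (counts (n - j - k) j k) \<noteq> {}" if "j + k \<le> n" for k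
    using that
  proof (induction k)
    case (Suc k)
    have "(counts (n - j - k) j k)(0 := counts (n - j - k) j k 0 - 1, 2 := counts (n - j - k) j k 2 + 1)
        = counts (n - j - Suc k) j (Suc k)"
      by (auto simp: counts_def)
    then show ?case using step[of "counts (n - j - k) j k" 0 2] Suc by auto
  qed (use 1 in simp)
  from this[of k] show ?thesis using n by auto
qed

lemma hive_max_exp:
  assumes X: "\<And>a. a \<in> {0,1,2} \<Longrightarrow> X a \<in> carrier_mat n n" "\<And>a. a \<in> {0,1,2} \<Longrightarrow> det (X a) \<noteq> 0"
  shows "hive n (\<lambda>i j k. of_rat (max_exp n X (counts i j k)))"
proof -
  have ne: "bases n X (counts i j k) \<noteq> {}" if "i + j + k = n" for i j k
    by (rule bases_nonempty) (use X that in auto)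
  have le: "real_of_rat (max_exp n X c) + of_rat (max_exp n X c') \<le> of_rat (max_exp n X d) + of_rat (max_exp n X d')"
    if "max_exp n X c + max_exp n X c' \<le> max_exp n X d + max_exp n X d'" for c c' d d'
    using that by (simp flip: of_rat_add add: of_rat_less_eq)
  show ?thesis
    unfolding hive_def
  proof (intro conjI allI impI)
    fix i j k assume a: "i + j + k = n \<and> 2 \<le> k"
    have e: "(counts i j k)(2 := counts i j k 2 - 2, 0 := counts i j k 0 + 1, 1 := counts i j k 1 + 1) = counts (i + 1) (j + 1) (k - 2)"
      "(counts i j k)(2 := counts i j k 2 - 1, 0 := counts i j k 0 + 1) = counts (i + 1) j (k - 1)"
      "(counts i j k)(2 := counts i j k 2 - 1, 1 := counts i j k 1 + 1) = counts i (j + 1) (k - 1)"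
      by (auto simp: counts_def)
    show "of_rat (max_exp n X (counts i j k)) + of_rat (max_exp n X (counts (i + 1) (j + 1) (k - 2)))
      \<le> real_of_rat (max_exp n X (counts (i + 1) j (k - 1))) + of_rat (max_exp n X (counts i (j + 1) (k - 1)))"
      using max_exp_rhombus[of 2 0 1 "counts i j k" n X] a ne[of i j k] ne[of "i + 1" "j + 1" "k - 2"]
      unfolding e by (intro le) (auto simp: insert_commute)
  next
    fix i j k assume a: "i + j + k = n \<and> 2 \<le> j"
    have e: "(counts i j k)(1 := counts i j k 1 - 2, 0 := counts i j k 0 + 1, 2 := counts i j k 2 + 1) = counts (i + 1) (j - 2) (k + 1)"
      "(counts i j k)(1 := counts i j k 1 - 1, 0 := counts i j k 0 + 1) = counts (i + 1) (j - 1) k"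
      "(counts i j k)(1 := counts i j k 1 - 1, 2 := counts i j k 2 + 1) = counts i (j - 1) (k + 1)"
      by (auto simp: counts_def)
    show "of_rat (max_exp n X (counts i j k)) + of_rat (max_exp n X (counts (i + 1) (j - 2) (k + 1)))
      \<le> real_of_rat (max_exp n X (counts (i + 1) (j - 1) k)) + of_rat (max_exp n X (counts i (j - 1) (k + 1)))"
      using max_exp_rhombus[of 1 0 2 "counts i j k" n X] a ne[of i j k] ne[of "i + 1" "j - 2" "k + 1"]
      unfolding e by (intro le) (auto simp: insert_commute)
  next
    fix i j k assume a: "i + j + k = n \<and> 2 \<le> i"
    have e: "(counts i j k)(0 := counts i j k 0 - 2, 1 := counts i j k 1 + 1, 2 := counts i j k 2 + 1) = counts (i - 2) (j + 1) (k + 1)"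
      "(counts i j k)(0 := counts i j k 0 - 1, 1 := counts i j k 1 + 1) = counts (i - 1) (j + 1) k"
      "(counts i j k)(0 := counts i j k 0 - 1, 2 := counts i j k 2 + 1) = counts (i - 1) j (k + 1)"
      by (auto simp: counts_def)
    show "of_rat (max_exp n X (counts i j k)) + of_rat (max_exp n X (counts (i - 2) (j + 1) (k + 1)))
      \<le> real_of_rat (max_exp n X (counts (i - 1) (j + 1) k)) + of_rat (max_exp n X (counts (i - 1) j (k + 1)))"
      using max_exp_rhombus[of 0 1 2 "counts i j k" n X] a ne[of i j k] ne[of "i - 2" "j + 1" "k + 1"]
      unfolding e by (intro le) (auto simp: insert_commute)
  qed
qed

text \<open>The columns of \<open>X a\<close> and \<open>X a * A\<close> are those of \<open>1\<close> and \<open>A\<close> multiplied by \<open>X a\<close>, so that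
  \<open>is_Sing_minors\<close> applies to determinants of such columns.\<close>

lemma max_exp_boundary:
  assumes X: "X a \<in> carrier_mat n n" "det (X a) \<noteq> 0" "X b = X a * A"
    and A: "A \<in> carrier_mat n n" "det A \<noteq> 0" "is_Sing A ss"
    and abd: "{a, b, d} = {0, 1, 2}" "a \<noteq> b" "a \<noteq> d" "b \<noteq> d" and m: "m \<le> n"
    and c: "c a = n - m" "c b = m" "c d = 0"
  shows "max_exp n X c = lead_exp (det (X a)) + (\<Sum>i<m. lead_exp (ss ! i))"
proof -
  define Y where "Y = (\<lambda>x. if x = a then 1\<^sub>m n else A)"
  have Y: "Y a = 1\<^sub>m n" "Y b = A" using abd by (simp_all add: Y_def)
  have det: "choice_det n X f = det (X a) * choice_det n Y f" if f: "f \<in> choices n {a,b}" for f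
  proof -
    have fT: "fst (f p) \<in> {a,b}" "snd (f p) < n" if "p < n" for p
      using f that by (cases "f p"; force simp: choices_def PiE_iff)+
    have XY: "X x = X a * Y x" if "x \<in> {a,b}" for x using that X Y by auto
    have "choice_det n X f = choice_det n (\<lambda>x. X a * Y x) f"
      unfolding choice_det_def using XY[OF fT(1)] by (intro arg_cong[of _ _ det] eq_matI) auto
    also have "\<dots> = det (X a) * choice_det n Y f"
      by (rule choice_det_mult[OF X(1) _ f]) (use A in \<open>auto simp: Y_def\<close>)
    finally show ?thesis .
  qed
  have total: "count_from n f a + count_from n f b = n" if "f \<in> choices n {a,b}" for f
  proof -
    have fT: "fst (f p) \<in> {a,b}" if "p < n" for p
      using \<open>f \<in> choices n {a,b}\<close> that by (cases "f p"; force simp: choices_def PiE_iff)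
    have "{0..<n} = {p \<in> {0..<n}. fst (f p) = a} \<union> {p \<in> {0..<n}. fst (f p) = b}" using fT by fastforce
    from arg_cong[OF this, of card]
    have "n = card ({p \<in> {0..<n}. fst (f p) = a} \<union> {p \<in> {0..<n}. fst (f p) = b})" by (simp only: card_atLeastLessThan diff_zero)
    also have "\<dots> = count_from n f a + count_from n f b"
      unfolding count_from_def using abd by (intro card_Un_disjoint) auto
    finally show ?thesis by simp
  qed
  have none: "count_from n f d = 0" if "f \<in> choices n {a,b}" for f
  proof -
    have "fst (f p) \<noteq> d" if "p < n" for p
      using \<open>f \<in> choices n {a,b}\<close> that abd by (cases "f p"; force simp: choices_def PiE_iff)
    then show ?thesis by (auto simp: count_from_def)
  qed
  have bases: "f \<in> bases n X c \<longleftrightarrow> f \<in> choices n {a,b} \<and> count_from n f b = m \<and> choice_det n X f \<noteq> 0" for f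
  proof
    assume f: "f \<in> bases n X c"
    then have f': "f \<in> choices n {a,b,d}" "count_from n f a = c a" "count_from n f b = c b" "count_from n f d = c d"
      "choice_det n X f \<noteq> 0" unfolding bases_def abd(1)[symmetric] by auto
    have "fst (f p) \<noteq> d" if "p < n" for p
      using f'(4) c(3) that by (auto simp: count_from_def)
    then have "f p \<in> {a,b} \<times> {0..<n}" if "p < n" for p
      using f'(1) that by (cases "f p"; force simp: choices_def PiE_iff)
    then have "f \<in> choices n {a,b}" using f'(1) by (auto simp: choices_def PiE_iff)
    then show "f \<in> choices n {a,b} \<and> count_from n f b = m \<and> choice_det n X f \<noteq> 0" using f' c by simp
  next
    assume f: "f \<in> choices n {a,b} \<and> count_from n f b = m \<and> choice_det n X f \<noteq> 0"
    have "choices n {a,b} \<subseteq> choices n {a,b,d}" unfolding choices_def by (intro PiE_mono) auto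
    then show "f \<in> bases n X c"
      unfolding bases_def abd(1)[symmetric] using f total[of f] none[of f] c by auto
  qed
  obtain f where f: "f \<in> choices n {a,b}" "count_from n f b = m" "choice_det n Y f \<noteq> 0"
    "lead_exp (choice_det n Y f) = (\<Sum>i<m. lead_exp (ss ! i))"
    using is_Sing_minors(1)[OF A abd(2) Y m] by blast
  show ?thesis
  proof (rule max_exp_eqI[of f])
    show "f \<in> bases n X c" using f X(2) by (simp add: bases det)
    show "lead_exp (choice_det n X f) = lead_exp (det (X a)) + (\<Sum>i<m. lead_exp (ss ! i))"
      using f X(2) by (simp add: det lead_exp_mult)
    fix g assume "g \<in> bases n X c"
    then show "exp_le (choice_det n X g) (lead_exp (det (X a)) + (\<Sum>i<m. lead_exp (ss ! i)))"
      using is_Sing_minors(2)[OF A abd(2) Y m, of g] by (auto simp: bases det intro: exp_le_mult exp_le_lead_exp)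
  qed
qed

text \<open>The three matrices are \<open>1\<close>, \<open>A\<close> and \<open>A B\<close>; the cycle closes because \<open>(A B) C = 1\<close>.\<close>

theorem hive_of_singular_values:
  assumes A: "A \<in> carrier_mat n n" and B: "B \<in> carrier_mat n n" and C: "C \<in> carrier_mat n n"
    and ABC: "A * B * C = 1\<^sub>m n"
    and S: "is_Sing A sA" "is_Sing B sB" "is_Sing C sC"
  shows "\<exists>h. hive n h \<and> hive_boundary n h =
    (map (of_rat \<circ> lead_exp) sA, map (of_rat \<circ> lead_exp) sB, map (of_rat \<circ> lead_exp) sC)"
proof -
  have "det A * det B * det C = 1"
    using arg_cong[OF ABC, of det] A B C by (simp add: det_mult[of _ n] mult.assoc)
  then have det: "det A \<noteq> 0" "det B \<noteq> 0" "det C \<noteq> 0" by auto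
  define X where "X = (\<lambda>a :: nat. if a = 0 then 1\<^sub>m n else if a = 1 then A else A * B)"
  have X: "X 0 = 1\<^sub>m n" "X 1 = A" "X 2 = A * B" by (simp_all add: X_def)
  have Xc: "X a \<in> carrier_mat n n" "det (X a) \<noteq> 0" if "a \<in> {0,1,2}" for a
    using A B det by (auto simp: X_def det_mult[OF A B])
  define h where "h = (\<lambda>i j k. real_of_rat (max_exp n X (counts i j k)))"
  have len: "length sA = n" "length sB = n" "length sC = n" using S A B C by (auto simp: is_Sing_def)
  have 1: "max_exp n X (counts (n - m) m 0) = lead_exp (det (X 0)) + (\<Sum>i<m. lead_exp (sA ! i))" if "m \<le> n" for m
    by (rule max_exp_boundary[of X 0 n 1 A sA 2]) (use Xc X A det S that in \<open>auto simp: counts_def\<close>)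
  have 2: "max_exp n X (counts 0 (n - m) m) = lead_exp (det (X 1)) + (\<Sum>i<m. lead_exp (sB ! i))" if "m \<le> n" for m
    by (rule max_exp_boundary[of X 1 n 2 B sB 0]) (use Xc X B det S that in \<open>auto simp: counts_def\<close>)
  have 3: "max_exp n X (counts m 0 (n - m)) = lead_exp (det (X 2)) + (\<Sum>i<m. lead_exp (sC ! i))" if "m \<le> n" for m
    by (rule max_exp_boundary[of X 2 n 0 C sC 1]) (use Xc[of 2] X(1,3) C ABC det S that in auto)
  have "hive n h" unfolding h_def by (rule hive_max_exp[OF Xc])
  moreover have "hive_boundary n h =
    (map (of_rat \<circ> lead_exp) sA, map (of_rat \<circ> lead_exp) sB, map (of_rat \<circ> lead_exp) sC)"
    unfolding hive_boundary_def
  proof (intro prod_eqI; unfold fst_conv snd_conv; intro nth_equalityI)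
    fix m assume "m < length (map (\<lambda>m. h (n - (m + 1)) (m + 1) 0 - h (n - m) m 0) [0..<n])"
    then have m: "m < n" by simp
    show "map (\<lambda>m. h (n - (m + 1)) (m + 1) 0 - h (n - m) m 0) [0..<n] ! m = map (of_rat \<circ> lead_exp) sA ! m"
      using m 1[of m] 1[of "m + 1"] by (simp add: len h_def flip: of_rat_diff)
  next
    fix m assume "m < length (map (\<lambda>m. h 0 (n - (m + 1)) (m + 1) - h 0 (n - m) m) [0..<n])"
    then have m: "m < n" by simp
    show "map (\<lambda>m. h 0 (n - (m + 1)) (m + 1) - h 0 (n - m) m) [0..<n] ! m = map (of_rat \<circ> lead_exp) sB ! m"
      using m 2[of m] 2[of "m + 1"] by (simp add: len h_def flip: of_rat_diff)
  next
    fix m assume "m < length (map (\<lambda>m. h (m + 1) 0 (n - (m + 1)) - h m 0 (n - m)) [0..<n])"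
    then have m: "m < n" by simp
    show "map (\<lambda>m. h (m + 1) 0 (n - (m + 1)) - h m 0 (n - m)) [0..<n] ! m = map (of_rat \<circ> lead_exp) sC ! m"
      using m 3[of m] 3[of "m + 1"] by (simp add: len h_def flip: of_rat_diff)
  qed (simp_all add: len)
  ultimately show ?thesis by blast
qed

section \<open>Rational hives\<close>

lemma common_denominator:
  fixes S :: "rat set"
  assumes "finite S"
  obtains D :: nat where "D > 0" "\<And>q. q \<in> S \<Longrightarrow> of_nat D * q \<in> \<int>"
proof -
  have "\<exists>D::nat. D > 0 \<and> (\<forall>q\<in>S. of_nat D * q \<in> \<int>)"
    using assms
  proof (induction S rule: finite_induct)
    case empty
    show ?case by (intro exI[of _ 1]) simp
  next
    case (insert q S)
    then obtain D :: nat where D: "D > 0" "\<forall>q\<in>S. of_nat D * q \<in> \<int>" by blast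
    obtain a b where ab: "quotient_of q = (a, b)" by (cases "quotient_of q")
    then have b: "b > 0" "q = of_int a / of_int b" using quotient_of_denom_pos quotient_of_div by auto
    have "of_nat (D * nat b) * q = of_int (int D * a)" using b by simp
    moreover have "of_nat (D * nat b) * p \<in> \<int>" if "p \<in> S" for p
    proof -
      have "of_nat (D * nat b) * p = of_nat (nat b) * (of_nat D * p)" by simp
      then show ?thesis using D(2) that by (metis Ints_mult Ints_of_nat)
    qed
    ultimately show ?case using D(1) b(1) by (intro exI[of _ "D * nat b"]) (auto simp del: of_nat_mult)
  qed
  then show ?thesis using that by blast
qed

text \<open>Multiply a hive by an integer such that all its values become close to integers, and round.
  A hive inequality between integers that holds up to an error below one holds exactly, and the
  same is true of the equations that fix the boundary.\<close>

lemma rational_hive_exists: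
  assumes hive: "hive n h" and bd: "hive_boundary n h = (map of_rat \<alpha>, map of_rat \<beta>, map of_rat \<gamma>)"
  obtains g :: "nat \<Rightarrow> nat \<Rightarrow> nat \<Rightarrow> rat" where "hive n (\<lambda>i j k. of_rat (g i j k))"
    "hive_boundary n (\<lambda>i j k. of_rat (g i j k)) = (map of_rat \<alpha>, map of_rat \<beta>, map of_rat \<gamma>)"
proof -
  have len: "length \<alpha> = n" "length \<beta> = n" "length \<gamma> = n"
    using bd unfolding hive_boundary_def by (auto dest!: arg_cong[of _ _ length])
  obtain D :: nat where D: "D > 0" "\<And>q. q \<in> set (\<alpha> @ \<beta> @ \<gamma>) \<Longrightarrow> of_nat D * q \<in> \<int>"
    using common_denominator[of "set (\<alpha> @ \<beta> @ \<gamma>)"] by auto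
  let ?F = "{..n} \<times> {..n} \<times> {..n}"
  obtain e where e: "bij_betw e ?F {0..<card ?F}" using ex_bij_betw_finite_nat[of ?F] by auto
  define \<theta> where "\<theta> = (\<lambda>l. case inv_into ?F e l of (i, j, k) \<Rightarrow> real D * h i j k)"
  have th: "\<theta> (e (i, j, k)) = real D * h i j k" if "i \<le> n" "j \<le> n" "k \<le> n" for i j k
    using that bij_betw_inv_into_left[OF e, of "(i, j, k)"] by (simp add: \<theta>_def)
  \<comment> \<open>Four values occur in a hive inequality, so errors below \<open>1 / 4\<close> add up to less than one.\<close>
  obtain q p where q: "0 < q" "q \<le> int (4 ^ card ?F)" and p: "\<And>l. l < card ?F \<Longrightarrow> \<bar>of_int q * \<theta> l - of_int (p l)\<bar> < 1 / real 4"
    by (rule Dirichlet_approx_simult[of 4 "card ?F" \<theta>], simp) (rule that)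
  define z where "z = (\<lambda>i j k. p (e (i, j, k)))"
  define c where "c = real_of_int q * real D"
  have c: "c > 0" using q(1) D(1) by (simp add: c_def)
  have z: "\<bar>c * h i j k - of_int (z i j k)\<bar> < 1 / 4" if "i \<le> n" "j \<le> n" "k \<le> n" for i j k
  proof -
    have "e (i, j, k) < card ?F" using that bij_betwE[OF e] by auto
    from p[OF this] show ?thesis using th[OF that] by (simp add: z_def c_def mult.assoc)
  qed
  define g where "g = (\<lambda>i j k. of_int (z i j k) / (of_int q * of_nat D) :: rat)"
  have g: "real_of_rat (g i j k) = of_int (z i j k) / c" for i j k
    by (simp add: g_def c_def of_rat_divide of_rat_mult)
  have ineq: "real_of_rat (g i j k) + of_rat (g i' j' k') \<le> of_rat (g a b d) + of_rat (g a' b' d')"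
    if "h i j k + h i' j' k' \<le> h a b d + h a' b' d'"
      "i \<le> n" "j \<le> n" "k \<le> n" "i' \<le> n" "j' \<le> n" "k' \<le> n" "a \<le> n" "b \<le> n" "d \<le> n" "a' \<le> n" "b' \<le> n" "d' \<le> n"
    for i j k i' j' k' a b d a' b' d'
  proof -
    have "c * (h i j k + h i' j' k') \<le> c * (h a b d + h a' b' d')" using that(1) c by simp
    then have "real_of_int (z i j k + z i' j' k') < of_int (z a b d + z a' b' d') + 1"
      using z[of i j k] z[of i' j' k'] z[of a b d] z[of a' b' d'] that(2-)
      by (simp add: distrib_left abs_if split: if_splits)
    then have "z i j k + z i' j' k' \<le> z a b d + z a' b' d'"
      by linarith
    then have "real_of_int (z i j k) + of_int (z i' j' k') \<le> of_int (z a b d) + of_int (z a' b' d')"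
      by (simp flip: of_int_add)
    then show ?thesis using c unfolding g by (simp add: divide_right_mono flip: add_divide_distrib)
  qed
  have eq: "real_of_rat (g i j k) - of_rat (g i' j' k') = h i j k - h i' j' k'"
    if hr: "h i j k - h i' j' k' = of_rat r" "r \<in> set (\<alpha> @ \<beta> @ \<gamma>)"
      and "i \<le> n" "j \<le> n" "k \<le> n" "i' \<le> n" "j' \<le> n" "k' \<le> n" for i j k i' j' k' r
  proof -
    obtain s where s: "of_nat D * r = of_int s" using D(2)[OF hr(2)] by (auto elim: Ints_cases)
    have "real D * of_rat r = of_rat (of_nat D * r)" by (simp add: of_rat_mult)
    then have ch: "c * h i j k - c * h i' j' k' = of_int (q * s)"
      unfolding right_diff_distrib[symmetric] hr(1) using s by (simp add: c_def)
    have "\<bar>c * h i j k - of_int (z i j k)\<bar> < 1 / 4" "\<bar>c * h i' j' k' - of_int (z i' j' k')\<bar> < 1 / 4"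
      using z that by auto
    then have "\<bar>real_of_int (z i j k) - of_int (z i' j' k') - of_int (q * s)\<bar> < 1"
      using ch by linarith
    then have "z i j k - z i' j' k' = q * s" by linarith
    then have "real_of_int (z i j k) - of_int (z i' j' k') = c * h i j k - c * h i' j' k'"
      unfolding ch by (simp flip: of_int_diff)
    then show ?thesis using c unfolding g by (simp add: field_simps)
  qed
  have "hive n (\<lambda>i j k. of_rat (g i j k))"
    unfolding hive_def
  proof (intro conjI allI impI)
    fix i j k assume a: "i + j + k = n \<and> 2 \<le> k"
    show "of_rat (g i j k) + of_rat (g (i + 1) (j + 1) (k - 2))
        \<le> real_of_rat (g (i + 1) j (k - 1)) + of_rat (g i (j + 1) (k - 1))"
      by (rule ineq) (use a hive in \<open>auto simp: hive_def\<close>)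
  next
    fix i j k assume a: "i + j + k = n \<and> 2 \<le> j"
    show "of_rat (g i j k) + of_rat (g (i + 1) (j - 2) (k + 1))
        \<le> real_of_rat (g (i + 1) (j - 1) k) + of_rat (g i (j - 1) (k + 1))"
      by (rule ineq) (use a hive in \<open>auto simp: hive_def\<close>)
  next
    fix i j k assume a: "i + j + k = n \<and> 2 \<le> i"
    show "of_rat (g i j k) + of_rat (g (i - 2) (j + 1) (k + 1))
        \<le> real_of_rat (g (i - 1) (j + 1) k) + of_rat (g (i - 1) j (k + 1))"
      by (rule ineq) (use a hive in \<open>auto simp: hive_def\<close>)
  qed
  moreover have "hive_boundary n (\<lambda>i j k. of_rat (g i j k)) = hive_boundary n h"
  proof -
    have nth: "h (n - (m + 1)) (m + 1) 0 - h (n - m) m 0 = of_rat (\<alpha> ! m)"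
      "h 0 (n - (m + 1)) (m + 1) - h 0 (n - m) m = of_rat (\<beta> ! m)"
      "h (m + 1) 0 (n - (m + 1)) - h m 0 (n - m) = of_rat (\<gamma> ! m)" if "m < n" for m
      using bd that unfolding hive_boundary_def prod.inject by (auto simp: list_eq_iff_nth_eq)
    have mem: "\<alpha> ! m \<in> set (\<alpha> @ \<beta> @ \<gamma>)" "\<beta> ! m \<in> set (\<alpha> @ \<beta> @ \<gamma>)" "\<gamma> ! m \<in> set (\<alpha> @ \<beta> @ \<gamma>)"
      if "m < n" for m using that len by auto
    have "real_of_rat (g (n - (m + 1)) (m + 1) 0) - of_rat (g (n - m) m 0) = h (n - (m + 1)) (m + 1) 0 - h (n - m) m 0"
      "real_of_rat (g 0 (n - (m + 1)) (m + 1)) - of_rat (g 0 (n - m) m) = h 0 (n - (m + 1)) (m + 1) - h 0 (n - m) m"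
      "real_of_rat (g (m + 1) 0 (n - (m + 1))) - of_rat (g m 0 (n - m)) = h (m + 1) 0 (n - (m + 1)) - h m 0 (n - m)"
      if "m < n" for m
      by (rule eq[OF nth(1)[OF that] mem(1)[OF that]] eq[OF nth(2)[OF that] mem(2)[OF that]]
          eq[OF nth(3)[OF that] mem(3)[OF that]]; use that in simp)+
    then show ?thesis unfolding hive_boundary_def by auto
  qed
  ultimately show ?thesis using that bd by simp
qed

section \<open>Matrices from a rational hive\<close>

subsection \<open>Singular values of a scaled unimodular matrix\<close>

text \<open>Matrices over the valuation ring.\<close>

definition integral_mat :: "nat \<Rightarrow> puiseux mat \<Rightarrow> bool" where
  "integral_mat n M \<longleftrightarrow> M \<in> carrier_mat n n \<and> (\<forall>i<n. \<forall>j<n. exp_le (M $$ (i, j)) 0)"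

lemma exp_le_det:
  assumes M: "M \<in> carrier_mat n n"
    and b: "\<And>i j. i < n \<Longrightarrow> j < n \<Longrightarrow> exp_le (M $$ (i, j)) (b i j)"
    and sum: "\<And>p. p permutes {0..<n} \<Longrightarrow> (\<Sum>i=0..<n. b i (p i)) \<le> q"
  shows "exp_le (det M) q"
  unfolding det_def'[OF M]
proof (rule exp_le_sum)
  fix p assume "p \<in> {p. p permutes {0..<n}}"
  then have p: "p permutes {0..<n}" by simp
  have pn: "p i < n" if "i < n" for i using permutes_in_image[OF p, of i] that by simp
  have "exp_le (\<Prod>i=0..<n. M $$ (i, p i)) (\<Sum>i=0..<n. b i (p i))"
    by (intro exp_le_prod b pn) auto
  then have "exp_le (\<Prod>i=0..<n. M $$ (i, p i)) q" using sum[OF p] exp_le_mono by blast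
  then show "exp_le (signof p * (\<Prod>i=0..<n. M $$ (i, p i))) q"
    by (cases "sign p = 1") (auto simp: sign_def)
qed

lemma sum_le_sum_largest:
  fixes x :: "nat \<Rightarrow> rat"
  assumes "I \<subseteq> {..<n}" "\<And>i j. i \<le> j \<Longrightarrow> j < n \<Longrightarrow> x j \<le> x i"
  shows "sum x I \<le> (\<Sum>i<card I. x i)"
  using assms(1)
proof (induction "card I" arbitrary: I)
  case 0
  then have "I = {}" using finite_subset[of I "{..<n}"] by simp
  then show ?case by simp
next
  case (Suc m)
  have fin: "finite I" using Suc.prems by (rule finite_subset) simp
  then have ne: "I \<noteq> {}" using Suc(2) by auto
  let ?k = "Max I"
  have k: "?k \<in> I" using fin ne by (rule Max_in)
  have c: "card (I - {?k}) = m" using Suc(2) fin k by simp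
  have "I \<subseteq> {..?k}" using fin by auto
  then have "card I \<le> Suc ?k" using card_mono[of "{..?k}" I] by simp
  then have "x ?k \<le> x m" using Suc(2) Suc.prems k by (intro assms(2)) auto
  moreover have "sum x (I - {?k}) \<le> (\<Sum>i<m. x i)"
    using Suc(1)[of "I - {?k}"] c Suc.prems by auto
  moreover have "sum x I = x ?k + sum x (I - {?k})" using fin k by (rule sum.remove)
  ultimately show ?case unfolding Suc(2)[symmetric] by simp
qed

lemma lead_exp_det_unimodular:
  assumes U: "integral_mat n U" and V: "integral_mat n V" and VU: "V * U = 1\<^sub>m n"
  shows "det U \<noteq> 0" "lead_exp (det U) = 0" "det V \<noteq> 0" "lead_exp (det V) = 0"
proof -
  have le: "exp_le (det M) 0" if "integral_mat n M" for M
    by (rule exp_le_det[of M n "\<lambda>_ _. 0"]) (use that in \<open>auto simp: integral_mat_def\<close>)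
  have "det V * det U = 1" using U V VU by (metis det_mult det_one integral_mat_def)
  then show nz: "det U \<noteq> 0" "det V \<noteq> 0" by auto
  have "lead_exp (det V) + lead_exp (det U) = 0"
    using lead_exp_mult(1)[OF nz(2,1)] \<open>det V * det U = 1\<close> by simp
  moreover have "lead_exp (det V) \<le> 0" "lead_exp (det U) \<le> 0"
    using le U V nz exp_le_iff by blast+
  ultimately show "lead_exp (det U) = 0" "lead_exp (det V) = 0" by linarith+
qed

text \<open>Multiplication by the inverse \<open>V\<close> of \<open>U\<close> turns the columns of the identity and of \<open>A\<close> into
  those of \<open>V\<close> and of a diagonal matrix.  The Leibniz formula bounds the determinants of choices
  from these; the bound is attained by exchanging the smallest columns of the diagonal matrix, one
  after the other, for columns of \<open>V\<close>.\<close>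

theorem is_Sing_scaled_unimodular:
  assumes U: "integral_mat n U" and V: "integral_mat n V" and VU: "V * U = 1\<^sub>m n"
    and x: "\<And>i. i < n \<Longrightarrow> x i \<noteq> 0" "\<And>i j. i \<le> j \<Longrightarrow> j < n \<Longrightarrow> lead_exp (x j) \<le> lead_exp (x i)"
    and A: "A = mat n n (\<lambda>(i,j). x j * U $$ (i, j))" and S: "is_Sing A ss" and i: "i < n"
  shows "lead_exp (ss ! i) = lead_exp (x i)"
proof -
  let ?l = "\<lambda>i. lead_exp (x i)"
  define D where "D = mat n n (\<lambda>(i,j). if i = j then x j else 0)"
  have Uc: "U \<in> carrier_mat n n" and Vc: "V \<in> carrier_mat n n" and Dc: "D \<in> carrier_mat n n"
    using U V by (auto simp: integral_mat_def D_def)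
  have Ac: "A \<in> carrier_mat n n" by (simp add: A)
  have UV: "U * V = 1\<^sub>m n" using mat_mult_left_right_inverse[OF Vc Uc VU] .
  have UD: "U * D = A"
    using Uc Dc by (intro eq_matI) (auto simp: A D_def scalar_prod_def if_distrib mult.commute cong: if_cong)
  note detU = lead_exp_det_unimodular[OF U V VU]
  define X where "X = (\<lambda>a :: nat. if a = 0 then 1\<^sub>m n else A)"
  define Y where "Y = (\<lambda>a :: nat. if a = 0 then V else D)"
  have X: "X 0 = 1\<^sub>m n" "X 1 = A" by (simp_all add: X_def)
  have XY: "X = (\<lambda>a. U * Y a)" using UV UD by (auto simp: X_def Y_def)
  have det: "choice_det n X f = det U * choice_det n Y f" if "f \<in> choices n {0,1}" for f
    unfolding XY by (rule choice_det_mult[OF Uc _ that]) (use Vc Dc in \<open>auto simp: Y_def\<close>)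
  have detD: "det D = (\<Prod>i=0..<n. x i)"
  proof -
    have "det D = prod_list (diag_mat D)"
      by (rule det_upper_triangular[OF _ Dc]) (auto simp: D_def)
    also have "diag_mat D = map x [0..<n]" by (auto simp: diag_mat_def D_def)
    finally show ?thesis using prod.distinct_set_conv_list[of "[0..<n]" x] by simp
  qed
  have detA: "det A \<noteq> 0"
    using detU x(1) unfolding UD[symmetric] det_mult[OF Uc Dc] detD by simp
  note minors = is_Sing_minors[where X = X and a = 0 and b = 1, OF Ac detA S zero_neq_one X]
  have entries: "fst (f p) \<in> {0,1}" "snd (f p) < n" if "f \<in> choices n {0,1}" "p < n" for f p
    using that by (cases "f p"; force simp: choices_def PiE_iff)+
  have upper: "exp_le (choice_det n Y f) (\<Sum>i<count_from n f 1. ?l i)" if f: "f \<in> choices n {0,1}" for f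
    unfolding choice_det_def
  proof (rule exp_le_det[where b = "\<lambda>i p. if fst (f p) = 1 then ?l i else 0"])
    fix i p assume ip: "i < n" "p < n"
    have "exp_le (V $$ (i, snd (f p))) 0" using V entries(2)[OF f ip(2)] ip(1) by (auto simp: integral_mat_def)
    then show "exp_le (mat n n (\<lambda>(i,p). Y (fst (f p)) $$ (i, snd (f p))) $$ (i, p))
        (if fst (f p) = 1 then ?l i else 0)"
      using ip entries[OF f ip(2)] by (auto simp: Y_def D_def exp_le_lead_exp)
  next
    fix p assume p: "p permutes {0..<n}"
    let ?I = "{i \<in> {0..<n}. fst (f (p i)) = 1}"
    have "(\<Sum>i=0..<n. if fst (f (p i)) = 1 then ?l i else 0) = sum ?l ?I"
      by (simp add: sum.If_cases Int_def)
    also have "\<dots> \<le> (\<Sum>i<card ?I. ?l i)" by (rule sum_le_sum_largest[of _ n]) (use x(2) in auto)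
    also have "card ?I = card {q \<in> {0..<n}. fst (f q) = 1}"
      by (rule bij_betw_same_card[of p]) (use p in \<open>auto simp: bij_betw_def inj_on_def permutes_inj_on
        permutes_in_image dest: permutes_inj injD intro!: image_eqI[of _ p "inv_into UNIV p _"]\<close>)
    finally show "(\<Sum>i=0..<n. if fst (f (p i)) = 1 then ?l i else 0) \<le> (\<Sum>i<count_from n f 1. ?l i)"
      by (simp add: count_from_def)
  qed simp
  \<comment> \<open>Downward induction on \<open>m\<close>: the positions from \<open>m\<close> on have been exchanged already.\<close>
  have lower: "\<exists>f\<in>choices n {0,1}. (\<forall>p<m. f p = (1, p)) \<and>
      count_from n f 1 = m \<and> choice_det n Y f \<noteq> 0 \<and> (\<Sum>i<m. ?l i) \<le> lead_exp (choice_det n Y f)"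
    if "m \<le> n" for m
    using that
  proof (induction m rule: inc_induct)
    case base
    define f where "f = (\<lambda>p\<in>{0..<n}. (1, p) :: nat \<times> nat)"
    have f: "f \<in> choices n {0,1}" "\<And>p. p < n \<Longrightarrow> f p = (1, p)" by (auto simp: f_def choices_def)
    have "mat n n (\<lambda>(i,p). Y (fst (f p)) $$ (i, snd (f p))) = D"
      by (intro eq_matI) (auto simp: Y_def D_def f(2))
    then have d: "choice_det n Y f = (\<Prod>i=0..<n. x i)" by (simp add: choice_det_def detD)
    have "lead_exp (\<Prod>i\<in>I. x i) = sum ?l I" if "I \<subseteq> {0..<n}" for I
      using finite_subset[OF that] that
      by (induction I rule: infinite_finite_induct) (auto simp: lead_exp_mult x(1) subset_eq)
    then have "lead_exp (choice_det n Y f) = (\<Sum>i<n. ?l i)" unfolding d by (simp add: atLeast0LessThan)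
    moreover have "choice_det n Y f \<noteq> 0" unfolding d using x(1) by simp
    moreover have "{p. p < n \<and> fst (f p) = 1} = {0..<n}" using f(2) by auto
    then have "count_from n f 1 = n" by (simp add: count_from_def)
    ultimately show ?case using f by (intro bexI[of _ f]) auto
  next
    case (step m)
    then obtain f where f: "f \<in> choices n {0,1}" "\<And>p. p < Suc m \<Longrightarrow> f p = (1, p)" "count_from n f 1 = Suc m" "choice_det n Y f \<noteq> 0"
      "(\<Sum>i<Suc m. ?l i) \<le> lead_exp (choice_det n Y f)" by blast
    define g where "g = (\<lambda>p :: nat. (0 :: nat, p))"
    have "mat n n (\<lambda>(i,p). Y (fst (g p)) $$ (i, snd (g p))) = V"
      using Vc by (intro eq_matI) (auto simp: Y_def g_def)
    then have g: "choice_det n Y g \<noteq> 0" "lead_exp (choice_det n Y g) = 0"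
      using detU by (simp_all add: choice_det_def)
    obtain s where s: "s < n" "choice_det n Y (f(m := g s)) \<noteq> 0" "choice_det n Y (g(s := f m)) \<noteq> 0"
      "lead_exp (choice_det n Y f) + lead_exp (choice_det n Y g)
        \<le> lead_exp (choice_det n Y (f(m := g s))) + lead_exp (choice_det n Y (g(s := f m)))"
      using valuated_exchange[OF step(2) f(4) g(1)] .
    have fm: "f m = (1, m)" using f(2) by simp
    have "exp_le (choice_det n Y (g(s := f m))) (?l m)"
      unfolding choice_det_def
    proof (rule exp_le_det[where b = "\<lambda>i p. if p = s then ?l m else 0"])
      fix i p assume ip: "i < n" "p < n"
      then have "exp_le (V $$ (i, p)) 0" using V by (auto simp: integral_mat_def)
      then show "exp_le (mat n n (\<lambda>(i,p). Y (fst ((g(s := f m)) p)) $$ (i, snd ((g(s := f m)) p))) $$ (i, p))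
          (if p = s then ?l m else 0)"
        using ip step(2) by (auto simp: fm g_def Y_def D_def exp_le_lead_exp)
    next
      fix p assume p: "p permutes {0..<n}"
      have "(\<Sum>i=0..<n. if p i = s then ?l m else 0) = (\<Sum>i=0..<n. if i = s then ?l m else 0)"
        by (rule sum.permute[OF p, of "\<lambda>i. if i = s then ?l m else 0", unfolded comp_def, symmetric])
      then show "(\<Sum>i=0..<n. if p i = s then ?l m else 0) \<le> ?l m" using s(1) by simp
    qed simp
    then have "lead_exp (choice_det n Y (g(s := f m))) \<le> ?l m" using s(3) exp_le_iff by blast
    then have low: "(\<Sum>i<m. ?l i) \<le> lead_exp (choice_det n Y (f(m := g s)))" using s(4) f(5) g(2) by simp
    have ch: "f(m := g s) \<in> choices n {0,1}"
      by (rule choices_upd[OF f(1) step(2)]) (use s(1) in \<open>simp add: g_def\<close>)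
    have "count_from n (f(m := g s)) 1 = m"
      using count_from_upd[OF step(2), of f "g s" 1] f(3) by (simp add: fm g_def)
    moreover have "(f(m := g s)) p = (1, p)" if "p < m" for p using f(2) that by simp
    ultimately show ?case using ch low s(2) by blast
  qed
  have partial: "(\<Sum>i<m. lead_exp (ss ! i)) = (\<Sum>i<m. ?l i)" if m: "m \<le> n" for m
  proof (rule antisym)
    obtain f where f: "f \<in> choices n {0,1}" "count_from n f 1 = m" "choice_det n X f \<noteq> 0"
      "lead_exp (choice_det n X f) = (\<Sum>i<m. lead_exp (ss ! i))"
      using minors(1)[OF m] by blast
    then have "choice_det n Y f \<noteq> 0" by (auto simp: det)
    then show "(\<Sum>i<m. lead_exp (ss ! i)) \<le> (\<Sum>i<m. ?l i)"
      using upper[OF f(1)] f detU by (simp add: det lead_exp_mult exp_le_iff flip: f(4))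
  next
    obtain f where f: "f \<in> choices n {0,1}" "count_from n f 1 = m" "choice_det n Y f \<noteq> 0"
      "(\<Sum>i<m. ?l i) \<le> lead_exp (choice_det n Y f)"
      using lower[OF m] by blast
    then show "(\<Sum>i<m. ?l i) \<le> (\<Sum>i<m. lead_exp (ss ! i))"
      using minors(2)[OF m f(1,2)] detU by (simp add: det lead_exp_mult exp_le_iff)
  qed
  show ?thesis using partial[of i] partial[of "Suc i"] i by simp
qed


subsection \<open>Snakes\<close>

text \<open>Membership of \<open>x\<close> in the module over the valuation ring that \<open>b 0, \<dots>, b (n - 1)\<close> generate.\<close>

definition in_lattice :: "nat \<Rightarrow> (nat \<Rightarrow> nat \<Rightarrow> puiseux) \<Rightarrow> (nat \<Rightarrow> puiseux) \<Rightarrow> bool" where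
  "in_lattice n b x \<longleftrightarrow> (\<exists>c. (\<forall>r<n. exp_le (c r) 0) \<and> (\<forall>q. x q = (\<Sum>r<n. c r * b r q)))"

lemma in_lattice_basis: "r < n \<Longrightarrow> in_lattice n b (b r)"
  unfolding in_lattice_def
  by (rule exI[of _ "\<lambda>s. if s = r then 1 else 0"]) (auto simp: if_distrib[of "\<lambda>x. x * _"] cong: if_cong)

lemma in_lattice_comb:
  assumes x: "in_lattice n b x" and y: "in_lattice n b y" and d: "exp_le d 0"
  shows "in_lattice n b (\<lambda>q. - x q + d * y q)"
proof -
  obtain c where c: "\<And>r. r < n \<Longrightarrow> exp_le (c r) 0" "\<And>q. x q = (\<Sum>r<n. c r * b r q)"
    using x by (auto simp: in_lattice_def)
  obtain e where e: "\<And>r. r < n \<Longrightarrow> exp_le (e r) 0" "\<And>q. y q = (\<Sum>r<n. e r * b r q)"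
    using y by (auto simp: in_lattice_def)
  have "exp_le (- c r + d * e r) 0" if "r < n" for r
    using c(1)[OF that] exp_le_mult[OF d e(1)[OF that]] by (intro exp_le_add) simp_all
  moreover have "- x q + d * y q = (\<Sum>r<n. (- c r + d * e r) * b r q)" for q
    by (simp add: c(2) e(2) left_diff_distrib sum_subtractf sum_distrib_left mult.assoc)
  ultimately show ?thesis unfolding in_lattice_def by (intro exI[of _ "\<lambda>r. - c r + d * e r"]) auto
qed

lemma in_lattice_matrix:
  assumes "\<And>r. r < n \<Longrightarrow> in_lattice n b (x r)"
  obtains G where "integral_mat n G" "mat n n (\<lambda>(r,q). x r q) = G * mat n n (\<lambda>(r,q). b r q)"
proof -
  have "\<forall>r. \<exists>c. r < n \<longrightarrow> (\<forall>s<n. exp_le (c s) 0) \<and> (\<forall>q. x r q = (\<Sum>s<n. c s * b s q))"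
    using assms by (auto simp: in_lattice_def)
  then obtain c where c: "\<And>r s. r < n \<Longrightarrow> s < n \<Longrightarrow> exp_le (c r s) 0"
    "\<And>r q. r < n \<Longrightarrow> x r q = (\<Sum>s<n. c r s * b s q)" by metis
  show ?thesis
  proof (rule that[of "mat n n (\<lambda>(r,s). c r s)"])
    show "integral_mat n (mat n n (\<lambda>(r,s). c r s))" using c(1) by (auto simp: integral_mat_def)
    show "mat n n (\<lambda>(r,q). x r q) = mat n n (\<lambda>(r,s). c r s) * mat n n (\<lambda>(r,q). b r q)"
      using c(2) by (intro eq_matI) (auto simp: scalar_prod_def atLeast0LessThan)
  qed
qed

text \<open>A snake is a path across the triangle from one corner to the opposite side.  The vector \<open>v i j\<close> has
  distance \<open>n - 1 - i\<close> from the corner and lies in position \<open>j\<close> of its row, so a snake meets each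
  row once.  An elementary move of a snake changes one of its vectors by sign and by a multiple in the
  valuation ring of the next one; therefore the two extreme snakes, along the sides at the corner,
  generate the same lattice.\<close>

lemma snake_bases:
  fixes v :: "nat \<Rightarrow> nat \<Rightarrow> nat \<Rightarrow> puiseux"
  assumes rel: "\<And>i j. i + j + 1 < n \<Longrightarrow> \<exists>d. exp_le d 0 \<and> v i (Suc j) = (\<lambda>q. - v i j q + d * v (Suc i) j q)"
  shows "\<exists>G G'. integral_mat n G \<and> integral_mat n G' \<and>
    mat n n (\<lambda>(r,q). v r 0 q) = G * mat n n (\<lambda>(r,q). v r (n - 1 - r) q) \<and>
    mat n n (\<lambda>(r,q). v r (n - 1 - r) q) = G' * mat n n (\<lambda>(r,q). v r 0 q)"
proof -
  have near: "in_lattice n (\<lambda>r. v r 0) (v i j)" if "i + j < n" for i j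
    using that
  proof (induction j arbitrary: i)
    case 0
    then show ?case using in_lattice_basis[of i n "\<lambda>r. v r 0"] by simp
  next
    case (Suc j)
    obtain d where d: "exp_le d 0" "v i (Suc j) = (\<lambda>q. - v i j q + d * v (Suc i) j q)"
      using rel[of i j] Suc.prems by auto
    show ?case unfolding d(2) using Suc.prems by (intro in_lattice_comb Suc.IH d(1)) auto
  qed
  have far: "in_lattice n (\<lambda>r. v r (n - 1 - r)) (v i (n - 1 - i - k))" if "i + k < n" for i k
    using that
  proof (induction k arbitrary: i)
    case 0
    then show ?case using in_lattice_basis[of i n "\<lambda>r. v r (n - 1 - r)"] by simp
  next
    case (Suc k)
    define j where "j = n - 1 - i - Suc k"
    have j: "Suc j = n - 1 - i - k" "j = n - 1 - Suc i - k" "i + j + 1 < n" using Suc.prems by (auto simp: j_def)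
    obtain d where d: "exp_le d 0" "v i (Suc j) = (\<lambda>q. - v i j q + d * v (Suc i) j q)"
      using rel[of i j] j(3) by auto
    have eq: "v i j = (\<lambda>q. - v i (Suc j) q + d * v (Suc i) j q)" unfolding d(2) by (auto simp: fun_eq_iff)
    have "in_lattice n (\<lambda>r. v r (n - 1 - r)) (v i (Suc j))"
      using Suc.IH[of i] Suc.prems unfolding j(1) by simp
    moreover have "in_lattice n (\<lambda>r. v r (n - 1 - r)) (v (Suc i) j)"
      using Suc.IH[of "Suc i"] Suc.prems unfolding j(2) by simp
    ultimately have "in_lattice n (\<lambda>r. v r (n - 1 - r)) (\<lambda>q. - v i (Suc j) q + d * v (Suc i) j q)"
      by (rule in_lattice_comb) (rule d(1))
    then show ?case unfolding j_def[symmetric] eq .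
  qed
  have "in_lattice n (\<lambda>r. v r (n - 1 - r)) (v r 0)" if "r < n" for r
    using far[of r "n - 1 - r"] that by simp
  then obtain G where "integral_mat n G" "mat n n (\<lambda>(r,q). v r 0 q) = G * mat n n (\<lambda>(r,q). v r (n - 1 - r) q)"
    by (rule in_lattice_matrix[of n "\<lambda>r. v r (n - 1 - r)" "\<lambda>r. v r 0"])
  moreover obtain G' where "integral_mat n G'"
    "mat n n (\<lambda>(r,q). v r (n - 1 - r) q) = G' * mat n n (\<lambda>(r,q). v r 0 q)"
    by (rule in_lattice_matrix[of n "\<lambda>r. v r 0" "\<lambda>r. v r (n - 1 - r)"]) (use near in auto)
  ultimately show ?thesis by blast
qed

text \<open>The bases of two neighbouring corners on their common side consist of proportional vectors in
  opposite order, so consecutive corners differ by a unimodular matrix whose columns are rescaled.\<close>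

lemma corner_matrix:
  fixes v :: "nat \<Rightarrow> nat \<Rightarrow> nat \<Rightarrow> puiseux"
  assumes rel: "\<And>i j. i + j + 1 < n \<Longrightarrow> \<exists>d. exp_le d 0 \<and> v i (Suc j) = (\<lambda>q. - v i j q + d * v (Suc i) j q)"
    and link: "\<And>r. r < n \<Longrightarrow> v (n - 1 - r) r = (\<lambda>q. x r * v' r q)"
    and x: "\<And>i. i < n \<Longrightarrow> x i \<noteq> 0" "\<And>i j. i \<le> j \<Longrightarrow> j < n \<Longrightarrow> lead_exp (x j) \<le> lead_exp (x i)"
    and F: "F = mat n n (\<lambda>(r,q). v r 0 q)" and det: "det F \<noteq> 0"
  obtains A ss where "A \<in> carrier_mat n n" "F = A * mat n n (\<lambda>(r,q). v' r q)" "det A \<noteq> 0"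
    "is_Sing A ss" "map lead_exp ss = map (\<lambda>i. lead_exp (x i)) [0..<n]"
proof -
  define E where "E = mat n n (\<lambda>(r,q). v r (n - 1 - r) q)"
  define F' where "F' = mat n n (\<lambda>(r,q). v' r q)"
  have c: "F \<in> carrier_mat n n" "E \<in> carrier_mat n n" "F' \<in> carrier_mat n n" by (simp_all add: F E_def F'_def)
  obtain G G' where G: "integral_mat n G" "F = G * E" and G': "integral_mat n G'" "E = G' * F"
    using snake_bases[of n v] rel unfolding F E_def by blast
  have Gc: "G \<in> carrier_mat n n" "G' \<in> carrier_mat n n" using G(1) G'(1) by (auto simp: integral_mat_def)
  have "det F = det G * (det G' * det F)" using G(2) G'(2) c Gc by (metis det_mult mult_carrier_mat)
  then have "det G \<noteq> 0" "det E \<noteq> 0" using det G(2) det_mult[OF Gc(1) c(2)] by auto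
  have GG: "G' * G = 1\<^sub>m n"
  proof -
    have "(G' * G) * E = G' * (G * E)" by (rule assoc_mult_mat[OF Gc(2,1) c(2)])
    also have "\<dots> = E" unfolding G(2)[symmetric] by (rule G'(2)[symmetric])
    finally have "(G' * G) * E = E" .
    obtain B where B: "B \<in> carrier_mat n n" "E * B = 1\<^sub>m n"
      using det_non_zero_imp_unit[OF c(2) \<open>det E \<noteq> 0\<close>, of "()"] by (auto simp: Units_def ring_mat_def)
    have "G' * G = (G' * G) * (E * B)" using B Gc by simp
    also have "\<dots> = ((G' * G) * E) * B" using B Gc c by (intro assoc_mult_mat[symmetric]) auto
    finally show ?thesis using \<open>(G' * G) * E = E\<close> B by simp
  qed
  define U where "U = mat n n (\<lambda>(i,j). G $$ (i, n - 1 - j))"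
  define V where "V = mat n n (\<lambda>(i,j). G' $$ (n - 1 - i, j))"
  have U: "integral_mat n U" and V: "integral_mat n V"
    using G(1) G'(1) by (auto simp: U_def V_def integral_mat_def)
  have VU: "V * U = 1\<^sub>m n"
  proof (rule eq_matI)
    fix i j assume "i < dim_row (1\<^sub>m n :: puiseux mat)" "j < dim_col (1\<^sub>m n :: puiseux mat)"
    then have ij: "i < n" "j < n" by auto
    have "(V * U) $$ (i, j) = (G' * G) $$ (n - 1 - i, n - 1 - j)"
      using ij Gc by (auto simp: U_def V_def scalar_prod_def)
    then show "(V * U) $$ (i, j) = 1\<^sub>m n $$ (i, j)" unfolding GG using ij by auto
  qed (simp_all add: U_def V_def)
  define A where "A = mat n n (\<lambda>(i,j). x j * U $$ (i, j))"
  have A: "A \<in> carrier_mat n n" by (simp add: A_def)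
  have FA: "F = A * F'"
  proof (rule eq_matI)
    fix i q assume "i < dim_row (A * F')" "q < dim_col (A * F')"
    then have iq: "i < n" "q < n" using A c by auto
    have "F $$ (i, q) = (\<Sum>s=0..<n. G $$ (i, s) * v s (n - 1 - s) q)"
      unfolding G(2) using iq Gc by (simp add: E_def scalar_prod_def)
    also have "\<dots> = (\<Sum>s=0..<n. G $$ (i, n - 1 - s) * v (n - 1 - s) s q)"
      by (rule sum.reindex_bij_witness[of _ "\<lambda>s. n - 1 - s" "\<lambda>s. n - 1 - s"]) auto
    also have "\<dots> = (\<Sum>s=0..<n. x s * U $$ (i, s) * v' s q)"
      using iq link by (intro sum.cong) (auto simp: U_def)
    also have "\<dots> = (A * F') $$ (i, q)" using iq by (simp add: A_def F'_def scalar_prod_def)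
    finally show "F $$ (i, q) = (A * F') $$ (i, q)" .
  qed (use A c in auto)
  have detA: "det A \<noteq> 0" using det unfolding FA det_mult[OF A c(3)] by auto
  obtain ss where ss: "is_Sing A ss" using is_Sing_exists[OF A detA] .
  have "length ss = n" using ss A by (simp add: is_Sing_def)
  then have "map lead_exp ss = map (\<lambda>i. lead_exp (x i)) [0..<n]"
    using is_Sing_scaled_unimodular[OF U V VU x A_def ss] by (auto intro!: nth_equalityI)
  then show ?thesis using that A FA detA ss unfolding F'_def by blast
qed

subsection \<open>The triangle of vectors\<close>

text \<open>The vectors \<open>triangle_vec D i j k\<close> with \<open>i + j + k = n - 1\<close> sit at the upward triangles of a
  triangular array with entries \<open>D i j k\<close>, \<open>i + j + k = n\<close>, at its nodes.  The recursion on \<open>j\<close> solves,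
  for each downward triangle, the linear relation \<open>triangle_relation\<close> between the three adjacent
  vectors.\<close>

fun triangle_vec :: "(nat \<Rightarrow> nat \<Rightarrow> nat \<Rightarrow> puiseux) \<Rightarrow> nat \<Rightarrow> nat \<Rightarrow> nat \<Rightarrow> nat \<Rightarrow> puiseux" where
  "triangle_vec D i 0 k q = D (Suc i) 0 k * (if q = i then 1 else 0)"
| "triangle_vec D i (Suc j) k q =
    - (D (Suc i) (Suc j) k * triangle_vec D i j (Suc k) q + D i (Suc j) (Suc k) * triangle_vec D (Suc i) j k q)
      / D (Suc i) j (Suc k)"

lemma triangle_relation:
  assumes "D (Suc i) j (Suc k) \<noteq> 0"
  shows "D i (Suc j) (Suc k) * triangle_vec D (Suc i) j k q + D (Suc i) j (Suc k) * triangle_vec D i (Suc j) k q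
    + D (Suc i) (Suc j) k * triangle_vec D i j (Suc k) q = 0"
  using assms by (simp add: field_simps)

text \<open>A relation between three vectors turned into an elementary move of a snake.  Here \<open>R\<close>, \<open>Q\<close>, \<open>Z\<close> are the
  scalings of the vectors at one corner of the triangle; for monomials at the nodes of a hive, the
  inequality between leading exponents is a hive inequality.\<close>

lemma normalized_relation:
  fixes P Q R Z :: puiseux
  assumes rel: "\<And>q. P * f1 q + Q * f2 q + R * f3 q = 0"
    and nz: "P \<noteq> 0" "Q \<noteq> 0" "R \<noteq> 0" "Z \<noteq> 0"
    and le: "lead_exp P + lead_exp Z \<le> lead_exp R + lead_exp Q"
  shows "\<exists>d. exp_le d 0 \<and> (\<lambda>q. f2 q / R) = (\<lambda>q. - (f3 q / Q) + d * (f1 q / Z))"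
proof (intro exI conjI ext)
  show "exp_le (- (P * Z / (R * Q))) 0"
    using nz le by (simp add: exp_le_iff lead_exp_divide lead_exp_mult)
  fix q
  show "f2 q / R = - (f3 q / Q) + - (P * Z / (R * Q)) * (f1 q / Z)"
    using nz rel[of q] by (simp add: field_simps eq_neg_iff_add_eq_0)
qed

lemma det_nonzero_imp_invertible_mat:
  fixes A :: "'a :: field mat"
  assumes A: "A \<in> carrier_mat n n" and "det A \<noteq> 0"
  shows "invertible_mat A"
proof -
  obtain B where "B \<in> carrier_mat n n" "A * B = 1\<^sub>m n" "B * A = 1\<^sub>m n"
    using det_non_zero_imp_unit[OF assms, of "()"] by (auto simp: Units_def ring_mat_def)
  then show ?thesis using A by (auto simp: invertible_mat_def inverts_mat_def)
qed

text \<open>The vectors \<open>vA\<close>, \<open>vB\<close>, \<open>vC\<close> are those of \<open>triangle_vec\<close> in the scalings of the three corners, and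
  \<open>FA\<close>, \<open>FB\<close>, \<open>FC\<close> are the bases along one side at each corner.  As \<open>FA = A FB\<close>, \<open>FB = B FC\<close> and
  \<open>FC = C FA\<close> with \<open>FA = 1\<close>, the product of \<open>A\<close>, \<open>B\<close>, \<open>C\<close> is \<open>1\<close>.\<close>

theorem matrices_of_rational_hive:
  fixes g :: "nat \<Rightarrow> nat \<Rightarrow> nat \<Rightarrow> rat"
  assumes len: "length \<alpha> = n" "length \<beta> = n" "length \<gamma> = n"
    and sorted: "sorted_wrt (\<ge>) \<alpha>" "sorted_wrt (\<ge>) \<beta>" "sorted_wrt (\<ge>) \<gamma>"
    and hive: "hive n (\<lambda>i j k. of_rat (g i j k))"
    and bd: "hive_boundary n (\<lambda>i j k. of_rat (g i j k)) = (map of_rat \<alpha>, map of_rat \<beta>, map of_rat \<gamma>)"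
  obtains A B C sA sB sC where "A \<in> carrier_mat n n" "B \<in> carrier_mat n n" "C \<in> carrier_mat n n"
    "det A \<noteq> 0" "det B \<noteq> 0" "det C \<noteq> 0" "A * B * C = 1\<^sub>m n"
    "is_Sing A sA" "is_Sing B sB" "is_Sing C sC"
    "map lead_exp sA = \<alpha>" "map lead_exp sB = \<beta>" "map lead_exp sC = \<gamma>"
proof -
  have rat_le: "a + b \<le> c + d" if "real_of_rat a + of_rat b \<le> of_rat c + of_rat d" for a b c d
    using that by (simp add: of_rat_less_eq flip: of_rat_add)
  have H1: "g i j (k + 2) + g (i + 1) (j + 1) k \<le> g (i + 1) j (k + 1) + g i (j + 1) (k + 1)"
    and H2: "g i (j + 2) k + g (i + 1) j (k + 1) \<le> g (i + 1) (j + 1) k + g i (j + 1) (k + 1)"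
    and H3: "g (i + 2) j k + g i (j + 1) (k + 1) \<le> g (i + 1) (j + 1) k + g (i + 1) j (k + 1)"
    if "i + j + k + 2 = n" for i j k
  proof -
    note h = hive[unfolded hive_def]
    show "g i j (k + 2) + g (i + 1) (j + 1) k \<le> g (i + 1) j (k + 1) + g i (j + 1) (k + 1)"
      using conjunct1[OF h, rule_format, of i j "k + 2"] that by (intro rat_le) simp
    show "g i (j + 2) k + g (i + 1) j (k + 1) \<le> g (i + 1) (j + 1) k + g i (j + 1) (k + 1)"
      using conjunct1[OF conjunct2[OF h], rule_format, of i "j + 2" k] that by (intro rat_le) simp
    show "g (i + 2) j k + g i (j + 1) (k + 1) \<le> g (i + 1) (j + 1) k + g (i + 1) j (k + 1)"
      using conjunct2[OF conjunct2[OF h], rule_format, of "i + 2" j k] that by (intro rat_le) simp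
  qed
  have inj: "a = b" if "real_of_rat a = of_rat b" for a b using that by simp
  have bdA: "g (n - 1 - r) (r + 1) 0 - g (n - r) r 0 = \<alpha> ! r"
    and bdB: "g 0 (n - 1 - r) (r + 1) - g 0 (n - r) r = \<beta> ! r"
    and bdC: "g (r + 1) 0 (n - 1 - r) - g r 0 (n - r) = \<gamma> ! r" if "r < n" for r
    using bd that len unfolding hive_boundary_def prod.inject list_eq_iff_nth_eq
    by (intro inj; simp add: of_rat_diff)+
  have mono: "xs ! j \<le> xs ! i" if "sorted_wrt (\<ge>) xs" "length xs = n" "i \<le> j" "j < n" for xs :: "rat list" and i j
    using sorted_wrt_nth_less[OF that(1), of i j] that by (cases "i = j") auto
  define D where "D = (\<lambda>i j k. tpow (g i j k))"
  have D: "D i j k \<noteq> 0" "lead_exp (D i j k) = g i j k" for i j k by (simp_all add: D_def)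
  define w where "w = triangle_vec D"
  have rel: "D i (j + 1) (k + 1) * w (i + 1) j k q + D (i + 1) j (k + 1) * w i (j + 1) k q
      + D (i + 1) (j + 1) k * w i j (k + 1) q = 0" for i j k q
    using triangle_relation[of D i j k q] D(1) by (simp add: w_def)
  define vA where "vA = (\<lambda>i j q. w i j (n - 1 - i - j) q / D (i + 1) j (n - 1 - i - j))"
  define vB where "vB = (\<lambda>j k q. w (n - 1 - j - k) j k q / D (n - 1 - j - k) (j + 1) k)"
  define vC where "vC = (\<lambda>k i q. w i (n - 1 - k - i) k q / D i (n - 1 - k - i) (k + 1))"
  define FA FB FC where "FA = mat n n (\<lambda>(r,q). vA r 0 q)" "FB = mat n n (\<lambda>(r,q). vB r 0 q)"
    "FC = mat n n (\<lambda>(r,q). vC r 0 q)"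
  have relA: "\<exists>d. exp_le d 0 \<and> vA i (Suc j) = (\<lambda>q. - vA i j q + d * vA (Suc i) j q)" if "i + j + 1 < n" for i j
  proof -
    define k where "k = n - 2 - i - j"
    have k: "n - 1 - i - Suc j = k" "n - 1 - Suc i - j = k" "n - 1 - i - j = k + 1" "i + j + k + 2 = n"
      using that by (auto simp: k_def)
    show ?thesis
      unfolding vA_def k(1-3)
      using normalized_relation[OF rel[of i j k], of "D (i + 1 + 1) j k"] D H3[OF k(4)] by simp
  qed
  have relB: "\<exists>d. exp_le d 0 \<and> vB j (Suc k) = (\<lambda>q. - vB j k q + d * vB (Suc j) k q)" if "j + k + 1 < n" for j k
  proof -
    define i where "i = n - 2 - j - k"
    have i: "n - 1 - j - Suc k = i" "n - 1 - Suc j - k = i" "n - 1 - j - k = i + 1" "i + j + k + 2 = n"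
      using that by (auto simp: i_def)
    have rel': "D (i + 1) j (k + 1) * w i (j + 1) k q + D (i + 1) (j + 1) k * w i j (k + 1) q
      + D i (j + 1) (k + 1) * w (i + 1) j k q = 0" for q using rel[of i j k q] by (simp add: add_ac)
    show ?thesis
      unfolding vB_def i(1-3)
      using normalized_relation[OF rel', of "D i (j + 1 + 1) k"] D H2[OF i(4)] by simp
  qed
  have relC: "\<exists>d. exp_le d 0 \<and> vC k (Suc i) = (\<lambda>q. - vC k i q + d * vC (Suc k) i q)" if "k + i + 1 < n" for k i
  proof -
    define j where "j = n - 2 - k - i"
    have j: "n - 1 - k - Suc i = j" "n - 1 - Suc k - i = j" "n - 1 - k - i = j + 1" "i + j + k + 2 = n"
      using that by (auto simp: j_def)
    have rel': "D (i + 1) (j + 1) k * w i j (k + 1) q + D i (j + 1) (k + 1) * w (i + 1) j k q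
      + D (i + 1) j (k + 1) * w i (j + 1) k q = 0" for q using rel[of i j k q] by (simp add: add_ac)
    show ?thesis
      unfolding vC_def j(1-3)
      using normalized_relation[OF rel', of "D i j (k + 1 + 1)"] D H1[OF j(4)] by simp
  qed
  define xA where "xA = (\<lambda>r. D (n - 1 - r) (r + 1) 0 / D (n - r) r 0)"
  define xB where "xB = (\<lambda>r. D 0 (n - 1 - r) (r + 1) / D 0 (n - r) r)"
  define xC where "xC = (\<lambda>r. D (r + 1) 0 (n - 1 - r) / D r 0 (n - r))"
  have x0: "xA r \<noteq> 0" "xB r \<noteq> 0" "xC r \<noteq> 0" for r using D(1) by (auto simp: xA_def xB_def xC_def)
  have lx: "lead_exp (xA r) = \<alpha> ! r" "lead_exp (xB r) = \<beta> ! r" "lead_exp (xC r) = \<gamma> ! r" if "r < n" for r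
    using bdA[OF that] bdB[OF that] bdC[OF that] D by (simp_all add: xA_def xB_def xC_def lead_exp_divide)
  have links: "vA (n - 1 - r) r = (\<lambda>q. xA r * vB r 0 q)" "vB (n - 1 - r) r = (\<lambda>q. xB r * vC r 0 q)"
    "vC (n - 1 - r) r = (\<lambda>q. xC r * vA r 0 q)" if r: "r < n" for r
  proof -
    have s: "n - 1 - (n - 1 - r) - r = 0" "n - 1 - r + 1 = n - r" "n - 1 - r - 0 = n - 1 - r" using r by auto
    show "vA (n - 1 - r) r = (\<lambda>q. xA r * vB r 0 q)" "vB (n - 1 - r) r = (\<lambda>q. xB r * vC r 0 q)"
      "vC (n - 1 - r) r = (\<lambda>q. xC r * vA r 0 q)"
      unfolding vA_def vB_def vC_def xA_def xB_def xC_def s using D(1) by (auto simp: fun_eq_iff)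
  qed
  have FA: "FA = 1\<^sub>m n"
    by (rule eq_matI) (auto simp: FA_FB_FC_def vA_def w_def D(1))
  have detFA: "det FA \<noteq> 0" by (simp add: FA)
  have F: "FB \<in> carrier_mat n n" "FC \<in> carrier_mat n n" by (simp_all add: FA_FB_FC_def)
  have decr: "lead_exp (xA j) \<le> lead_exp (xA i)" "lead_exp (xB j) \<le> lead_exp (xB i)"
    "lead_exp (xC j) \<le> lead_exp (xC i)" if "i \<le> j" "j < n" for i j
    using mono[OF sorted(1) len(1) that] mono[OF sorted(2) len(2) that] mono[OF sorted(3) len(3) that] that
    by (simp_all add: lx)
  obtain A sA where A: "A \<in> carrier_mat n n" "FA = A * FB" "det A \<noteq> 0" "is_Sing A sA"
      "map lead_exp sA = map (\<lambda>i. lead_exp (xA i)) [0..<n]"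
    by (rule corner_matrix[of n vA xA "\<lambda>r. vB r 0" FA, folded FA_FB_FC_def];
      (erule relA | erule links | rule x0 | erule (1) decr | rule refl | rule detFA | rule that))
  have detFB: "det FB \<noteq> 0" using detFA unfolding A(2) det_mult[OF A(1) F(1)] by auto
  obtain B sB where B: "B \<in> carrier_mat n n" "FB = B * FC" "det B \<noteq> 0" "is_Sing B sB"
      "map lead_exp sB = map (\<lambda>i. lead_exp (xB i)) [0..<n]"
    by (rule corner_matrix[of n vB xB "\<lambda>r. vC r 0" FB, folded FA_FB_FC_def];
      (erule relB | erule links | rule x0 | erule (1) decr | rule refl | rule detFB | rule that))
  have detFC: "det FC \<noteq> 0" using detFB unfolding B(2) det_mult[OF B(1) F(2)] by auto
  obtain C sC where C: "C \<in> carrier_mat n n" "FC = C * FA" "det C \<noteq> 0" "is_Sing C sC"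
      "map lead_exp sC = map (\<lambda>i. lead_exp (xC i)) [0..<n]"
    by (rule corner_matrix[of n vC xC "\<lambda>r. vA r 0" FC, folded FA_FB_FC_def];
      (erule relC | erule links | rule x0 | erule (1) decr | rule refl | rule detFC | rule that))
  have "A * B * C = 1\<^sub>m n"
  proof -
    have "A * B * C = A * (B * C)" by (rule assoc_mult_mat[OF A(1) B(1) C(1)])
    also have "B * C = FB" using B(2) C(1,2) FA by simp
    finally show ?thesis using A(2) FA by simp
  qed
  moreover have "map lead_exp sA = \<alpha>" "map lead_exp sB = \<beta>" "map lead_exp sC = \<gamma>"
    unfolding A(5) B(5) C(5) using len by (auto intro!: nth_equalityI simp: lx)
  ultimately show ?thesis using that A B C by blast
qed

theorem theorem15:
  fixes n :: nat and \<alpha> \<beta> \<gamma> :: "rat list"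
  assumes "length \<alpha> = n" "length \<beta> = n" "length \<gamma> = n"
    and "sorted_wrt (\<ge>) \<alpha>" "sorted_wrt (\<ge>) \<beta>" "sorted_wrt (\<ge>) \<gamma>"
  shows "(\<exists>A B C :: puiseux mat.
            A \<in> carrier_mat n n \<and> B \<in> carrier_mat n n \<and> C \<in> carrier_mat n n \<and>
            invertible_mat A \<and> invertible_mat B \<and> invertible_mat C \<and>
            A * B * C = 1\<^sub>m n \<and>
            (\<exists>sA sB sC. is_Sing A sA \<and> is_Sing B sB \<and> is_Sing C sC \<and>
               map lead_exp sA = \<alpha> \<and> map lead_exp sB = \<beta> \<and> map lead_exp sC = \<gamma>)) \<longleftrightarrow>
         (\<exists>h. hive n h \<and>
            hive_boundary n h = (map of_rat \<alpha>, map of_rat \<beta>, map of_rat \<gamma>))"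
    (is "?matrices \<longleftrightarrow> ?hive")
proof
  assume ?matrices
  then obtain A B C sA sB sC where "A \<in> carrier_mat n n" "B \<in> carrier_mat n n" "C \<in> carrier_mat n n"
    "A * B * C = 1\<^sub>m n" "is_Sing A sA" "is_Sing B sB" "is_Sing C sC"
    and l: "map lead_exp sA = \<alpha>" "map lead_exp sB = \<beta>" "map lead_exp sC = \<gamma>"
    by blast
  then show ?hive using hive_of_singular_values[of A n B C sA sB sC] by (simp flip: l)
next
  assume ?hive
  then obtain h where "hive n h" "hive_boundary n h = (map of_rat \<alpha>, map of_rat \<beta>, map of_rat \<gamma>)"
    by blast
  then obtain g :: "nat \<Rightarrow> nat \<Rightarrow> nat \<Rightarrow> rat" where "hive n (\<lambda>i j k. of_rat (g i j k))"
    "hive_boundary n (\<lambda>i j k. of_rat (g i j k)) = (map of_rat \<alpha>, map of_rat \<beta>, map of_rat \<gamma>)"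
    by (rule rational_hive_exists)
  then obtain A B C sA sB sC where ABC: "A \<in> carrier_mat n n" "B \<in> carrier_mat n n" "C \<in> carrier_mat n n"
    and det: "det A \<noteq> 0" "det B \<noteq> 0" "det C \<noteq> 0" and "A * B * C = 1\<^sub>m n"
    and S: "is_Sing A sA" "is_Sing B sB" "is_Sing C sC"
    "map lead_exp sA = \<alpha>" "map lead_exp sB = \<beta>" "map lead_exp sC = \<gamma>"
    by (rule matrices_of_rational_hive[OF assms])
  moreover have "invertible_mat A" "invertible_mat B" "invertible_mat C"
    by (rule det_nonzero_imp_invertible_mat[OF ABC(1) det(1)] det_nonzero_imp_invertible_mat[OF ABC(2) det(2)]
      det_nonzero_imp_invertible_mat[OF ABC(3) det(3)])+
  moreover have "\<exists>sA sB sC. is_Sing A sA \<and> is_Sing B sB \<and> is_Sing C sC \<and>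
      map lead_exp sA = \<alpha> \<and> map lead_exp sB = \<beta> \<and> map lead_exp sC = \<gamma>"
    by (intro exI[of _ sA] exI[of _ sB] exI[of _ sC] conjI S)
  ultimately show ?matrices
    by (intro exI[of _ A] exI[of _ B] exI[of _ C] conjI)
qed

end
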